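(* Let $P_{\lambda,\delta}$ be the spectral projector on the Euclidean cylinder $\mathbb{T}\times\mathbb{R}=(\mathbb{R}/\mathbb{Z})\times\mathbb{R}$ defined in the context, and let $p>2$. If $\lambda>1$ and $0<\delta<1$, then for every $\epsilon>0$ $$\| P_{\lambda,\delta} \|_{L^2 \to L^p} \lesssim_\epsilon \lambda^\epsilon \delta^{-\epsilon} \left[ \lambda^{\frac{1}{2} - \frac{2}{p}} \delta^{\frac{1}{2}} + \left( \lambda \delta \right)^{\frac{1}{4} - \frac{1}{2p}} \right].$$ Furthermore, this estimate is optimal, up to the subpolynomial factor $\lambda^\epsilon \delta^{-\epsilon}$ and the multiplicative constant.
   Context: Coordinates on $\mathbb{T}\times\mathbb{R}$ are $(x,y)$ with $x\in[0,1]$ (periodic) and $y\in\mathbb{R}$, and the Laplacian is $\Delta=\partial_x^2+\partial_y^2$. A function $f$ on $\mathbb{T}\times\mathbb{R}$ is expanded by Fourier series in $x$ and Fourier transform in $y$: $f(x,y)=\sum_{k\in\mathbb{Z}}\int_{\mathbb{R}}\widehat f(k,\eta)e^{2\pi i(kx+\eta y)}\,d\eta$. With $\chi$ a fixed cutoff function on $\mathbb{R}$ (whose precise choice is irrelevant), the spectral projector $P_{\lambda,\delta}=\chi\big((\sqrt{-\Delta}-\lambda)/\delta\big)$ is expressed as the Fourier multiplier $$P_{\lambda,\delta}f(x,y)=\sum_{k\in\mathbb{Z}}\int_{\mathbb{R}}\chi\left(\frac{\sqrt{k^2+\eta^2}-\lambda}{\delta}\right)\widehat f(k,\eta)e^{2\pi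 i(kx+\eta y)}\,d\eta$$ (the factor $2\pi$ being normalized away). The norm $\|\cdot\|_{L^2\to L^p}$ is the operator norm from $L^2(\mathbb{T}\times\mathbb{R})$ to $L^p(\mathbb{T}\times\mathbb{R})$, and $A\lesssim_\epsilon B$ means $A\le C_\epsilon B$ with a constant $C_\epsilon$ depending on $\epsilon$ but not on $\lambda$ or $\delta$. *)

theory Defs
  imports "HOL-Probability.Essential_Supremum"
begin

(* The cylinder (R/Z) x R as a measure space: a function on it is represented by its restriction
   to one period 0 <= x <= 1, the two endpoints being a null set. *)
definition cylinder :: "(real \<times> real) measure" where
  "cylinder = restrict_space lborel {0..1} \<Otimes>\<^sub>M lborel"

(* The (extended) Lp norm, for exponents p > 0 including p = infinity. *)
definition Lp_norm :: "'a measure \<Rightarrow> ennreal \<Rightarrow> ('a \<Rightarrow> complex) \<Rightarrow> ennreal" where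
  "Lp_norm M p f =
     (if p = \<infinity> then esssup M (\<lambda>z. ennreal (cmod (f z)))
      else let I = (\<integral>\<^sup>+ z. ennreal (cmod (f z) powr enn2real p) \<partial>M)
           in if I = \<infinity> then \<infinity> else ennreal (enn2real I powr (1 / enn2real p)))"

definition Lp_space :: "'a measure \<Rightarrow> ennreal \<Rightarrow> ('a \<Rightarrow> complex) set" where
  "Lp_space M p = {f \<in> borel_measurable M. Lp_norm M p f < \<infinity>}"

(* Operator norm from L^2 to L^p over the cylinder; it is infinite for an unbounded operator. *)
definition op_norm_L2_Lp ::
    "ennreal \<Rightarrow> ((real \<times> real \<Rightarrow> complex) \<Rightarrow> (real \<times> real \<Rightarrow> complex)) \<Rightarrow> ennreal" where
  "op_norm_L2_Lp p T =
     (SUP f \<in> {f \<in> Lp_space cylinder 2. Lp_norm cylinder 2 f \<le> 1}. Lp_norm cylinder p (T f))"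

definition fourier_coeff_x :: "(real \<times> real \<Rightarrow> complex) \<Rightarrow> int \<Rightarrow> real \<Rightarrow> complex" where
  "fourier_coeff_x f k y =
     (LINT x|restrict_space lborel {0..1}. f (x, y) * cis (- 2 * pi * of_int k * x))"

(* Fourier transform on L^2(R) in Plancherel's sense, as the L^2 limit of the transforms of the
   truncations h * 1_[-N,N]. It is determined up to null sets only; SOME picks a representative. *)
definition fourier_transform_L2 :: "(real \<Rightarrow> complex) \<Rightarrow> real \<Rightarrow> complex" where
  "fourier_transform_L2 h =
     (SOME g. g \<in> Lp_space lborel 2 \<and>
        (\<lambda>N::nat. Lp_norm lborel 2
           (\<lambda>\<eta>. (LINT y:{- real N..real N}|lborel. h y * cis (- 2 * pi * \<eta> * y)) - g \<eta>))
        \<longlonglongrightarrow> 0)"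

definition fourier_cyl :: "(real \<times> real \<Rightarrow> complex) \<Rightarrow> int \<Rightarrow> real \<Rightarrow> complex" where
  "fourier_cyl f k = fourier_transform_L2 (fourier_coeff_x f k)"

definition cutoff :: "(real \<Rightarrow> real) \<Rightarrow> bool" where
  "cutoff chi \<longleftrightarrow>
     (\<forall>n. (deriv ^^ n) chi differentiable_on UNIV) \<and>
     compact (closure {t. chi t \<noteq> 0}) \<and>
     (\<forall>t. 0 \<le> chi t \<and> chi t \<le> 1) \<and>
     (\<forall>\<^sub>F t in nhds 0. chi t = 1)"

(* For a cutoff, only finitely many k contribute, and each integrand has bounded support. *)
definition spectral_projector ::
    "(real \<Rightarrow> real) \<Rightarrow> real \<Rightarrow> real \<Rightarrow> (real \<times> real \<Rightarrow> complex) \<Rightarrow> (real \<times> real \<Rightarrow> complex)" where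
  "spectral_projector chi lam \<delta> f = (\<lambda>(x, y).
     \<Sum>\<^sub>\<infinity>k::int. (LINT \<eta>|lborel.
       of_real (chi ((sqrt ((of_int k)\<^sup>2 + \<eta>\<^sup>2) - lam) / \<delta>)) * fourier_cyl f k \<eta>
         * cis (2 * pi * (of_int k * x + \<eta> * y))))"

(* The quotients are formed in ennreal, so that 2 / p and 1 / (2 * p) vanish at p = infinity. *)
definition projector_bound :: "ennreal \<Rightarrow> real \<Rightarrow> real \<Rightarrow> real" where
  "projector_bound p lam \<delta> =
     lam powr (1 / 2 - enn2real (2 / p)) * \<delta> powr (1 / 2)
       + (lam * \<delta>) powr (1 / 4 - enn2real (1 / (2 * p)))"

(* The bound projector_bound is attained, up to a constant, by some lam' in every window
   [lam, lam + 1], uniformly in delta. A lower bound at every single lam would be false: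
   for fixed lam outside the integers the L^2 to L^p norm is O(delta^(1/2 - 1/p)) as delta
   tends to 0. *)
definition projector_bound_optimal :: "(real \<Rightarrow> real) \<Rightarrow> ennreal \<Rightarrow> bool" where
  "projector_bound_optimal chi p \<longleftrightarrow>
     (\<exists>c>0. \<forall>lam>1. \<exists>lam'\<in>{lam..lam + 1}. \<forall>\<delta>. 0 < \<delta> \<and> \<delta> < 1 \<longrightarrow>
        ennreal (c * projector_bound p lam' \<delta>) \<le> op_norm_L2_Lp p (spectral_projector chi lam' \<delta>))"

end

(*
  Upper bound. Let F = P f with ||f||_2 <= 1, let E be a subset of {|F| > a} and g = sgn(F) 1_E. Duality gives
  a^2 |E|^2 <= C Sum_k Int m_k(eta)^2 |ghat_k(eta)|^2 d(eta), where m_k is the symbol of P on the k-th line.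
  The O(1) lines with |k| close to lam are estimated trivially. The others are grouped dyadically, M <= lam - |k| < 2M;
  there m_k lives on two intervals of length about l = delta sqrt(lam/M) centred at +-sqrt(lam^2 - k^2) and is dominated by
  Gaussians of width l. From these one subtracts a flat multiple of wider Gaussians, of width 1/r with r = rho sqrt M:
  the wide part is controlled by Bessel's inequality, while the kernel of the difference vanishes near y = 0, and away
  from y = 0 van der Corput's second derivative test bounds the exponential sum over k. Optimising in rho gives
  |E| <= C (log lam)^3 delta^3 lam a^(-6) once a^2 exceeds C log(lam) sqrt(lam delta). Together with
  |E| <= 2 a^(-2) and the sup bound on F, integrating over the level sets gives every p > 2 at once, without
  interpolation and with only logarithmic losses.

  Lower bound, at integers lam. A sum of Gaussian wave packets focusing at the origin, one for each k in {0..lam} with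
  frequency sqrt(lam^2 - k^2) and width delta, gives the first term; a single wave packet at k = lam with frequency 0 and
  width sqrt(lam delta) gives the second.
*)
theory Submission
  imports Defs "HOL-Probability.Probability"
begin

section \<open>The Kusmin-Landau inequality\<close>

section \<open>Exponential sums\<close>

text \<open>On a dyadic block the second differences of \<open>sqrt (lam^2 - k^2)\<close> are
  comparable to \<open>L = sqrt lam / (M * sqrt M)\<close>, so that at \<open>y = t\<close> the
  exponential sum is bounded by a multiple of \<open>M * u + 1 / u\<close> with
  \<open>u = sqrt (\<bar>t\<bar> * L)\<close>. The decay of the kernel beyond
  \<open>\<bar>t\<bar> = 1 / l\<close> tames the first part; the second is singular at
  \<open>t = 0\<close>, where the phases in \<open>y\<close> give no cancellation, and this dictates
  that the kernel vanish there. The scaling of \<open>r\<close> comes from uniformity in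
  \<open>M\<close>: the quantities \<open>M^2 * l * L = lam * \<delta>\<close>,
  \<open>l^2 / (r * L) = \<delta>^2 * sqrt lam / \<rho>\<close> and
  \<open>l * r = \<delta> * \<rho> * sqrt lam\<close> are free of \<open>M\<close>, so all blocks
  obey one bound and their sum costs only a logarithm. Gaussians serve as majorants because they and
  their transforms are explicit and positive, whatever the cutoff. In the lower bound, an integer
  \<open>lam\<close> makes the line \<open>k = lam\<close> tangent to the circle of radius
  \<open>lam\<close>; the annulus meets that line in an interval of length about
  \<open>sqrt (lam * \<delta>)\<close> instead of \<open>\<delta>\<close>, which is the source of
  the second term.\<close>

lemma sin_pi_lower:
  fixes t \<theta> :: real
  assumes "0 < \<theta>" "\<theta> \<le> t" "t \<le> 1 - \<theta>"
  shows "\<theta> \<le> sin (pi * t)"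
proof -
  \<comment> \<open>Below \<open>pi / 3\<close> this is \<open>x * cos x \<le> sin x\<close> with
    \<open>cos x \<ge> 1 / 2\<close>; above it, \<open>sin x \<ge> sqrt 3 / 2 \<ge> 0.85\<close>
    beats \<open>x / 2 \<le> 0.8\<close>.\<close>
  have half: "x / 2 \<le> sin x" if "0 \<le> x" "x \<le> pi / 2" for x :: real
  proof (cases "x \<le> pi / 3")
    case True
    have "x * cos x \<le> sin x"
    proof -
      have "((\<lambda>x. sin x - x * cos x) has_real_derivative (x * sin x)) (at x)" for x :: real
        by (auto intro!: derivative_eq_intros)
      moreover have "x * sin x \<ge> 0" if "0 \<le> x" "x \<le> pi / 3" for x
        using that by (intro mult_nonneg_nonneg sin_ge_zero) auto
      ultimately have "sin 0 - 0 * cos 0 \<le> sin x - x * cos x"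
        using that True by (intro DERIV_nonneg_imp_nondecreasing[of 0 x "\<lambda>x. sin x - x * cos x"]) (auto, force)
      thus ?thesis by simp
    qed
    moreover have "cos (pi/3) \<le> cos x"
      using that True by (intro cos_monotone_0_pi_le) auto
    hence "x * (1/2) \<le> x * cos x" using that by (intro mult_left_mono) (auto simp: cos_60)
    ultimately show ?thesis by simp
  next
    case False
    have "sin (pi / 3) \<le> sin x" using that False by (intro sin_monotone_2pi_le) auto
    moreover have "sqrt 3 / 2 \<ge> 0.85" 
      using real_le_rsqrt[of "1.7" 3] by (simp add: power2_eq_square)
    moreover have "x \<le> 1.6" using that pi_approx by simp
    ultimately show ?thesis by (simp add: sin_60)
  qed
  have "\<theta> \<le> pi * \<theta> / 2" using assms pi_ge_two by simp
  show ?thesis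
  proof (cases "t \<le> 1/2")
    case True
    have "(pi * t) / 2 \<le> sin (pi * t)" using assms True by (intro half) auto
    moreover have "pi * \<theta> / 2 \<le> pi * t / 2" using assms by simp
    ultimately show ?thesis using \<open>\<theta> \<le> pi * \<theta> / 2\<close> by linarith
  next
    case False
    have "(pi * (1 - t)) / 2 \<le> sin (pi * (1 - t))" using assms False by (intro half) auto
    moreover have "pi * \<theta> / 2 \<le> pi * (1 - t) / 2" using assms by simp
    moreover have "sin (pi * (1 - t)) = sin (pi * t)" by (simp add: algebra_simps sin_diff)
    ultimately show ?thesis using \<open>\<theta> \<le> pi * \<theta> / 2\<close> by linarith
  qed
qed

text \<open>The difference of two cotangents is \<open>sin (pi * (t - s))\<close> over a positive
  product. Monotonicity lets the total variation of the coefficients in \<open>kusmin_landau\<close>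
  telescope.\<close>

lemma cot_antimono_pi:
  fixes s t :: real
  assumes "0 < s" "s \<le> t" "t < 1"
  shows "cot (pi * t) \<le> cot (pi * s)"
proof -
  have "pi * s < pi * 1" "pi * t < pi * 1" "pi * (t - s) \<le> pi * 1" "0 < pi * s" "0 < pi * t" "0 \<le> pi * (t - s)"
    using assms by (auto simp del: mult_1_right intro!: mult_strict_left_mono mult_left_mono)
  hence s: "sin (pi * s) > 0" "sin (pi * t) > 0" "sin (pi * (t - s)) \<ge> 0"
    by (auto intro!: sin_gt_zero sin_ge_zero)
  have "cot (pi * s) - cot (pi * t) = sin (pi * (t - s)) / (sin (pi * s) * sin (pi * t))"
    using s by (simp add: cot_def field_simps sin_diff)
  also have "\<dots> \<ge> 0" using s by simp
  finally show ?thesis by simp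
qed

text \<open>With d i the i-th increment, E i = cis (2 pi phi i) and c i = 1 / (1 - cis (2 pi d i)), one has E i = c i (E i - E (i+1));
  summation by parts then applies because c i = 1/2 + (i/2) cot (pi d i) has monotone imaginary part.\<close>

lemma kusmin_landau:
  fixes \<phi> :: "nat \<Rightarrow> real" and m :: int
    and \<theta> :: real
  assumes \<theta>: "0 < \<theta>"
    and range: "\<And>i. i < n \<Longrightarrow> m + \<theta> \<le> \<phi> (Suc i) - \<phi> i \<and> \<phi> (Suc i) - \<phi> i \<le> m + 1 - \<theta>"
    and mono: "\<And>i. Suc i < n \<Longrightarrow> \<phi> (Suc i) - \<phi> i \<le> \<phi> (Suc (Suc i)) - \<phi> (Suc i)"
  shows "norm (\<Sum>i<n. cis (2 * pi * \<phi> i)) \<le> 2 / \<theta>"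
proof (cases n)
  case 0
  thus ?thesis using \<theta> by simp
next
  case (Suc n')
  define d where "d i = \<phi> (Suc i) - \<phi> i - m" for i
  define E where "E i = cis (2 * pi * \<phi> i)" for i
  define c where "c i = Complex (1/2) (cot (pi * d i) / 2)" for i
  have d: "\<theta> \<le> d i" "d i \<le> 1 - \<theta>" if "i < n" for i using range[OF that] by (auto simp: d_def)
  have dmono: "d i \<le> d (Suc i)" if "Suc i < n" for i using mono[OF that] by (simp add: d_def)
  have sin: "\<theta> \<le> sin (pi * d i)" if "i < n" for i
    using d[OF that] \<theta> by (intro sin_pi_lower) auto
  \<comment> \<open>Removing the integer \<open>m\<close> from the increments leaves the
    exponentials unchanged.\<close>
  have EE: "E (Suc i) = E i * cis (2 * pi * d i)" for i
  proof -
    have "E i * cis (2 * pi * d i) = cis (2 * pi * \<phi> (Suc i) - 2 * pi * m)"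
      by (simp add: E_def cis_mult d_def algebra_simps)
    also have "\<dots> = cis (2 * pi * \<phi> (Suc i))"
      by (simp add: complex_eq_iff cos_diff sin_diff)
    finally show ?thesis by (simp add: E_def)
  qed
  have cE: "c i * (E i - E (Suc i)) = E i" if "i < n" for i
  proof -
    have s0: "sin (pi * d i) \<noteq> 0" using sin[OF that] \<theta> by auto
    have s2: "1 - cos (2 * (pi * d i)) = 2 * sin (pi * d i) * sin (pi * d i)"
      "sin (2 * (pi * d i)) = 2 * sin (pi * d i) * cos (pi * d i)"
      by (simp_all add: cos_double_sin sin_double power2_eq_square)
    have sq: "cos (pi * d i) * cos (pi * d i) = 1 - sin (pi * d i) * sin (pi * d i)"
      using sin_cos_squared_add[of "pi * d i"] by (simp add: power2_eq_square)
    have "c i * (1 - cis (2 * (pi * d i))) = Complex (1/2) (cot (pi * d i) / 2) *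
      Complex (2 * sin (pi * d i) * sin (pi * d i)) (- (2 * sin (pi * d i) * cos (pi * d i)))"
      unfolding c_def using s2 by (simp add: complex_eq_iff)
    also have "\<dots> = 1"
      using s0 sq by (simp add: complex_eq_iff cot_def)
    finally have "c i * (1 - cis (2 * (pi * d i))) = 1" .
    hence "E i * (c i * (1 - cis (2 * pi * d i))) = E i" by (simp add: mult.assoc)
    thus ?thesis by (simp add: EE algebra_simps)
  qed
  \<comment> \<open>The modulus of \<open>c i\<close> is exactly
    \<open>1 / (2 * sin (pi * d i))\<close>, because \<open>1 - cis (2 * pi * d i)\<close> has
    modulus \<open>2 * sin (pi * d i)\<close>.\<close>
  have cnorm: "norm (c i) \<le> 1 / (2 * \<theta>)" if "i < n" for i
  proof -
    have s0: "sin (pi * d i) > 0" using sin[OF that] \<theta> by auto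
    have "norm (c i) ^ 2 = (1 / (2 * sin (pi * d i))) ^ 2"
      using s0 sin_cos_squared_add[of "pi * d i"] unfolding c_def cmod_power2
      by (simp add: cot_def field_simps power2_eq_square)
    hence "norm (c i) = 1 / (2 * sin (pi * d i))" using s0 by (subst (asm) power2_eq_iff_nonneg) auto
    also have "\<dots> \<le> 1 / (2 * \<theta>)" using sin[OF that] \<theta> by (intro divide_left_mono) auto
    finally show ?thesis .
  qed
  have cotb: "\<bar>cot (pi * d i)\<bar> \<le> 1 / \<theta>" if "i < n" for i
  proof -
    have "\<bar>Im (c i)\<bar> \<le> 1 / (2 * \<theta>)" using cnorm[OF that] abs_Im_le_cmod[of "c i"] by linarith
    thus ?thesis by (simp add: c_def)
  qed
  \<comment> \<open>With the boundary term \<open>c j * E (Suc j)\<close> added, each new summand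
    changes the corrected sum only by \<open>(c (Suc j) - c j) * E (Suc j)\<close>. The
    \<open>c j\<close> move down a vertical line, so these changes sum up to half the drop of the
    cotangent.\<close>
  have main: "norm ((\<Sum>i<Suc j. E i) + c j * E (Suc j)) \<le> norm (c 0) + (cot (pi * d 0) - cot (pi * d j)) / 2"
    if "j < n" for j using that
  proof (induction j)
    case 0
    have "E 0 + c 0 * E (Suc 0) = c 0 * E 0" using cE[OF 0] by (simp add: algebra_simps)
    thus ?case by (simp add: norm_mult E_def)
  next
    case (Suc j)
    have "(\<Sum>i<Suc (Suc j). E i) + c (Suc j) * E (Suc (Suc j))
      = ((\<Sum>i<Suc j. E i) + c j * E (Suc j)) + (c (Suc j) - c j) * E (Suc j)"
      using cE[OF Suc.prems] by (simp add: algebra_simps)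
    moreover have "norm ((c (Suc j) - c j) * E (Suc j)) = (cot (pi * d j) - cot (pi * d (Suc j))) / 2"
    proof -
      have "cot (pi * d (Suc j)) \<le> cot (pi * d j)"
        using d[of j] d[of "Suc j"] dmono[of j] \<theta> Suc.prems by (intro cot_antimono_pi) auto
      moreover have "c (Suc j) - c j = Complex 0 ((cot (pi * d (Suc j)) - cot (pi * d j)) / 2)"
        by (simp add: c_def complex_eq_iff)
      ultimately have "norm (c (Suc j) - c j) = (cot (pi * d j) - cot (pi * d (Suc j))) / 2"
        by (simp add: cmod_def)
      thus ?thesis by (simp add: norm_mult E_def)
    qed
    ultimately have "norm ((\<Sum>i<Suc (Suc j). E i) + c (Suc j) * E (Suc (Suc j)))
      \<le> norm ((\<Sum>i<Suc j. E i) + c j * E (Suc j)) + (cot (pi * d j) - cot (pi * d (Suc j))) / 2"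
      by (metis norm_triangle_ineq)
    thus ?case using Suc.IH Suc.prems by (simp add: field_simps)
  qed
  have "n' < n" "0 < n" using Suc by auto
  \<comment> \<open>The budget is \<open>1 / (2 * \<theta>)\<close> for the first coefficient,
    \<open>1 / \<theta>\<close> for the variation and \<open>1 / (2 * \<theta>)\<close> for the last
    boundary term.\<close>
  have arith: "X + y \<le> (1 / (2*\<theta>) + (1/\<theta> + 1/\<theta>) / 2) + 1 / (2*\<theta>)"
    if "X \<le> x + (a - b) / 2" "y \<le> 1 / (2*\<theta>)" "x \<le> 1 / (2*\<theta>)" "\<bar>b\<bar> \<le> 1/\<theta>" "\<bar>a\<bar> \<le> 1/\<theta>" for X y x a b :: real
  proof -
    define u where "u = 1 / \<theta>"
    have u: "1 / (2 * \<theta>) = u / 2" "1 / \<theta> = u" by (simp_all add: u_def)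
    show ?thesis using that unfolding u abs_le_iff by argo
  qed
  have "norm (\<Sum>i<n. E i) \<le> norm ((\<Sum>i<Suc n'. E i) + c n' * E (Suc n')) + norm (c n' * E (Suc n'))"
    unfolding Suc by (metis add_diff_cancel_right' norm_triangle_ineq4)
  also have "norm (c n' * E (Suc n')) = norm (c n')" by (simp add: norm_mult E_def)
  also have "norm ((\<Sum>i<Suc n'. E i) + c n' * E (Suc n')) + norm (c n')
     \<le> (1 / (2*\<theta>) + (1/\<theta> + 1/\<theta>) / 2) + 1 / (2*\<theta>)"
    by (intro arith[OF main[OF \<open>n' < n\<close>]] cnorm cotb) fact+
  also have "\<dots> = 2 / \<theta>" using \<theta> by (simp add: field_simps)
  finally show ?thesis by (simp add: E_def)
qed

section \<open>Van der Corput's second derivative test\<close>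

text \<open>Only the gap between the smallest and the largest index of \<open>S\<close> matters. The
  lemma counts the indices whose increment is within \<open>\<theta>\<close> of an integer, where
  \<open>kusmin_landau\<close> fails.\<close>

lemma card_separated:
  fixes d :: "nat \<Rightarrow> real"
  assumes "finite S" "\<Lambda> > 0" "\<theta> \<ge> 0"
    and "\<And>i j. i \<in> S \<Longrightarrow> j \<in> S \<Longrightarrow> i \<le> j \<Longrightarrow> real (j - i) * \<Lambda> \<le> \<theta>"
  shows "real (card S) \<le> \<theta> / \<Lambda> + 1"
proof (cases "S = {}")
  case True
  thus ?thesis using assms by simp
next
  case False
  have "S \<subseteq> {Min S..Max S}" using assms(1) by auto
  hence "card S \<le> Suc (Max S) - Min S" using card_mono[of "{Min S..Max S}" S] by simp
  moreover have "Min S \<le> Max S" using False assms(1) by simp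
  moreover have "real (Max S - Min S) * \<Lambda> \<le> \<theta>"
    using assms False by (intro assms(4)) auto
  hence "real (Max S - Min S) \<le> \<theta> / \<Lambda>" using assms by (simp add: field_simps)
  ultimately show ?thesis by linarith
qed

text \<open>The increments grow by at least \<open>\<Lambda>\<close> and at most
  \<open>h * \<Lambda>\<close> per step, hence visit about \<open>h * N * \<Lambda>\<close> unit
  intervals. In each of them the increments away from the integers cost \<open>2 / \<theta>\<close>
  by \<open>kusmin_landau\<close>, and the remaining ones number about
  \<open>2 * \<theta> / \<Lambda>\<close>; \<open>\<theta> = sqrt \<Lambda>\<close> balances the
  two.\<close>

theorem van_der_corput_second_difference:
  fixes \<phi> :: "nat \<Rightarrow> real"
  assumes \<Lambda>: "\<Lambda> > 0" and h: "h \<ge> 1"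
    and second: "\<And>i. Suc i < N \<Longrightarrow> \<Lambda> \<le> \<phi> (Suc (Suc i)) - 2 * \<phi> (Suc i) + \<phi> i \<and>
        \<phi> (Suc (Suc i)) - 2 * \<phi> (Suc i) + \<phi> i \<le> h * \<Lambda>"
  shows "norm (\<Sum>i<N. cis (2 * pi * \<phi> i)) \<le> 5 * h * N * sqrt \<Lambda> + 10 / sqrt \<Lambda>"
\<comment> \<open>For \<open>\<Lambda> > 1 / 4\<close> the trivial bound \<open>N\<close> suffices.
  Otherwise \<open>1 / \<theta> \<ge> 2\<close>, which absorbs the additive constants of the two
  cardinality bounds.\<close>
proof (cases "\<Lambda> \<le> 1 / 4 \<and> N > 0")
  case False
  have "norm (\<Sum>i<N. cis (2 * pi * \<phi> i)) \<le> N"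
    by (rule order_trans[OF norm_sum]) simp
  also have "\<dots> \<le> 5 * h * N * sqrt \<Lambda> + 10 / sqrt \<Lambda>"
  proof (cases "N = 0")
    case False
    hence "1 / 4 \<le> \<Lambda>" using \<open>\<not> (\<Lambda> \<le> 1 / 4 \<and> N > 0)\<close> by simp
    hence "1 / 2 \<le> sqrt \<Lambda>" using real_sqrt_le_mono[of "1/4" \<Lambda>] by (simp add: real_sqrt_divide)
    hence "1 * (1 / 2) \<le> h * sqrt \<Lambda>" using h by (intro mult_mono) auto
    hence "1 * real N \<le> (5 * (h * sqrt \<Lambda>)) * real N" by (intro mult_right_mono) auto
    also have "\<dots> \<le> 5 * h * N * sqrt \<Lambda> + 10 / sqrt \<Lambda>" using \<Lambda> by (simp add: mult_ac)
    finally show ?thesis by simp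
  qed (use \<Lambda> in simp)
  finally show ?thesis .
next
  case True
  hence small: "\<Lambda> \<le> 1 / 4" and N: "N > 0" by auto
  define \<theta> where "\<theta> = sqrt \<Lambda>"
  have \<theta>: "\<theta> > 0" "\<theta> \<le> 1 / 2" "\<theta> * \<theta> = \<Lambda>"
    using \<Lambda> small real_sqrt_le_mono[of \<Lambda> "1/4"] by (simp_all add: \<theta>_def real_sqrt_divide)
  define d where "d i = \<phi> (Suc i) - \<phi> i" for i
  have dstep: "\<Lambda> \<le> d (Suc i) - d i" "d (Suc i) - d i \<le> h * \<Lambda>" if "Suc i < N" for i
    using second[OF that] by (auto simp: d_def)
  have dgap: "real (j - i) * \<Lambda> \<le> d j - d i \<and> d j - d i \<le> real (j - i) * (h * \<Lambda>)" if "i \<le> j" "j < N" for i j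
    using that
  proof (induction j rule: dec_induct)
    case (step j)
    thus ?case using dstep[of j] by (auto simp: Suc_diff_le algebra_simps)
  qed auto
  have dmono: "d i \<le> d j" if "i \<le> j" "j < N" for i j
    using dgap[OF that] \<Lambda> mult_nonneg_nonneg[of "real (j - i)" \<Lambda>] by linarith
  define I where "I m = {i. i < N \<and> \<lfloor>d i\<rfloor> = m}" for m
  have block: "norm (\<Sum>i\<in>I m. cis (2 * pi * \<phi> i)) \<le> 5 / \<theta>" for m
  proof -
    define G where "G = {i. i < N \<and> m + \<theta> \<le> d i \<and> d i \<le> m + 1 - \<theta>}"
    define L where "L = {i. i < N \<and> m \<le> d i \<and> d i < m + \<theta>}"
    define U where "U = {i. i < N \<and> m + 1 - \<theta> < d i \<and> d i < m + 1}"
    have fin: "finite G" "finite L" "finite U" by (auto simp: G_def L_def U_def)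
    have I: "I m = G \<union> (L \<union> U)"
      using \<theta> by (auto simp: I_def G_def L_def U_def floor_eq_iff)
    have GLU: "G \<inter> (L \<union> U) = {}" by (auto simp: G_def L_def U_def)
    have "real (card L) \<le> \<theta> / \<Lambda> + 1"
    proof (rule card_separated)
      fix i j assume "i \<in> L" "j \<in> L" "i \<le> j"
      thus "real (j - i) * \<Lambda> \<le> \<theta>" using dgap[of i j] by (auto simp: L_def)
    qed (use fin \<Lambda> \<theta> in auto)
    moreover have "real (card U) \<le> \<theta> / \<Lambda> + 1"
    proof (rule card_separated)
      fix i j assume "i \<in> U" "j \<in> U" "i \<le> j"
      thus "real (j - i) * \<Lambda> \<le> \<theta>" using dgap[of i j] by (auto simp: U_def)
    qed (use fin \<Lambda> \<theta> in auto)
    moreover have "\<theta> / \<Lambda> = 1 / \<theta>" using \<theta> \<Lambda> by (simp add: field_simps)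
    moreover have "real (card (L \<union> U)) \<le> real (card L) + real (card U)"
      using card_Un_le[of L U] by linarith
    moreover have "2 \<le> 1 / \<theta>" using \<theta> by (simp add: field_simps)
    ultimately have LU: "real (card (L \<union> U)) \<le> 3 / \<theta>" by (simp add: field_simps)
    have LUn: "norm (\<Sum>i\<in>L \<union> U. cis (2 * pi * \<phi> i)) \<le> 3 / \<theta>"
      by (rule order_trans[OF norm_sum]) (use LU in simp)
    have Gn: "norm (\<Sum>i\<in>G. cis (2 * pi * \<phi> i)) \<le> 2 / \<theta>"
    proof (cases "G = {}")
      case False
      define a b where "a = Min G" and "b = Max G"
      have ab: "a \<in> G" "b \<in> G" "a \<le> b" using False fin by (auto simp: a_def b_def)
      \<comment> \<open>The increments are monotone, so the good indices are consecutive and form a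
        shifted sum.\<close>
      have Geq: "G = {a..b}"
      proof
        show "G \<subseteq> {a..b}" using fin by (auto simp: a_def b_def)
        show "{a..b} \<subseteq> G"
        proof
          fix i assume "i \<in> {a..b}"
          thus "i \<in> G" using ab dmono[of a i] dmono[of i b] by (auto simp: G_def)
        qed
      qed
      have "(\<Sum>i\<in>G. cis (2 * pi * \<phi> i)) = (\<Sum>i<Suc b - a. cis (2 * pi * \<phi> (a + i)))"
        unfolding Geq using ab
        by (intro sum.reindex_bij_witness[of _ "\<lambda>i. a + i" "\<lambda>i. i - a"]) auto
      also have "norm \<dots> \<le> 2 / \<theta>"
      proof (rule kusmin_landau[where m = m])
        fix i assume "i < Suc b - a"
        hence "a + i \<in> G" unfolding Geq by auto
        thus "m + \<theta> \<le> \<phi> (a + Suc i) - \<phi> (a + i) \<and> \<phi> (a + Suc i) - \<phi> (a + i) \<le> m + 1 - \<theta>"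
          by (auto simp: G_def d_def)
      next
        fix i assume "Suc i < Suc b - a"
        hence "a + Suc i \<in> G" unfolding Geq by auto
        thus "\<phi> (a + Suc i) - \<phi> (a + i) \<le> \<phi> (a + Suc (Suc i)) - \<phi> (a + Suc i)"
          using dmono[of "a + i" "a + Suc i"] by (auto simp: G_def d_def)
      qed (use \<theta> in auto)
      finally show ?thesis .
    qed (use \<theta> in auto)
    have "(\<Sum>i\<in>I m. cis (2 * pi * \<phi> i)) = (\<Sum>i\<in>G. cis (2 * pi * \<phi> i)) + (\<Sum>i\<in>L \<union> U. cis (2 * pi * \<phi> i))"
      unfolding I using fin GLU by (intro sum.union_disjoint) auto
    also have "norm \<dots> \<le> 2 / \<theta> + 3 / \<theta>" by (intro norm_triangle_mono Gn LUn)
    finally show ?thesis by simp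
  qed
  define ms where "ms = {\<lfloor>d 0\<rfloor>..\<lfloor>d (N - 1)\<rfloor>}"
  have "{..<N} = (\<Union>m\<in>ms. I m)"
    using dmono[of 0] dmono[of _ "N - 1"] N by (fastforce simp: ms_def I_def intro!: floor_mono)
  hence "(\<Sum>i<N. cis (2 * pi * \<phi> i)) = (\<Sum>m\<in>ms. \<Sum>i\<in>I m. cis (2 * pi * \<phi> i))"
    by (simp only:) (rule sum.UNION_disjoint; auto simp: ms_def I_def)
  also have "norm \<dots> \<le> (\<Sum>m\<in>ms. 5 / \<theta>)"
    by (rule order_trans[OF norm_sum sum_mono]) (rule block)
  also have "\<dots> = card ms * (5 / \<theta>)" by simp
  also have "\<dots> \<le> (h * N * \<Lambda> + 2) * (5 / \<theta>)"
  proof (rule mult_right_mono)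
    have "d (N - 1) - d 0 \<le> real (N - 1) * (h * \<Lambda>)" using dgap[of 0 "N - 1"] N by simp
    also have "\<dots> \<le> real N * (h * \<Lambda>)" using h \<Lambda> by (intro mult_right_mono) auto
    finally have "d (N - 1) - d 0 \<le> h * N * \<Lambda>" by (simp add: mult_ac)
    moreover have "\<lfloor>d 0\<rfloor> \<le> \<lfloor>d (N - 1)\<rfloor>" using dmono[of 0 "N - 1"] N by (intro floor_mono) simp
    ultimately show "real (card ms) \<le> h * N * \<Lambda> + 2"
      unfolding ms_def by simp linarith
  qed (use \<theta> in auto)
  also have "\<dots> = 5 * h * N * sqrt \<Lambda> + 10 / sqrt \<Lambda>"
    using \<theta> unfolding \<theta>_def[symmetric] by (simp add: field_simps flip: \<theta>(3))
  finally show ?thesis .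
qed

section \<open>Gaussians and the Fourier transform on the line\<close>

lemma borel_measurable_cis [measurable]:
  assumes "f \<in> borel_measurable M"
  shows "(\<lambda>x. cis (f x)) \<in> borel_measurable M"
  using assms by (rule borel_measurable_continuous_on[rotated]) (intro continuous_intros)

lemma borel_measurable_cnj [measurable]:
  assumes "f \<in> borel_measurable M"
  shows "(\<lambda>x. cnj (f x)) \<in> borel_measurable M"
  using assms by (rule borel_measurable_continuous_on[rotated]) (intro continuous_intros)

text \<open>With \<open>pi\<close> in the exponent, a Gaussian of width \<open>l\<close> has mass
  exactly \<open>l\<close>: it is \<open>l\<close> times a normal density of standard deviation
  \<open>l / sqrt (2 * pi)\<close>.\<close>

lemma gaussian_integrable:
  assumes "l > 0"
  shows "integrable lborel (\<lambda>t::real. exp (- pi * ((t - c) / l)\<^sup>2))"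
    and "(LINT t|lborel. exp (- pi * ((t - c) / l)\<^sup>2)) = l"
proof -
  define \<sigma> where "\<sigma> = l / sqrt (2 * pi)"
  have \<sigma>: "\<sigma> > 0" using assms by (simp add: \<sigma>_def)
  have s2: "\<sigma>\<^sup>2 = l\<^sup>2 / (2 * pi)" by (simp add: \<sigma>_def power_divide)
  have l: "sqrt (2 * pi * \<sigma>\<^sup>2) = l" using assms by (simp add: s2)
  have "exp (- pi * ((t - c) / l)\<^sup>2) = l * normal_density c \<sigma> t" for t
    unfolding normal_density_def l unfolding s2 using assms by (simp add: field_simps)
  moreover have "integrable lborel (normal_density c \<sigma>)" "(LINT t|lborel. normal_density c \<sigma> t) = 1"
    using \<sigma> by auto
  ultimately show "integrable lborel (\<lambda>t::real. exp (- pi * ((t - c) / l)\<^sup>2))"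
    "(LINT t|lborel. exp (- pi * ((t - c) / l)\<^sup>2)) = l" by simp_all
qed

text \<open>A rescaled form of the characteristic function of the standard normal
  distribution.\<close>

lemma gaussian_fourier:
  assumes "l > 0"
  shows "(LINT t|lborel. of_real (exp (- pi * (t / l)\<^sup>2)) * cis (2 * pi * t * y)) = of_real (l * exp (- pi * (l * y)\<^sup>2))"
proof -
  define s where "s = l / sqrt (2 * pi)"
  have s: "s > 0" using assms by (simp add: s_def)
  have s2: "s * s * (2 * pi) = l * l" by (simp add: s_def)
  have "(LINT t|lborel. of_real (exp (- pi * (t / l)\<^sup>2)) * cis (2 * pi * t * y))
     = \<bar>s\<bar> *\<^sub>R (LINT t|lborel. of_real (exp (- pi * ((0 + s * t) / l)\<^sup>2)) * cis (2 * pi * (0 + s * t) * y))"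
    using s by (intro lborel_integral_real_affine) auto
  also have "(LINT t|lborel. of_real (exp (- pi * ((0 + s * t) / l)\<^sup>2)) * cis (2 * pi * (0 + s * t) * y))
     = (LINT t|lborel. sqrt (2 * pi) * (std_normal_density t *\<^sub>R iexp ((2 * pi * s * y) * t)))"
  proof (intro Bochner_Integration.integral_cong refl)
    fix t :: real
    have "pi * ((s * t) / l)\<^sup>2 = t\<^sup>2 / 2"
      using assms s2 by (simp add: field_simps power2_eq_square)
    thus "of_real (exp (- pi * ((0 + s * t) / l)\<^sup>2)) * cis (2 * pi * (0 + s * t) * y)
       = sqrt (2 * pi) * (std_normal_density t *\<^sub>R iexp ((2 * pi * s * y) * t))"
      by (simp add: std_normal_density_def cis_conv_exp scaleR_conv_of_real mult_ac)
  qed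
  also have "\<dots> = sqrt (2 * pi) * (LINT t|lborel. std_normal_density t *\<^sub>R iexp ((2 * pi * s * y) * t))"
    by (subst integral_mult_right_zero[symmetric]) (simp add: mult_ac)
  also have "(LINT t|lborel. std_normal_density t *\<^sub>R iexp ((2 * pi * s * y) * t)) = char std_normal_distribution (2 * pi * s * y)"
    unfolding char_def by (subst integral_density) (auto simp: mult_ac)
  also have "\<dots> = of_real (exp (- pi * (l * y)\<^sup>2))"
  proof -
    have "(2 * pi * s * y)\<^sup>2 / 2 = pi * (l * y)\<^sup>2"
      using s2 by (simp add: power2_eq_square mult_ac)
    thus ?thesis by (simp add: char_std_normal_distribution)
  qed
  also have "\<bar>s\<bar> *\<^sub>R (complex_of_real (sqrt (2 * pi)) * of_real (exp (- pi * (l * y)\<^sup>2))) = of_real (l * exp (- pi * (l * y)\<^sup>2))"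
    using assms by (simp add: s_def scaleR_conv_of_real)
  finally show ?thesis .
qed

section \<open>Weighted L^2 norms of Fourier integrals as bilinear forms\<close>

lemma integrable_integral_product:
  fixes u v :: "_ \<Rightarrow> complex"
  assumes "sigma_finite_measure M" "sigma_finite_measure N" and u: "integrable M u" and v: "integrable N v"
  shows "integrable (M \<Otimes>\<^sub>M N) (\<lambda>p. u (fst p) * v (snd p))"
    and "(LINT p|(M \<Otimes>\<^sub>M N). u (fst p) * v (snd p)) = integral\<^sup>L M u * integral\<^sup>L N v"
proof -
  interpret M: sigma_finite_measure M by fact
  interpret N: sigma_finite_measure N by fact
  interpret pair_sigma_finite M N ..
  have [measurable]: "u \<in> borel_measurable M" "v \<in> borel_measurable N" using u v by auto
  show i: "integrable (M \<Otimes>\<^sub>M N) (\<lambda>p. u (fst p) * v (snd p))"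
    using u v by (intro Fubini_integrable) (auto simp: norm_mult)
  show "(LINT p|(M \<Otimes>\<^sub>M N). u (fst p) * v (snd p)) = integral\<^sup>L M u * integral\<^sup>L N v"
    using integral_fst'[OF i] by simp
qed

text \<open>The coordinate \<open>Y\<close> is general because it is the identity on the line for
  Bessel's inequality and the second coordinate on the cylinder for the dyadic blocks.\<close>

lemma norm_square_integral:
  assumes "sigma_finite_measure M" "integrable M g" and [measurable]: "Y \<in> borel_measurable M"
  shows "of_real ((cmod (LINT z|M. g z * cis (- 2 * pi * \<eta> * Y z)))\<^sup>2)
    = (LINT p|(M \<Otimes>\<^sub>M M). g (fst p) * cnj (g (snd p)) * cis (- 2 * pi * \<eta> * (Y (fst p) - Y (snd p))))"
proof -
  interpret sigma_finite_measure M by fact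
  interpret pair_sigma_finite M M ..
  have [measurable]: "g \<in> borel_measurable M" using assms(2) by auto
  let ?u = "\<lambda>z. g z * cis (- 2 * pi * \<eta> * Y z)"
  have u: "integrable M ?u"
    by (rule Bochner_Integration.integrable_bound[OF assms(2)]) (auto simp: norm_mult)
  have "of_real ((cmod (integral\<^sup>L M ?u))\<^sup>2) = integral\<^sup>L M ?u * cnj (integral\<^sup>L M ?u)"
    by (rule complex_norm_square)
  also have "cnj (integral\<^sup>L M ?u) = (LINT z|M. cnj (?u z))" by (rule Bochner_Integration.integral_cnj[symmetric])
  also have "integral\<^sup>L M ?u * (LINT z|M. cnj (?u z)) = (LINT p|(M \<Otimes>\<^sub>M M). ?u (fst p) * cnj (?u (snd p)))"
    by (rule integrable_integral_product(2)[OF assms(1,1) u, symmetric]) (rule integrable_cnj[OF u])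
  also have "\<dots> = (LINT p|(M \<Otimes>\<^sub>M M). g (fst p) * cnj (g (snd p)) * cis (- 2 * pi * \<eta> * (Y (fst p) - Y (snd p))))"
    by (intro Bochner_Integration.integral_cong refl) (simp add: cis_cnj mult_ac cis_mult algebra_simps)
  finally show ?thesis .
qed

text \<open>Fubini's theorem after expanding the square: a weighted frequency integral becomes a
  bilinear form whose kernel is the Fourier transform of the weight. Integrability of the weight
  makes the triple integral absolutely convergent.\<close>

lemma weighted_norm_square_integral:
  assumes M: "sigma_finite_measure M" and g: "integrable M g" and Y [measurable]: "Y \<in> borel_measurable M"
    and w: "integrable lborel (w :: real \<Rightarrow> real)"
  shows "(LINT \<eta>|lborel. of_real (w \<eta> * (cmod (LINT z|M. g z * cis (- 2 * pi * \<eta> * Y z)))\<^sup>2))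
    = (LINT p|(M \<Otimes>\<^sub>M M). g (fst p) * cnj (g (snd p)) *
        (LINT \<eta>|lborel. of_real (w \<eta>) * cis (- 2 * pi * \<eta> * (Y (fst p) - Y (snd p)))))"
    (is "?L = ?R")
    and "integrable lborel (\<lambda>\<eta>. w \<eta> * (cmod (LINT z|M. g z * cis (- 2 * pi * \<eta> * Y z)))\<^sup>2)" (is "integrable _ ?F")
proof -
  interpret sigma_finite_measure M by fact
  interpret MM: pair_sigma_finite M M ..
  interpret P: pair_sigma_finite lborel "M \<Otimes>\<^sub>M M" ..
  have [measurable]: "g \<in> borel_measurable M" "w \<in> borel_measurable borel" using g w by auto
  have f: "fst \<in> borel_measurable (lborel \<Otimes>\<^sub>M (M \<Otimes>\<^sub>M M))"
    using measurable_fst[of "lborel :: real measure" "M \<Otimes>\<^sub>M M"] by simp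
  have wf: "(\<lambda>q. w (fst q)) \<in> borel_measurable (lborel \<Otimes>\<^sub>M (M \<Otimes>\<^sub>M M))"
    using f by (rule measurable_compose) simp
  let ?k = "\<lambda>\<eta> p. of_real (w \<eta>) * (g (fst p) * cnj (g (snd p)) * cis (- 2 * pi * \<eta> * (Y (fst p) - Y (snd p))))"
  have gg: "integrable (M \<Otimes>\<^sub>M M) (\<lambda>p. g (fst p) * cnj (g (snd p)))"
    using integrable_integral_product(1)[OF M M g, of "\<lambda>z. cnj (g z)"] g by simp
  have "integrable (lborel \<Otimes>\<^sub>M (M \<Otimes>\<^sub>M M)) (\<lambda>q. of_real (w (fst q)) * (g (fst (snd q)) * cnj (g (snd (snd q)))))"
    using integrable_integral_product(1)[OF sigma_finite_lborel MM.sigma_finite_measure_axioms _ gg, of "\<lambda>\<eta>. of_real (w \<eta>)"] w by simp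
  hence int: "integrable (lborel \<Otimes>\<^sub>M (M \<Otimes>\<^sub>M M)) (\<lambda>(\<eta>, p). ?k \<eta> p)"
    using f wf by (elim Bochner_Integration.integrable_bound) (auto simp: norm_mult case_prod_beta')
  have F: "of_real (?F \<eta>) = (LINT p|(M \<Otimes>\<^sub>M M). ?k \<eta> p)" for \<eta>
    unfolding of_real_mult norm_square_integral[OF M g Y] by simp
  have "integrable lborel (\<lambda>\<eta>. complex_of_real (?F \<eta>))"
    unfolding F using P.integrable_fst'[OF int] by simp
  hence "integrable lborel (\<lambda>\<eta>. Re (complex_of_real (?F \<eta>)))" by (rule integrable_Re)
  thus "integrable lborel ?F" by simp
  have "?L = (LINT \<eta>|lborel. LINT p|(M \<Otimes>\<^sub>M M). ?k \<eta> p)" unfolding F ..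
  also have "\<dots> = (LINT p|(M \<Otimes>\<^sub>M M). LINT \<eta>|lborel. ?k \<eta> p)"
    using P.Fubini_integral[OF int] by simp
  also have "\<dots> = ?R"
  proof (intro Bochner_Integration.integral_cong refl)
    fix p
    show "(LINT \<eta>|lborel. ?k \<eta> p) = g (fst p) * cnj (g (snd p)) *
        (LINT \<eta>|lborel. of_real (w \<eta>) * cis (- 2 * pi * \<eta> * (Y (fst p) - Y (snd p))))"
      by (subst integral_mult_right_zero[symmetric]) (simp add: mult_ac)
  qed
  finally show "?L = ?R" .
qed

text \<open>A Gaussian weight increasing to 1 is inserted on the frequency side. Its transform
  \<open>K n\<close> is positive of mass 1, so Schur's test bounds every weighted integral by the
  right-hand side, and Fatou's lemma removes the weight.\<close>

lemma bessel_fourier_integral: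
  fixes h :: "real \<Rightarrow> complex"
  assumes h: "integrable lborel h"
  shows "(\<integral>\<^sup>+\<eta>. ennreal ((cmod (LINT y|lborel. h y * cis (- 2 * pi * \<eta> * y)))\<^sup>2) \<partial>lborel)
     \<le> (\<integral>\<^sup>+y. ennreal ((cmod (h y))\<^sup>2) \<partial>lborel)"
proof -
  have [measurable]: "h \<in> borel_measurable borel" using h by auto
  define H where "H \<eta> = (LINT y|lborel. h y * cis (- 2 * pi * \<eta> * y))" for \<eta>
  define w where "w n \<eta> = exp (- pi * (\<eta> / real (Suc n))\<^sup>2)" for n \<eta>
  define K where "K n t = real (Suc n) * exp (- pi * (real (Suc n) * t)\<^sup>2)" for n t
  have [measurable]: "K n \<in> borel_measurable borel" "w n \<in> borel_measurable borel" for n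
    unfolding K_def w_def by measurable
  have Kpos: "K n t \<ge> 0" for n t by (simp add: K_def)
  have wint: "integrable lborel (w n)" for n
    using gaussian_integrable(1)[of "real (Suc n)" 0] by (simp add: w_def[abs_def])
  have wK: "(LINT \<eta>|lborel. of_real (w n \<eta>) * cis (- 2 * pi * \<eta> * t)) = of_real (K n t)" for n t
    using gaussian_fourier[of "real (Suc n)" "- t"] by (simp add: w_def K_def)
  have Kmass: "(\<integral>\<^sup>+t. ennreal (K n (t - c)) \<partial>lborel) = 1" "(\<integral>\<^sup>+t. ennreal (K n (c - t)) \<partial>lborel) = 1" for n c
  proof -
    have "K n (t - c) = real (Suc n) * exp (- pi * ((t - c) / (1 / real (Suc n)))\<^sup>2)" for t
      by (simp add: K_def mult_ac)
    hence "integrable lborel (\<lambda>t. K n (t - c))" "(LINT t|lborel. K n (t - c)) = 1"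
      using gaussian_integrable[of "1 / real (Suc n)" c] by simp_all
    thus 1: "(\<integral>\<^sup>+t. ennreal (K n (t - c)) \<partial>lborel) = 1"
      by (subst nn_integral_eq_integral) (auto simp: K_def)
    have "K n (c - t) = K n (t - c)" for t by (simp add: K_def power2_commute power_mult_distrib)
    thus "(\<integral>\<^sup>+t. ennreal (K n (c - t)) \<partial>lborel) = 1" using 1 by simp
  qed
  have H: "H \<in> borel_measurable borel" unfolding H_def[abs_def] by measurable
  note [measurable] = H
  let ?L = "lborel \<Otimes>\<^sub>M lborel :: (real \<times> real) measure"
  have bound: "(\<integral>\<^sup>+\<eta>. ennreal (w n \<eta> * (cmod (H \<eta>))\<^sup>2) \<partial>lborel) \<le> (\<integral>\<^sup>+y. ennreal ((cmod (h y))\<^sup>2) \<partial>lborel)" (is "_ \<le> ?B") for n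
  proof -
    have half: "ennreal (c * (a * k + b * k)) = ennreal c * (ennreal a * ennreal k + ennreal b * ennreal k)"
      if "0 \<le> a" "0 \<le> b" "0 \<le> c" "0 \<le> k" for a b c k :: real
      using that by (simp add: ennreal_mult ennreal_plus del: ennreal_plus[symmetric])
    let ?k = "\<lambda>p. h (fst p) * cnj (h (snd p)) * of_real (K n (fst p - snd p))"
    have id: "(\<lambda>x::real. x) \<in> borel_measurable lborel" by simp
    note W = weighted_norm_square_integral[OF sigma_finite_lborel h id wint[of n], folded H_def]
    have "(\<integral>\<^sup>+\<eta>. ennreal (w n \<eta> * (cmod (H \<eta>))\<^sup>2) \<partial>lborel) = ennreal (LINT \<eta>|lborel. w n \<eta> * (cmod (H \<eta>))\<^sup>2)"
      using W(2) by (intro nn_integral_eq_integral) (auto simp: w_def)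
    also have "\<dots> \<le> ennreal (cmod (LINT \<eta>|lborel. of_real (w n \<eta> * (cmod (H \<eta>))\<^sup>2)))"
      unfolding integral_complex_of_real norm_of_real by (rule ennreal_leI[OF abs_ge_self])
    also have "(LINT \<eta>|lborel. of_real (w n \<eta> * (cmod (H \<eta>))\<^sup>2)) = (LINT p|?L. ?k p)"
      unfolding W(1) wK ..
    also have "ennreal (cmod (LINT p|?L. ?k p)) \<le> (\<integral>\<^sup>+p. ennreal (cmod (?k p)) \<partial>?L)"
      by (cases "integrable ?L ?k") (auto simp: integral_norm_bound_ennreal not_integrable_integral_eq)
    also have "\<dots> \<le> (\<integral>\<^sup>+p. ennreal (1/2) * (ennreal ((cmod (h (fst p)))\<^sup>2) * ennreal (K n (fst p - snd p))
         + ennreal ((cmod (h (snd p)))\<^sup>2) * ennreal (K n (fst p - snd p))) \<partial>?L)"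
    proof (intro nn_integral_mono)
      fix p
      \<comment> \<open>Schur's test: after \<open>a * b \<le> (a^2 + b^2) / 2\<close> each half
        depends on one variable besides the kernel, and the other variable integrates
        \<open>K n\<close> to 1.\<close>
      have "0 \<le> (cmod (h (fst p)) - cmod (h (snd p)))\<^sup>2" by simp
      hence "cmod (h (fst p)) * cmod (h (snd p)) \<le> 1/2 * ((cmod (h (fst p)))\<^sup>2 + (cmod (h (snd p)))\<^sup>2)"
        by (simp add: power2_eq_square algebra_simps)
      hence "cmod (h (fst p)) * cmod (h (snd p)) * K n (fst p - snd p) \<le> 1/2 * ((cmod (h (fst p)))\<^sup>2 + (cmod (h (snd p)))\<^sup>2) * K n (fst p - snd p)"
        by (rule mult_right_mono) (simp add: K_def)
      moreover have "cmod (?k p) = cmod (h (fst p)) * cmod (h (snd p)) * K n (fst p - snd p)"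
        using Kpos by (simp add: norm_mult)
      moreover have "K n (fst p - snd p) \<ge> 0" by (simp add: K_def)
      ultimately show "ennreal (cmod (?k p)) \<le> ennreal (1/2) * (ennreal ((cmod (h (fst p)))\<^sup>2) * ennreal (K n (fst p - snd p))
         + ennreal ((cmod (h (snd p)))\<^sup>2) * ennreal (K n (fst p - snd p)))"
        by (subst half[symmetric]) (auto intro!: ennreal_leI simp del: ennreal_plus simp: algebra_simps)
    qed
    also have "\<dots> = ennreal (1/2) * ((\<integral>\<^sup>+p. ennreal ((cmod (h (fst p)))\<^sup>2) * ennreal (K n (fst p - snd p)) \<partial>?L)
         + (\<integral>\<^sup>+p. ennreal ((cmod (h (snd p)))\<^sup>2) * ennreal (K n (fst p - snd p)) \<partial>?L))"
      by (subst nn_integral_cmult, measurable, subst nn_integral_add) auto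
    also have "(\<integral>\<^sup>+p. ennreal ((cmod (h (fst p)))\<^sup>2) * ennreal (K n (fst p - snd p)) \<partial>?L) = ?B"
      by (subst lborel.nn_integral_fst[symmetric]) (auto simp: nn_integral_cmult Kmass)
    also have "(\<integral>\<^sup>+p. ennreal ((cmod (h (snd p)))\<^sup>2) * ennreal (K n (fst p - snd p)) \<partial>?L) = ?B"
      by (subst lborel_pair.nn_integral_snd[symmetric]) (auto simp: nn_integral_cmult Kmass)
    also have "ennreal (1/2) * (?B + ?B) = ?B"
    proof -
      have "ennreal (1/2) * ennreal 2 = ennreal (1/2 * 2)" by (rule ennreal_mult[symmetric]) auto
      hence "ennreal (1/2) * 2 = 1" by (simp only: ennreal_numeral mult_2 field_sum_of_halves) simp
      thus ?thesis by (simp only: mult_2[symmetric] mult.assoc[symmetric] mult_1_left)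
    qed
    finally show ?thesis .
  qed
  have lim: "(\<lambda>n. ennreal (w n \<eta> * (cmod (H \<eta>))\<^sup>2)) \<longlonglongrightarrow> ennreal ((cmod (H \<eta>))\<^sup>2)" for \<eta>
  proof -
    have "(\<lambda>n. \<eta> / real (Suc n)) \<longlonglongrightarrow> 0" by (intro LIMSEQ_Suc lim_const_over_n)
    hence "(\<lambda>n. w n \<eta> * (cmod (H \<eta>))\<^sup>2) \<longlonglongrightarrow> exp (- pi * 0\<^sup>2) * (cmod (H \<eta>))\<^sup>2"
      unfolding w_def by (intro tendsto_intros)
    thus ?thesis by (intro tendsto_ennrealI) simp
  qed
  have "(\<integral>\<^sup>+\<eta>. ennreal ((cmod (H \<eta>))\<^sup>2) \<partial>lborel) = (\<integral>\<^sup>+\<eta>. liminf (\<lambda>n. ennreal (w n \<eta> * (cmod (H \<eta>))\<^sup>2)) \<partial>lborel)"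
    using lim_imp_Liminf[OF _ lim] by simp
  also have "\<dots> \<le> liminf (\<lambda>n. \<integral>\<^sup>+\<eta>. ennreal (w n \<eta> * (cmod (H \<eta>))\<^sup>2) \<partial>lborel)"
    by (intro nn_integral_liminf) measurable
  also have "\<dots> \<le> liminf (\<lambda>n::nat. \<integral>\<^sup>+y. ennreal ((cmod (h y))\<^sup>2) \<partial>lborel)"
    by (intro Liminf_mono always_eventually allI bound)
  also have "\<dots> = (\<integral>\<^sup>+y. ennreal ((cmod (h y))\<^sup>2) \<partial>lborel)" by (simp add: Liminf_const)
  finally show ?thesis by (simp add: H_def)
qed

section \<open>The Plancherel transform as an L^2 limit\<close>

text \<open>The Riesz-Fischer theorem with the Cauchy rate preserved: a subsequence converges almost
  everywhere, and Fatou's lemma passes the bound \<open>e n\<close> to the limit.\<close>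

lemma L2_complete:
  fixes u :: "nat \<Rightarrow> 'a \<Rightarrow> complex"
  assumes [measurable]: "\<And>n. u n \<in> borel_measurable M"
    and e0: "e \<longlonglongrightarrow> (0::ennreal)"
    and ue: "\<And>m n. n \<le> m \<Longrightarrow> (\<integral>\<^sup>+x. ennreal ((cmod (u m x - u n x))\<^sup>2) \<partial>M) \<le> e n"
  obtains g where "g \<in> borel_measurable M" "\<And>n. (\<integral>\<^sup>+x. ennreal ((cmod (u n x - g x))\<^sup>2) \<partial>M) \<le> e n"
proof -
  have "\<exists>N. \<forall>n\<ge>N. e n < ennreal ((1/8)^j)" for j
    using order_tendstoD(2)[OF e0, of "ennreal ((1/8)^j)"] by (auto simp: eventually_sequentially)
  then obtain f where f: "\<And>j n. n \<ge> f j \<Longrightarrow> e n < ennreal ((1/8)^j)" by metis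
  define r where "r j = j + (\<Sum>i\<le>j. f i)" for j
  have r1: "j \<le> r j" for j by (simp add: r_def)
  have r2: "f j \<le> r j" for j by (simp add: r_def trans_le_add2 member_le_sum)
  have r3: "r j \<le> r (Suc j)" for j by (simp add: r_def)
  define D where "D j x = u (r (Suc j)) x - u (r j) x" for j x
  have [measurable]: "D j \<in> borel_measurable M" for j unfolding D_def by measurable
  have D: "(\<integral>\<^sup>+x. ennreal ((cmod (D j x))\<^sup>2) \<partial>M) \<le> ennreal ((1/8)^j)" for j
    using ue[OF r3[of j]] f[OF r2[of j]] unfolding D_def by (meson order_trans less_imp_le)
  \<comment> \<open>The weight \<open>2 ^ j\<close> against the decay \<open>(1/8) ^ j\<close> still
    leaves a convergent series, and
    \<open>2 * cmod (D j x) \<le> 2^j * (cmod (D j x))^2 + (1/2)^j\<close> then gives absolute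
    summability of the increments at almost every point.\<close>
  have "(\<integral>\<^sup>+x. (\<Sum>j. ennreal (2^j * (cmod (D j x))\<^sup>2)) \<partial>M) = (\<Sum>j. \<integral>\<^sup>+x. ennreal (2^j * (cmod (D j x))\<^sup>2) \<partial>M)"
    by (intro nn_integral_suminf) measurable
  also have "\<dots> \<le> (\<Sum>j. ennreal ((1/4)^j))"
  proof (intro suminf_le allI)
    fix j
    have "(\<integral>\<^sup>+x. ennreal (2^j * (cmod (D j x))\<^sup>2) \<partial>M) = ennreal (2^j) * (\<integral>\<^sup>+x. ennreal ((cmod (D j x))\<^sup>2) \<partial>M)"
      by (subst nn_integral_cmult[symmetric]) (auto simp: ennreal_mult)
    also have "\<dots> \<le> ennreal (2^j) * ennreal ((1/8)^j)" by (intro mult_left_mono D) auto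
    also have "\<dots> = ennreal ((1/4)^j)" by (simp flip: ennreal_mult power_mult_distrib)
    finally show "(\<integral>\<^sup>+x. ennreal (2^j * (cmod (D j x))\<^sup>2) \<partial>M) \<le> ennreal ((1/4)^j)" .
  qed auto
  also have "\<dots> < \<infinity>" by (subst suminf_ennreal2) (auto simp: summable_geometric less_top[symmetric])
  finally have "(\<integral>\<^sup>+x. (\<Sum>j. ennreal (2^j * (cmod (D j x))\<^sup>2)) \<partial>M) \<noteq> \<infinity>" by simp
  hence "AE x in M. (\<Sum>j. ennreal (2^j * (cmod (D j x))\<^sup>2)) \<noteq> \<infinity>"
    by (intro nn_integral_PInf_AE) measurable
  hence conv: "AE x in M. convergent (\<lambda>j. u (r j) x)"
  proof eventually_elim
    case (elim x)
    have s: "summable (\<lambda>j. 2^j * (cmod (D j x))\<^sup>2)"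
      using elim by (intro summable_suminf_not_top) auto
    have "summable (\<lambda>j. (1/2)^j + 2^j * (cmod (D j x))\<^sup>2)"
      by (intro summable_add s) (simp add: summable_geometric)
    hence "summable (\<lambda>j. cmod (D j x))"
    proof (rule summable_comparison_test[rotated], intro exI allI impI)
      fix j :: nat
      have "2 * cmod (D j x) * (1/2)^j \<le> (cmod (D j x))\<^sup>2 + ((1/2)^j)\<^sup>2" by (rule sum_squares_bound[THEN order_trans]) auto
      hence "2^j * (2 * cmod (D j x) * (1/2)^j) \<le> 2^j * ((cmod (D j x))\<^sup>2 + ((1/2)^j)\<^sup>2)" by (intro mult_left_mono) auto
      hence "2 * cmod (D j x) \<le> 2^j * (cmod (D j x))\<^sup>2 + (1/2)^j"
        by (simp add: algebra_simps power2_eq_square power_one_over)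
      thus "norm (cmod (D j x)) \<le> (1/2)^j + 2^j * (cmod (D j x))\<^sup>2"
        using norm_ge_zero[of "D j x"] unfolding real_norm_def abs_norm_cancel by linarith
    qed
    hence "summable (\<lambda>j. D j x)" by (rule summable_norm_cancel)
    hence "convergent (\<lambda>n. \<Sum>j<n. D j x)" by (simp add: summable_iff_convergent)
    moreover have "(\<Sum>j<n. D j x) = u (r n) x - u (r 0) x" for n
      unfolding D_def by (rule sum_lessThan_telescope)
    ultimately have "convergent (\<lambda>n. u (r n) x - u (r 0) x)" by simp
    thus ?case by (simp add: convergent_diff_const_right_iff)
  qed
  define g where "g x = lim (\<lambda>j. u (r j) x)" for x
  have g [measurable]: "g \<in> borel_measurable M" unfolding g_def by measurable
  have "(\<integral>\<^sup>+x. ennreal ((cmod (u n x - g x))\<^sup>2) \<partial>M) \<le> e n" for n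
  proof -
    have "AE x in M. ennreal ((cmod (u n x - g x))\<^sup>2) = liminf (\<lambda>j. ennreal ((cmod (u (r j) x - u n x))\<^sup>2))"
      using conv
    proof eventually_elim
      case (elim x)
      hence "(\<lambda>j. u (r j) x) \<longlonglongrightarrow> g x" by (simp add: g_def convergent_LIMSEQ_iff)
      hence "(\<lambda>j. ennreal ((cmod (u (r j) x - u n x))\<^sup>2)) \<longlonglongrightarrow> ennreal ((cmod (g x - u n x))\<^sup>2)"
        by (intro tendsto_ennrealI tendsto_intros)
      thus ?case by (subst lim_imp_Liminf[OF trivial_limit_sequentially]) (auto simp: norm_minus_commute)
    qed
    hence "(\<integral>\<^sup>+x. ennreal ((cmod (u n x - g x))\<^sup>2) \<partial>M) = (\<integral>\<^sup>+x. liminf (\<lambda>j. ennreal ((cmod (u (r j) x - u n x))\<^sup>2)) \<partial>M)"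
      by (rule nn_integral_cong_AE)
    also have "\<dots> \<le> liminf (\<lambda>j. \<integral>\<^sup>+x. ennreal ((cmod (u (r j) x - u n x))\<^sup>2) \<partial>M)"
      by (intro nn_integral_liminf) measurable
    also have "\<dots> \<le> liminf (\<lambda>j::nat. e n)"
      by (intro Liminf_mono eventually_mono[OF eventually_ge_at_top[of n]]) (rule ue, use r1 order_trans in blast)
    also have "\<dots> = e n" by (simp add: Liminf_const)
    finally show ?thesis .
  qed
  with g show ?thesis by (rule that)
qed

lemma Lp_norm_2_square: "Lp_norm M 2 f * Lp_norm M 2 f = (\<integral>\<^sup>+z. ennreal ((cmod (f z))\<^sup>2) \<partial>M)"
proof -
  define I where "I = (\<integral>\<^sup>+z. ennreal ((cmod (f z))\<^sup>2) \<partial>M)"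
  have I: "(\<integral>\<^sup>+z. ennreal (cmod (f z) powr 2) \<partial>M) = I" by (simp add: I_def)
  have L: "Lp_norm M 2 f = (if I = \<infinity> then \<infinity> else ennreal (enn2real I powr (1/2)))"
    unfolding Lp_norm_def Let_def enn2real_numeral I by simp
  show ?thesis
  proof (cases "I = \<infinity>")
    case True
    thus ?thesis by (simp add: L flip: I_def)
  next
    case False
    hence "Lp_norm M 2 f = ennreal (enn2real I powr (1/2))"
      by (simp add: L)
    moreover have "enn2real I powr (1/2) * enn2real I powr (1/2) = enn2real I"
      by (simp flip: powr_add)
    ultimately have "Lp_norm M 2 f * Lp_norm M 2 f = I"
      using False by (simp flip: ennreal_mult add: less_top[symmetric])
    thus ?thesis by (simp add: I_def)
  qed
qed

lemma Lp_norm_2_less_top_iff: "Lp_norm M 2 f < \<infinity> \<longleftrightarrow> (\<integral>\<^sup>+z. ennreal ((cmod (f z))\<^sup>2) \<partial>M) < \<infinity>"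
  unfolding Lp_norm_2_square[symmetric] by (auto simp: ennreal_mult_less_top less_top[symmetric] top_unique ennreal_mult_eq_top_iff)

text \<open>Transfers the limit in \<open>fourier_transform_L2\<close> to integrals of squares,
  where Fatou's lemma and Bessel's inequality apply directly.\<close>

lemma Lp_norm_2_tendsto_0_iff:
  "(\<lambda>n. Lp_norm M 2 (f n)) \<longlonglongrightarrow> 0 \<longleftrightarrow> (\<lambda>n. \<integral>\<^sup>+z. ennreal ((cmod (f n z))\<^sup>2) \<partial>M) \<longlonglongrightarrow> 0"
proof
  assume L: "(\<lambda>n. Lp_norm M 2 (f n)) \<longlonglongrightarrow> 0"
  have "(\<lambda>n. Lp_norm M 2 (f n) * Lp_norm M 2 (f n)) \<longlonglongrightarrow> 0 * 0"
    by (intro tendsto_mult_ennreal L) auto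
  thus "(\<lambda>n. \<integral>\<^sup>+z. ennreal ((cmod (f n z))\<^sup>2) \<partial>M) \<longlonglongrightarrow> 0" by (simp add: Lp_norm_2_square)
next
  assume I: "(\<lambda>n. \<integral>\<^sup>+z. ennreal ((cmod (f n z))\<^sup>2) \<partial>M) \<longlonglongrightarrow> 0"
  show "(\<lambda>n. Lp_norm M 2 (f n)) \<longlonglongrightarrow> 0"
  proof (rule order_tendstoI)
    fix a :: ennreal assume "0 < a"
    then obtain e where e: "0 < e" "e < \<infinity>" "e \<le> a" by (rule_tac that[of "min 1 a"]) (auto simp: min_def not_le intro: less_trans[OF _ ennreal_one_less_top])
    hence "0 < e * e" by (simp add: ennreal_zero_less_mult_iff)
    hence "\<forall>\<^sub>F n in sequentially. Lp_norm M 2 (f n) * Lp_norm M 2 (f n) < e * e"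
      using order_tendstoD(2)[OF I] by (simp add: Lp_norm_2_square)
    thus "\<forall>\<^sub>F n in sequentially. Lp_norm M 2 (f n) < a"
    proof eventually_elim
      case (elim n)
      have "\<not> e \<le> Lp_norm M 2 (f n)" using elim mult_mono[of e "Lp_norm M 2 (f n)" e "Lp_norm M 2 (f n)"] by auto
      thus ?case using e by auto
    qed
  qed auto
qed

text \<open>The approximants whose L^2 limit is \<open>fourier_transform_L2\<close>.\<close>

definition truncated_fourier :: "(real \<Rightarrow> complex) \<Rightarrow> nat \<Rightarrow> real \<Rightarrow> complex" where
  "truncated_fourier h N \<eta> = (LINT y:{- real N..real N}|lborel. h y * cis (- 2 * pi * \<eta> * y))"

lemma square_integrable_imp_integrable_indicator:
  fixes h :: "'a \<Rightarrow> complex"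
  assumes [measurable]: "h \<in> borel_measurable M" "A \<in> sets M"
    and "emeasure M A < \<infinity>" "(\<integral>\<^sup>+y. ennreal ((cmod (h y))\<^sup>2) \<partial>M) < \<infinity>"
  shows "integrable M (\<lambda>y. indicator A y *\<^sub>R h y)"
proof (rule integrableI_bounded)
  have "(\<integral>\<^sup>+y. ennreal (norm (indicator A y *\<^sub>R h y)) \<partial>M) \<le> (\<integral>\<^sup>+y. indicator A y + ennreal ((cmod (h y))\<^sup>2) \<partial>M)"
  proof (intro nn_integral_mono)
    fix y
    have "cmod (h y) \<le> 1 + (cmod (h y))\<^sup>2"
      using sum_squares_bound[of 1 "cmod (h y)"] norm_ge_zero[of "h y"] unfolding power_one by linarith
    thus "ennreal (norm (indicator A y *\<^sub>R h y)) \<le> indicator A y + ennreal ((cmod (h y))\<^sup>2)"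
      by (auto simp: indicator_def ennreal_leI simp flip: ennreal_1 ennreal_plus)
  qed
  also have "\<dots> = emeasure M A + (\<integral>\<^sup>+y. ennreal ((cmod (h y))\<^sup>2) \<partial>M)"
    by (subst nn_integral_add) auto
  also have "\<dots> < \<infinity>" using assms by simp
  finally show "(\<integral>\<^sup>+y. ennreal (norm (indicator A y *\<^sub>R h y)) \<partial>M) < \<infinity>" .
qed simp

text \<open>The difference of two truncations is the transform of a function vanishing on
  \<open>{- N..N}\<close>. Its Bessel bound, the tail of \<open>h\<close>, is the Cauchy rate
  required by \<open>L2_complete\<close>.\<close>

lemma truncated_fourier_bessel:
  fixes h :: "real \<Rightarrow> complex"
  assumes [measurable]: "h \<in> borel_measurable borel" and h2: "(\<integral>\<^sup>+y. ennreal ((cmod (h y))\<^sup>2) \<partial>lborel) < \<infinity>"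
  shows "(\<integral>\<^sup>+\<eta>. ennreal ((cmod (truncated_fourier h N \<eta>))\<^sup>2) \<partial>lborel) \<le> (\<integral>\<^sup>+y. ennreal ((cmod (h y))\<^sup>2) \<partial>lborel)"
    and "N \<le> m \<Longrightarrow> (\<integral>\<^sup>+\<eta>. ennreal ((cmod (truncated_fourier h m \<eta> - truncated_fourier h N \<eta>))\<^sup>2) \<partial>lborel)
         \<le> (\<integral>\<^sup>+y. indicator (- {- real N..real N}) y * ennreal ((cmod (h y))\<^sup>2) \<partial>lborel)"
    and "truncated_fourier h N \<in> borel_measurable borel"
proof -
  have cut: "integrable lborel (\<lambda>y. indicator {- real n..real n} y *\<^sub>R h y)" for n
    using h2 by (intro square_integrable_imp_integrable_indicator) auto
  have eq: "truncated_fourier h n \<eta> = (LINT y|lborel. (indicator {- real n..real n} y *\<^sub>R h y) * cis (- 2 * pi * \<eta> * y))" for n \<eta>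
    by (simp add: truncated_fourier_def set_lebesgue_integral_def)
  show "truncated_fourier h N \<in> borel_measurable borel"
    unfolding truncated_fourier_def set_lebesgue_integral_def by measurable
  show "(\<integral>\<^sup>+\<eta>. ennreal ((cmod (truncated_fourier h N \<eta>))\<^sup>2) \<partial>lborel) \<le> (\<integral>\<^sup>+y. ennreal ((cmod (h y))\<^sup>2) \<partial>lborel)"
    unfolding eq
    by (rule order_trans[OF bessel_fourier_integral[OF cut]])
       (auto intro!: nn_integral_mono simp: indicator_def)
  assume "N \<le> m"
  let ?d = "\<lambda>y. indicator {- real m..real m} y *\<^sub>R h y - indicator {- real N..real N} y *\<^sub>R h y"
  have osc: "integrable lborel (\<lambda>y. (indicator {- real n..real n} y *\<^sub>R h y) * cis (- 2 * pi * \<eta> * y))" for n \<eta>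
    by (rule Bochner_Integration.integrable_bound[OF cut[of n]]) (auto simp: norm_mult)
  have "truncated_fourier h m \<eta> - truncated_fourier h N \<eta> = (LINT y|lborel. ?d y * cis (- 2 * pi * \<eta> * y))" for \<eta>
    unfolding eq by (subst Bochner_Integration.integral_diff[symmetric, OF osc osc]) (simp add: left_diff_distrib)
  hence "(\<integral>\<^sup>+\<eta>. ennreal ((cmod (truncated_fourier h m \<eta> - truncated_fourier h N \<eta>))\<^sup>2) \<partial>lborel)
     \<le> (\<integral>\<^sup>+y. ennreal ((cmod (?d y))\<^sup>2) \<partial>lborel)"
    using bessel_fourier_integral[of ?d] cut by simp
  also have "\<dots> \<le> (\<integral>\<^sup>+y. indicator (- {- real N..real N}) y * ennreal ((cmod (h y))\<^sup>2) \<partial>lborel)"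
    using \<open>N \<le> m\<close> by (intro nn_integral_mono) (auto simp: indicator_def)
  finally show "(\<integral>\<^sup>+\<eta>. ennreal ((cmod (truncated_fourier h m \<eta> - truncated_fourier h N \<eta>))\<^sup>2) \<partial>lborel)
         \<le> (\<integral>\<^sup>+y. indicator (- {- real N..real N}) y * ennreal ((cmod (h y))\<^sup>2) \<partial>lborel)" .
qed

text \<open>Completeness supplies a witness for \<open>SOME\<close>; everything else is proved for
  any representative. The factor 2 stems from \<open>(a + b)^2 \<le> 2 * a^2 + 2 * b^2\<close> and
  reappears as the energy 2 in \<open>annulus_synthesis\<close>.\<close>

lemma fourier_transform_L2_properties:
  fixes h :: "real \<Rightarrow> complex"
  assumes [measurable]: "h \<in> borel_measurable borel" and h2: "(\<integral>\<^sup>+y. ennreal ((cmod (h y))\<^sup>2) \<partial>lborel) < \<infinity>"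
  shows "fourier_transform_L2 h \<in> borel_measurable borel"
    and "(\<lambda>N. \<integral>\<^sup>+\<eta>. ennreal ((cmod (truncated_fourier h N \<eta> - fourier_transform_L2 h \<eta>))\<^sup>2) \<partial>lborel) \<longlonglongrightarrow> 0"
    and "(\<integral>\<^sup>+\<eta>. ennreal ((cmod (fourier_transform_L2 h \<eta>))\<^sup>2) \<partial>lborel) \<le> 2 * (\<integral>\<^sup>+y. ennreal ((cmod (h y))\<^sup>2) \<partial>lborel)"
proof -
  note [measurable] = truncated_fourier_bessel(3)[OF assms]
  define e where "e N = (\<integral>\<^sup>+y. indicator (- {- real N..real N}) y * ennreal ((cmod (h y))\<^sup>2) \<partial>lborel)" for N
  have sq: "ennreal ((cmod (a + b))\<^sup>2) \<le> 2 * ennreal ((cmod a)\<^sup>2) + 2 * ennreal ((cmod b)\<^sup>2)" for a b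
  proof -
    have "(cmod (a + b))\<^sup>2 \<le> (cmod a + cmod b)\<^sup>2" by (intro power_mono norm_triangle_ineq) auto
    also have "\<dots> \<le> 2 * (cmod a)\<^sup>2 + 2 * (cmod b)\<^sup>2"
      using sum_squares_bound[of "cmod a" "cmod b"] by (simp add: power2_sum)
    finally have "ennreal ((cmod (a + b))\<^sup>2) \<le> ennreal (2 * (cmod a)\<^sup>2 + 2 * (cmod b)\<^sup>2)" by (rule ennreal_leI)
    thus ?thesis by (simp add: ennreal_mult)
  qed
  have e0: "e \<longlonglongrightarrow> 0"
  proof -
    have "e \<longlonglongrightarrow> (\<integral>\<^sup>+y. 0 \<partial>(lborel :: real measure))" unfolding e_def
    proof (rule nn_integral_dominated_convergence[where w = "\<lambda>y. ennreal ((cmod (h y))\<^sup>2)" and u' = "\<lambda>_. 0"])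
      show "AE y in lborel. (\<lambda>N. indicator (- {- real N..real N}) y * ennreal ((cmod (h y))\<^sup>2)) \<longlonglongrightarrow> 0"
      proof (rule AE_I2)
        fix y :: real
        obtain N0 where "\<bar>y\<bar> \<le> real N0" using real_arch_simple by blast
        hence "\<forall>\<^sub>F N in sequentially. indicator (- {- real N..real N}) y * ennreal ((cmod (h y))\<^sup>2) = 0"
          by (intro eventually_mono[OF eventually_ge_at_top[of N0]]) (auto simp: indicator_def abs_le_iff)
        thus "(\<lambda>N. indicator (- {- real N..real N}) y * ennreal ((cmod (h y))\<^sup>2)) \<longlonglongrightarrow> 0"
          by (rule tendsto_eventually)
      qed
    qed (use h2 in \<open>auto simp: indicator_def\<close>)
    thus ?thesis by simp
  qed
  obtain g where [measurable]: "g \<in> borel_measurable lborel"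
    and g: "\<And>N. (\<integral>\<^sup>+\<eta>. ennreal ((cmod (truncated_fourier h N \<eta> - g \<eta>))\<^sup>2) \<partial>lborel) \<le> e N"
  proof (rule L2_complete[of "truncated_fourier h" lborel e])
    show "(\<integral>\<^sup>+\<eta>. ennreal ((cmod (truncated_fourier h m \<eta> - truncated_fourier h n \<eta>))\<^sup>2) \<partial>lborel) \<le> e n" if "n \<le> m" for m n
      unfolding e_def by (rule truncated_fourier_bessel(2)[OF assms that])
  qed (use e0 in auto)
  have lim: "(\<lambda>N. \<integral>\<^sup>+\<eta>. ennreal ((cmod (truncated_fourier h N \<eta> - g \<eta>))\<^sup>2) \<partial>lborel) \<longlonglongrightarrow> 0"
    by (rule tendsto_sandwich[OF _ _ tendsto_const e0]) (auto simp: g)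
  have split: "(\<integral>\<^sup>+\<eta>. ennreal ((cmod (k \<eta>))\<^sup>2) \<partial>lborel) \<le>
     2 * (\<integral>\<^sup>+\<eta>. ennreal ((cmod (truncated_fourier h N \<eta> - k \<eta>))\<^sup>2) \<partial>lborel) + 2 * (\<integral>\<^sup>+y. ennreal ((cmod (h y))\<^sup>2) \<partial>lborel)"
    if [measurable]: "k \<in> borel_measurable lborel" for k N
  proof -
    have "(\<integral>\<^sup>+\<eta>. ennreal ((cmod (k \<eta>))\<^sup>2) \<partial>lborel) \<le> (\<integral>\<^sup>+\<eta>. 2 * ennreal ((cmod (truncated_fourier h N \<eta> - k \<eta>))\<^sup>2)
       + 2 * ennreal ((cmod (truncated_fourier h N \<eta>))\<^sup>2) \<partial>lborel)"
      using sq[of "_ - _" "truncated_fourier h N _"]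
      by (intro nn_integral_mono) (metis diff_add_cancel norm_minus_commute)
    also have "\<dots> = 2 * (\<integral>\<^sup>+\<eta>. ennreal ((cmod (truncated_fourier h N \<eta> - k \<eta>))\<^sup>2) \<partial>lborel)
       + 2 * (\<integral>\<^sup>+\<eta>. ennreal ((cmod (truncated_fourier h N \<eta>))\<^sup>2) \<partial>lborel)"
      by (simp add: nn_integral_add nn_integral_cmult)
    also have "\<dots> \<le> 2 * (\<integral>\<^sup>+\<eta>. ennreal ((cmod (truncated_fourier h N \<eta> - k \<eta>))\<^sup>2) \<partial>lborel) + 2 * (\<integral>\<^sup>+y. ennreal ((cmod (h y))\<^sup>2) \<partial>lborel)"
      by (intro add_left_mono mult_left_mono truncated_fourier_bessel(1)[OF assms]) auto
    finally show ?thesis .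
  qed
  have "(\<integral>\<^sup>+\<eta>. ennreal ((cmod (g \<eta>))\<^sup>2) \<partial>lborel) \<le> 2 * e 0 + 2 * (\<integral>\<^sup>+y. ennreal ((cmod (h y))\<^sup>2) \<partial>lborel)"
    by (rule order_trans[OF split[of g 0]]) (auto intro!: add_right_mono mult_left_mono g)
  also have "\<dots> < \<infinity>"
  proof -
    have "e 0 \<le> (\<integral>\<^sup>+y. ennreal ((cmod (h y))\<^sup>2) \<partial>lborel)"
      unfolding e_def by (intro nn_integral_mono) (auto simp: indicator_def)
    hence "e 0 < \<infinity>" using h2 by simp
    thus ?thesis using h2 by (simp add: ennreal_mult_less_top)
  qed
  finally have "g \<in> Lp_space lborel 2" by (simp add: Lp_space_def Lp_norm_2_less_top_iff[simplified])
  moreover have "(\<lambda>N. Lp_norm lborel 2 (\<lambda>\<eta>. truncated_fourier h N \<eta> - g \<eta>)) \<longlonglongrightarrow> 0"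
    unfolding Lp_norm_2_tendsto_0_iff by (rule lim)
  ultimately have "\<exists>g. g \<in> Lp_space lborel 2 \<and> (\<lambda>N. Lp_norm lborel 2 (\<lambda>\<eta>. truncated_fourier h N \<eta> - g \<eta>)) \<longlonglongrightarrow> 0"
    by blast
  hence F: "fourier_transform_L2 h \<in> Lp_space lborel 2 \<and> (\<lambda>N. Lp_norm lborel 2 (\<lambda>\<eta>. truncated_fourier h N \<eta> - fourier_transform_L2 h \<eta>)) \<longlonglongrightarrow> 0"
    unfolding fourier_transform_L2_def truncated_fourier_def by (rule someI_ex)
  thus [measurable]: "fourier_transform_L2 h \<in> borel_measurable borel" by (simp add: Lp_space_def)
  show T: "(\<lambda>N. \<integral>\<^sup>+\<eta>. ennreal ((cmod (truncated_fourier h N \<eta> - fourier_transform_L2 h \<eta>))\<^sup>2) \<partial>lborel) \<longlonglongrightarrow> 0"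
    using F unfolding Lp_norm_2_tendsto_0_iff by blast
  have "(\<lambda>N. 2 * (\<integral>\<^sup>+\<eta>. ennreal ((cmod (truncated_fourier h N \<eta> - fourier_transform_L2 h \<eta>))\<^sup>2) \<partial>lborel) + 2 * (\<integral>\<^sup>+y. ennreal ((cmod (h y))\<^sup>2) \<partial>lborel))
     \<longlonglongrightarrow> 2 * 0 + 2 * (\<integral>\<^sup>+y. ennreal ((cmod (h y))\<^sup>2) \<partial>lborel)"
    by (intro tendsto_add tendsto_const ennreal_tendsto_cmult T) auto
  thus "(\<integral>\<^sup>+\<eta>. ennreal ((cmod (fourier_transform_L2 h \<eta>))\<^sup>2) \<partial>lborel) \<le> 2 * (\<integral>\<^sup>+y. ennreal ((cmod (h y))\<^sup>2) \<partial>lborel)"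
    by (intro tendsto_lowerbound[of _ "2 * 0 + 2 * (\<integral>\<^sup>+y. ennreal ((cmod (h y))\<^sup>2) \<partial>lborel)", simplified]) (auto simp: split)
qed

text \<open>The truncations converge pointwise to the absolutely convergent integral and in L^2 to
  the chosen representative, so by Fatou's lemma the two agree almost everywhere. This evaluates the
  transforms of the test functions in the lower bound.\<close>

lemma fourier_transform_L2_integrable:
  fixes h :: "real \<Rightarrow> complex"
  assumes h: "integrable lborel h" and h2: "(\<integral>\<^sup>+y. ennreal ((cmod (h y))\<^sup>2) \<partial>lborel) < \<infinity>"
  shows "AE \<eta> in lborel. fourier_transform_L2 h \<eta> = (LINT y|lborel. h y * cis (- 2 * pi * \<eta> * y))"
proof -
  have m [measurable]: "h \<in> borel_measurable borel" using h by auto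
  note [measurable] = truncated_fourier_bessel(3)[OF m h2] fourier_transform_L2_properties(1)[OF m h2]
  define H where "H \<eta> = (LINT y|lborel. h y * cis (- 2 * pi * \<eta> * y))" for \<eta>
  have [measurable]: "H \<in> borel_measurable borel" unfolding H_def by measurable
  have "(\<lambda>N. truncated_fourier h N \<eta>) \<longlonglongrightarrow> H \<eta>" for \<eta>
    unfolding truncated_fourier_def set_lebesgue_integral_def H_def
  proof (rule integral_dominated_convergence[where w = "\<lambda>y. cmod (h y)"])
    show "AE y in lborel. (\<lambda>N. indicator {- real N..real N} y *\<^sub>R (h y * cis (- 2 * pi * \<eta> * y))) \<longlonglongrightarrow> h y * cis (- 2 * pi * \<eta> * y)"
    proof (rule AE_I2)
      fix y :: real
      obtain N0 where "\<bar>y\<bar> \<le> real N0" using real_arch_simple by blast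
      hence "\<forall>\<^sub>F N in sequentially. indicator {- real N..real N} y *\<^sub>R (h y * cis (- 2 * pi * \<eta> * y)) = h y * cis (- 2 * pi * \<eta> * y)"
        by (intro eventually_mono[OF eventually_ge_at_top[of N0]]) (auto simp: indicator_def abs_le_iff)
      thus "(\<lambda>N. indicator {- real N..real N} y *\<^sub>R (h y * cis (- 2 * pi * \<eta> * y))) \<longlonglongrightarrow> h y * cis (- 2 * pi * \<eta> * y)"
        by (rule tendsto_eventually)
    qed
  qed (use h in \<open>auto simp: indicator_def norm_mult\<close>)
  hence lim: "(\<lambda>N. ennreal ((cmod (truncated_fourier h N \<eta> - fourier_transform_L2 h \<eta>))\<^sup>2)) \<longlonglongrightarrow> ennreal ((cmod (H \<eta> - fourier_transform_L2 h \<eta>))\<^sup>2)" for \<eta>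
    by (intro tendsto_ennrealI tendsto_intros) auto
  have "(\<integral>\<^sup>+\<eta>. ennreal ((cmod (H \<eta> - fourier_transform_L2 h \<eta>))\<^sup>2) \<partial>lborel)
     = (\<integral>\<^sup>+\<eta>. liminf (\<lambda>N. ennreal ((cmod (truncated_fourier h N \<eta> - fourier_transform_L2 h \<eta>))\<^sup>2)) \<partial>lborel)"
    unfolding lim_imp_Liminf[OF trivial_limit_sequentially lim] ..
  also have "\<dots> \<le> liminf (\<lambda>N. \<integral>\<^sup>+\<eta>. ennreal ((cmod (truncated_fourier h N \<eta> - fourier_transform_L2 h \<eta>))\<^sup>2) \<partial>lborel)"
    by (intro nn_integral_liminf) measurable
  also have "\<dots> = 0"
    using fourier_transform_L2_properties(2)[OF m h2] by (simp add: lim_imp_Liminf)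
  finally have "AE \<eta> in lborel. ennreal ((cmod (H \<eta> - fourier_transform_L2 h \<eta>))\<^sup>2) = 0"
    using nn_integral_0_iff_AE[of "\<lambda>\<eta>. ennreal ((cmod (H \<eta> - fourier_transform_L2 h \<eta>))\<^sup>2)" lborel] by simp
  thus ?thesis by eventually_elim (simp add: H_def)
qed

section \<open>Fourier analysis on the cylinder\<close>

abbreviation circle :: "real measure" where "circle \<equiv> restrict_space lborel {0..1}"

lemma space_circle [simp]: "space circle = {0..1}"
  by (simp add: space_restrict_space)

lemma sets_circle [measurable]: "{0..1} \<in> sets circle"
  using sets.top[of circle] by simp

lemma emeasure_circle: "emeasure circle {0..1} = 1"
  by (simp add: emeasure_restrict_space)

interpretation circle: finite_measure circle
  by standard (simp add: emeasure_circle)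

interpretation circle_line: pair_sigma_finite circle "lborel :: real measure" ..

lemma sigma_finite_cylinder: "sigma_finite_measure cylinder"
  unfolding cylinder_def by (rule circle_line.sigma_finite_measure_axioms)

lemma measurable_circle_id [measurable]: "(\<lambda>x. x) \<in> borel_measurable circle"
  by (intro measurable_restrict_space1) simp

lemma measurable_cylinder_fst_snd [measurable]:
  "fst \<in> borel_measurable cylinder" "snd \<in> borel_measurable cylinder"
proof -
  have "fst \<in> cylinder \<rightarrow>\<^sub>M circle" unfolding cylinder_def by measurable
  from measurable_compose[OF this measurable_circle_id] show "fst \<in> borel_measurable cylinder" by simp
  have "snd \<in> cylinder \<rightarrow>\<^sub>M lborel" unfolding cylinder_def by measurable
  thus "snd \<in> borel_measurable cylinder" by simp
qed

lemma circle_has_integral_cis: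
  "has_bochner_integral circle (\<lambda>x. cis (2 * pi * real_of_int n * x)) (if n = 0 then 1 else 0)"
proof (cases "n = 0")
  case True
  thus ?thesis using emeasure_circle
    by (auto simp: has_bochner_integral_iff measure_def)
next
  case False
  define F where "F x = cis (2 * pi * real_of_int n * x) / (2 * pi * of_int n * \<i>)" for x :: real
  have "has_bochner_integral lborel (\<lambda>x. indicator {0..1} x *\<^sub>R cis (2 * pi * real_of_int n * x)) (F 1 - F 0)"
  proof (rule has_bochner_integral_FTC_Icc)
    fix x :: real
    show "(F has_vector_derivative cis (2 * pi * real_of_int n * x)) (at x within {0..1})"
      unfolding F_def cis_conv_exp using False
      by (auto intro!: derivative_eq_intros has_vector_derivative_real_field simp: field_simps)
  qed (auto intro!: continuous_intros)
  moreover have "F 1 - F 0 = 0"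
    using cis_multiple_2pi[of "real_of_int n"] by (simp add: F_def)
  ultimately show ?thesis using False
    by (simp add: has_bochner_integral_iff integrable_restrict_space integral_restrict_space)
qed

text \<open>The usual expansion of the squared distance from \<open>u\<close> to its Fourier
  polynomial over \<open>K\<close>. A finite right-hand side makes \<open>u\<close> integrable on
  the circle, so that the coefficients are genuine integrals.\<close>

lemma bessel_circle:
  fixes u :: "real \<Rightarrow> complex"
  assumes [measurable]: "u \<in> borel_measurable circle" and K: "finite K"
  shows "(\<Sum>k\<in>K. ennreal ((cmod (LINT x|circle. u x * cis (- 2 * pi * real_of_int k * x)))\<^sup>2))
     \<le> (\<integral>\<^sup>+x. ennreal ((cmod (u x))\<^sup>2) \<partial>circle)"
proof (cases "(\<integral>\<^sup>+x. ennreal ((cmod (u x))\<^sup>2) \<partial>circle) = \<infinity>")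
  case False
  hence u2: "(\<integral>\<^sup>+x. ennreal ((cmod (u x))\<^sup>2) \<partial>circle) < \<infinity>" by (simp add: less_top)
  define c where "c k = (LINT x|circle. u x * cis (- 2 * pi * real_of_int k * x))" for k
  define e where "e k x = cis (2 * pi * real_of_int k * x)" for k :: int and x :: real
  have [measurable]: "e k \<in> borel_measurable circle" for k unfolding e_def by measurable
  have "integrable circle (\<lambda>x. indicator {0..1} x *\<^sub>R u x)"
    using u2 emeasure_circle by (intro square_integrable_imp_integrable_indicator) auto
  hence ui: "integrable circle u"
    by (rule Bochner_Integration.integrable_cong[THEN iffD1, rotated -1]) auto
  have uu: "integrable circle (\<lambda>x. complex_of_real ((cmod (u x))\<^sup>2))"
    using u2 by (intro integrableI_bounded) (auto simp: norm_power)
  have ue: "integrable circle (\<lambda>x. u x * cnj (e k x))" for k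
    by (rule Bochner_Integration.integrable_bound[OF ui]) (auto simp: norm_mult e_def)
  have ceq: "(LINT x|circle. u x * cnj (e k x)) = c k" for k
    by (simp add: c_def e_def cis_cnj)
  have eu: "integrable circle (\<lambda>x. cnj (u x) * e k x)" "(LINT x|circle. cnj (u x) * e k x) = cnj (c k)" for k
    using integrable_cnj[OF ue[of k]] Bochner_Integration.integral_cnj[of circle "\<lambda>x. u x * cnj (e k x)"] ceq[of k] by auto
  have ee: "has_bochner_integral circle (\<lambda>x. e k x * cnj (e l x)) (if k = l then 1 else 0)" for k l
    using circle_has_integral_cis[of "k - l"] by (simp add: e_def cis_cnj cis_mult algebra_simps)
  let ?s = "\<lambda>x. \<Sum>k\<in>K. c k * e k x"
  have expand: "complex_of_real ((cmod (u x - ?s x))\<^sup>2) = of_real ((cmod (u x))\<^sup>2)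
     - (\<Sum>k\<in>K. cnj (c k) * (u x * cnj (e k x))) - (\<Sum>k\<in>K. c k * (cnj (u x) * e k x))
     + (\<Sum>k\<in>K. \<Sum>l\<in>K. c k * cnj (c l) * (e k x * cnj (e l x)))" for x
    unfolding complex_norm_square
    by (simp add: algebra_simps sum_distrib_left sum_distrib_right sum_product)
       (rule sum.swap)
  have "0 \<le> Re (LINT x|circle. complex_of_real ((cmod (u x - ?s x))\<^sup>2))"
    unfolding integral_complex_of_real Re_complex_of_real by simp
  also have "(LINT x|circle. complex_of_real ((cmod (u x - ?s x))\<^sup>2)) =
    (LINT x|circle. complex_of_real ((cmod (u x))\<^sup>2)) - (\<Sum>k\<in>K. cnj (c k) * c k) - (\<Sum>k\<in>K. c k * cnj (c k))
     + (\<Sum>k\<in>K. \<Sum>l\<in>K. c k * cnj (c l) * (if k = l then 1 else 0))"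
    unfolding expand using uu ue eu ee
    by (simp add: has_bochner_integral_iff Bochner_Integration.integral_add Bochner_Integration.integral_diff
         Bochner_Integration.integral_sum ceq)
  also have "\<dots> = of_real ((LINT x|circle. (cmod (u x))\<^sup>2) - (\<Sum>k\<in>K. (cmod (c k))\<^sup>2))"
    using K by (simp add: if_distrib sum.delta mult.commute complex_norm_square[symmetric] del: of_real_power cong: if_cong)
  finally have "(\<Sum>k\<in>K. (cmod (c k))\<^sup>2) \<le> (LINT x|circle. (cmod (u x))\<^sup>2)" by simp
  hence "ennreal (\<Sum>k\<in>K. (cmod (c k))\<^sup>2) \<le> ennreal (LINT x|circle. (cmod (u x))\<^sup>2)" by (rule ennreal_leI)
  also have "ennreal (LINT x|circle. (cmod (u x))\<^sup>2) = (\<integral>\<^sup>+x. ennreal ((cmod (u x))\<^sup>2) \<partial>circle)"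
  proof (rule nn_integral_eq_integral[symmetric])
    show "integrable circle (\<lambda>x. (cmod (u x))\<^sup>2)" using integrable_Re[OF uu] unfolding Re_complex_of_real .
  qed auto
  finally show ?thesis by (simp add: sum_ennreal c_def)
qed simp

section \<open>Bessel's inequality on the cylinder\<close>

lemma nn_integral_cylinder:
  assumes "f \<in> borel_measurable cylinder"
  shows "(\<integral>\<^sup>+z. f z \<partial>cylinder) = (\<integral>\<^sup>+y. (\<integral>\<^sup>+x. f (x, y) \<partial>circle) \<partial>lborel)"
  using circle_line.nn_integral_snd[of f] assms by (simp add: cylinder_def)

lemma bessel_fourier_coeff_x:
  assumes f: "f \<in> borel_measurable cylinder" and K: "finite K"
  shows "fourier_coeff_x f k \<in> borel_measurable borel"
    and "(\<Sum>k\<in>K. \<integral>\<^sup>+y. ennreal ((cmod (fourier_coeff_x f k y))\<^sup>2) \<partial>lborel) \<le> (\<integral>\<^sup>+z. ennreal ((cmod (f z))\<^sup>2) \<partial>cylinder)"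
proof -
  have f' [measurable]: "f \<in> borel_measurable (circle \<Otimes>\<^sub>M lborel)" using f by (simp add: cylinder_def)
  have meas: "fourier_coeff_x f k \<in> borel_measurable lborel" for k
  proof -
    have "(\<lambda>(y, x). f (x, y) * cis (- 2 * pi * real_of_int k * x)) \<in> borel_measurable (lborel \<Otimes>\<^sub>M circle)"
    proof -
      have 1: "(\<lambda>p. (snd p, fst p)) \<in> (lborel \<Otimes>\<^sub>M circle) \<rightarrow>\<^sub>M (circle \<Otimes>\<^sub>M (lborel :: real measure))" by measurable
      have "snd \<in> (lborel :: real measure) \<Otimes>\<^sub>M circle \<rightarrow>\<^sub>M circle" by measurable
      note [measurable] = measurable_compose[OF this measurable_circle_id] measurable_compose[OF 1 f']
      show ?thesis by (simp add: case_prod_beta')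
    qed
    thus ?thesis unfolding fourier_coeff_x_def by (rule circle.borel_measurable_lebesgue_integral)
  qed
  show "fourier_coeff_x f k \<in> borel_measurable borel" using meas by simp
  note [measurable] = meas
  have "(\<Sum>k\<in>K. \<integral>\<^sup>+y. ennreal ((cmod (fourier_coeff_x f k y))\<^sup>2) \<partial>lborel) = (\<integral>\<^sup>+y. (\<Sum>k\<in>K. ennreal ((cmod (fourier_coeff_x f k y))\<^sup>2)) \<partial>lborel)"
    by (subst nn_integral_sum) auto
  also have "\<dots> \<le> (\<integral>\<^sup>+y. (\<integral>\<^sup>+x. ennreal ((cmod (f (x, y)))\<^sup>2) \<partial>circle) \<partial>lborel)"
    unfolding fourier_coeff_x_def by (intro nn_integral_mono bessel_circle K) measurable
  also have "\<dots> = (\<integral>\<^sup>+z. ennreal ((cmod (f z))\<^sup>2) \<partial>cylinder)"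
    using f by (subst nn_integral_cylinder) auto
  finally show "(\<Sum>k\<in>K. \<integral>\<^sup>+y. ennreal ((cmod (fourier_coeff_x f k y))\<^sup>2) \<partial>lborel) \<le> (\<integral>\<^sup>+z. ennreal ((cmod (f z))\<^sup>2) \<partial>cylinder)" .
qed

lemma bessel_fourier_cyl:
  assumes f: "f \<in> borel_measurable cylinder" and f2: "(\<integral>\<^sup>+z. ennreal ((cmod (f z))\<^sup>2) \<partial>cylinder) < \<infinity>" and K: "finite K"
  shows "fourier_cyl f k \<in> borel_measurable borel"
    and "(\<Sum>k\<in>K. \<integral>\<^sup>+\<eta>. ennreal ((cmod (fourier_cyl f k \<eta>))\<^sup>2) \<partial>lborel) \<le> 2 * (\<integral>\<^sup>+z. ennreal ((cmod (f z))\<^sup>2) \<partial>cylinder)"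
proof -
  have fin: "(\<integral>\<^sup>+y. ennreal ((cmod (fourier_coeff_x f k y))\<^sup>2) \<partial>lborel) < \<infinity>" for k
    using bessel_fourier_coeff_x(2)[OF f, of "{k}"] f2 by (simp add: le_less_trans)
  note F = fourier_transform_L2_properties[OF bessel_fourier_coeff_x(1)[OF f K] fin, folded fourier_cyl_def]
  show "fourier_cyl f k \<in> borel_measurable borel" by (rule F(1))
  have "(\<Sum>k\<in>K. \<integral>\<^sup>+\<eta>. ennreal ((cmod (fourier_cyl f k \<eta>))\<^sup>2) \<partial>lborel) \<le> (\<Sum>k\<in>K. 2 * (\<integral>\<^sup>+y. ennreal ((cmod (fourier_coeff_x f k y))\<^sup>2) \<partial>lborel))"
    by (intro sum_mono F(3))
  also have "\<dots> \<le> 2 * (\<integral>\<^sup>+z. ennreal ((cmod (f z))\<^sup>2) \<partial>cylinder)"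
    unfolding sum_distrib_left[symmetric] by (intro mult_left_mono bessel_fourier_coeff_x(2)[OF f K]) auto
  finally show "(\<Sum>k\<in>K. \<integral>\<^sup>+\<eta>. ennreal ((cmod (fourier_cyl f k \<eta>))\<^sup>2) \<partial>lborel) \<le> 2 * (\<integral>\<^sup>+z. ennreal ((cmod (f z))\<^sup>2) \<partial>cylinder)" .
qed

text \<open>The transform of an integrable function as one absolutely convergent integral, defined
  at every frequency. It serves the dual functions, whereas \<open>fourier_cyl\<close> is determined
  only up to null sets.\<close>

definition cyl_transform :: "(real \<times> real \<Rightarrow> complex) \<Rightarrow> int \<Rightarrow> real \<Rightarrow> complex" where
  "cyl_transform g k \<eta> = (LINT z|cylinder. g z * cis (- 2 * pi * real_of_int k * fst z) * cis (- 2 * pi * \<eta> * snd z))"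

lemma bessel_cyl_transform:
  assumes g: "integrable cylinder g" and K: "finite K"
  shows "(\<Sum>k\<in>K. \<integral>\<^sup>+\<eta>. ennreal ((cmod (cyl_transform g k \<eta>))\<^sup>2) \<partial>lborel) \<le> (\<integral>\<^sup>+z. ennreal ((cmod (g z))\<^sup>2) \<partial>cylinder)"
proof -
  have gm [measurable]: "g \<in> borel_measurable cylinder" using g by auto
  have gk: "integrable cylinder (\<lambda>z. g z * cis (- 2 * pi * real_of_int k * fst z))" for k
    by (rule Bochner_Integration.integrable_bound[OF g]) (auto simp: norm_mult)
  have gke: "integrable cylinder (\<lambda>z. g z * cis (- 2 * pi * real_of_int k * fst z) * cis (- 2 * pi * \<eta> * snd z))" for k \<eta>
    by (rule Bochner_Integration.integrable_bound[OF g]) (auto simp: norm_mult)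
  have sw: "integrable (lborel \<Otimes>\<^sub>M circle) (\<lambda>(y, x). F (x, y))" if "integrable cylinder F" for F :: "real \<times> real \<Rightarrow> complex"
    using that circle_line.integrable_product_swap_iff[of F] by (simp add: cylinder_def)
  interpret lc: pair_sigma_finite "lborel :: real measure" circle ..
  have int: "integrable lborel (fourier_coeff_x g k)" for k
    using lc.integrable_fst'[OF sw[OF gk[of k]]] by (simp add: fourier_coeff_x_def[abs_def])
  have eq: "cyl_transform g k \<eta> = (LINT y|lborel. fourier_coeff_x g k y * cis (- 2 * pi * \<eta> * y))" for k \<eta>
  proof -
    have "cyl_transform g k \<eta> = (LINT y|lborel. LINT x|circle. g (x, y) * cis (- 2 * pi * real_of_int k * x) * cis (- 2 * pi * \<eta> * y))"
      using circle_line.integral_snd[of "\<lambda>x y. g (x, y) * cis (- 2 * pi * real_of_int k * x) * cis (- 2 * pi * \<eta> * y)"] gke[of k \<eta>]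
      by (simp add: cyl_transform_def cylinder_def case_prod_beta')
    thus ?thesis by (simp add: fourier_coeff_x_def)
  qed
  have "(\<Sum>k\<in>K. \<integral>\<^sup>+\<eta>. ennreal ((cmod (cyl_transform g k \<eta>))\<^sup>2) \<partial>lborel) \<le> (\<Sum>k\<in>K. \<integral>\<^sup>+y. ennreal ((cmod (fourier_coeff_x g k y))\<^sup>2) \<partial>lborel)"
    unfolding eq by (intro sum_mono bessel_fourier_integral int)
  also have "\<dots> \<le> (\<integral>\<^sup>+z. ennreal ((cmod (g z))\<^sup>2) \<partial>cylinder)"
    by (rule bessel_fourier_coeff_x(2)[OF gm K])
  finally show ?thesis .
qed

section \<open>Kernel estimates for dyadic blocks\<close>

text \<open>Two applications of the mean value theorem turn the second difference into
  \<open>q'' y\<close>, where \<open>q'' s = - lam^2 / (lam^2 - s^2)^(3/2)\<close>. On the block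
  \<open>lam^2 - s^2 = (lam - s) * (lam + s)\<close> lies between \<open>M * lam\<close> and
  \<open>4 * M * lam\<close>, which costs the factor \<open>4^(3/2) = 8\<close>.\<close>

lemma circle_second_difference:
  fixes lam M k :: real
  assumes k: "0 \<le> k" and M: "M > 0" "M \<le> lam - (k + 2)" "lam - k \<le> 2 * M"
  defines "q \<equiv> \<lambda>s. sqrt (lam\<^sup>2 - s\<^sup>2)"
  shows "sqrt lam / (M * sqrt M) / 8 \<le> - (q (k + 2) - 2 * q (k + 1) + q k)"
    and "- (q (k + 2) - 2 * q (k + 1) + q k) \<le> sqrt lam / (M * sqrt M)"
proof -
  have lam: "lam > 0" using assms by linarith
  define q' where "q' s = - s / sqrt (lam\<^sup>2 - s\<^sup>2)" for s
  define q'' where "q'' s = - lam\<^sup>2 / (sqrt (lam\<^sup>2 - s\<^sup>2)) ^ 3" for s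
  have W: "M * lam \<le> lam\<^sup>2 - s\<^sup>2" "lam\<^sup>2 - s\<^sup>2 \<le> 4 * (M * lam)" if "k \<le> s" "s \<le> k + 2" for s
  proof -
    have eq: "lam\<^sup>2 - s\<^sup>2 = (lam - s) * (lam + s)" by (simp add: power2_eq_square algebra_simps)
    have "M * lam \<le> (lam - s) * (lam + s)" using assms that by (intro mult_mono) auto
    moreover have "(lam - s) * (lam + s) \<le> (2 * M) * (2 * lam)" using assms that by (intro mult_mono) auto
    ultimately show "M * lam \<le> lam\<^sup>2 - s\<^sup>2" "lam\<^sup>2 - s\<^sup>2 \<le> 4 * (M * lam)" unfolding eq by auto
  qed
  have pos: "0 < lam\<^sup>2 - s\<^sup>2" if "k \<le> s" "s \<le> k + 2" for s
    using W(1)[OF that] mult_pos_pos[OF M(1) lam] by linarith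
  have dq: "(q has_real_derivative q' s) (at s)" if "k \<le> s" "s \<le> k + 2" for s
    using pos[OF that] unfolding q_def q'_def
    by (auto intro!: derivative_eq_intros simp: field_simps)
  have dq': "(q' has_real_derivative q'' s) (at s)" if "k \<le> s" "s \<le> k + 2" for s
  proof -
    have p: "0 < lam\<^sup>2 - s\<^sup>2" by (rule pos[OF that])
    define R where "R = sqrt (lam\<^sup>2 - s\<^sup>2)"
    have R: "R > 0" "R * R = lam\<^sup>2 - s\<^sup>2" using p by (simp_all add: R_def)
    have "((\<lambda>s. - s) has_real_derivative - 1) (at s)" by (auto intro!: derivative_eq_intros)
    from DERIV_divide[OF this dq[OF that]] R(1)
    have "(q' has_real_derivative (- 1 * q s - - s * q' s) / (q s * q s)) (at s)"
      unfolding q'_def q_def R_def by simp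
    also have "(- 1 * q s - - s * q' s) / (q s * q s) = - (R * R + s * s) / R ^ 3"
      using R(1) unfolding q_def q'_def R_def[symmetric] by (simp add: field_simps power3_eq_cube)
    also have "\<dots> = q'' s" unfolding q''_def R(2) by (simp add: R_def power2_eq_square)
    finally show ?thesis .
  qed
  have "\<exists>z>k. z < k + 1 \<and> (q (k + 1 + 1) - q (k + 1)) - (q (k + 1) - q k) = (k + 1 - k) * (q' (z + 1) - q' z)"
  proof (rule MVT2)
    fix s assume s: "k \<le> s" "s \<le> k + 1"
    have "((\<lambda>s. q (s + 1)) has_real_derivative q' (s + 1)) (at s)"
      using dq[of "s + 1"] s DERIV_shift[of q "q' (s + 1)" s 1] by auto
    thus "((\<lambda>s. q (s + 1) - q s) has_real_derivative q' (s + 1) - q' s) (at s)"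
      using s by (intro DERIV_diff dq) auto
  qed simp
  then obtain z where z: "k < z" "z < k + 1" "q (k + 2) - 2 * q (k + 1) + q k = q' (z + 1) - q' z"
    by (auto simp: algebra_simps)
  have "\<exists>y>z. y < z + 1 \<and> q' (z + 1) - q' z = (z + 1 - z) * q'' y"
    by (rule MVT2) (use z in \<open>auto intro!: dq'\<close>)
  then obtain y where y: "z < y" "y < z + 1" "q' (z + 1) - q' z = q'' y" by auto
  have yk: "k \<le> y" "y \<le> k + 2" using y z by auto
  define R where "R = sqrt (lam\<^sup>2 - y\<^sup>2)"
  define P where "P = sqrt (M * lam)"
  have P: "P > 0" using M lam by (simp add: P_def)
  have "P \<le> R" unfolding P_def R_def using W(1)[OF yk] by simp
  moreover have "R \<le> 2 * P"
    using W(2)[OF yk] real_sqrt_le_mono[of "lam\<^sup>2 - y\<^sup>2" "4 * (M * lam)"] by (simp add: P_def R_def real_sqrt_mult)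
  ultimately have R3: "P ^ 3 \<le> R ^ 3" "R ^ 3 \<le> 8 * P ^ 3"
    using P power_mono[of P R 3] power_mono[of R "2 * P" 3] by (auto simp: power_mult_distrib)
  have R0: "R > 0" using P \<open>P \<le> R\<close> by linarith
  have \<Lambda>: "lam\<^sup>2 / P ^ 3 = sqrt lam / (M * sqrt M)"
  proof -
    have "lam * lam = (sqrt lam * sqrt lam) * (sqrt lam * sqrt lam)" using lam by simp
    thus ?thesis using M lam
      by (simp add: P_def real_sqrt_mult power3_eq_cube power2_eq_square field_simps)
  qed
  have sd: "- (q (k + 2) - 2 * q (k + 1) + q k) = lam\<^sup>2 / R ^ 3"
    unfolding z(3) y(3) by (simp add: q''_def R_def)
  show "- (q (k + 2) - 2 * q (k + 1) + q k) \<le> sqrt lam / (M * sqrt M)"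
    unfolding sd \<Lambda>[symmetric] using R3 P R0 by (intro divide_left_mono) auto
  have "lam\<^sup>2 / (8 * P ^ 3) \<le> lam\<^sup>2 / R ^ 3"
    using R3 P R0 by (intro divide_left_mono) auto
  thus "sqrt lam / (M * sqrt M) / 8 \<le> - (q (k + 2) - 2 * q (k + 1) + q k)"
    unfolding sd \<Lambda>[symmetric] by simp
qed

text \<open>The van der Corput test with \<open>\<Lambda> = u^2 / 8\<close> and
  \<open>h = 8\<close>, the ratio from \<open>circle_second_difference\<close>. The part of the
  phase that is linear in \<open>k\<close> has no second difference, so the bound is uniform in
  \<open>x\<close>.\<close>

lemma circle_exponential_sum:
  fixes lam M x t u :: real and a n :: nat
  assumes M: "M > 0" and lam: "lam > 0" and t: "t \<noteq> 0"
    and block: "\<And>i. i < n \<Longrightarrow> M \<le> lam - real (a + i) \<and> lam - real (a + i) \<le> 2 * M"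
  defines "u \<equiv> sqrt (\<bar>t\<bar> * (sqrt lam / (M * sqrt M)))"
  shows "norm (\<Sum>i<n. cis (2 * pi * (real (a + i) * x + sqrt (lam\<^sup>2 - (real (a + i))\<^sup>2) * t))) \<le> 16 * real n * u + 30 / u"
proof (cases n)
  case 0
  thus ?thesis using M lam by (simp add: u_def)
next
  \<comment> \<open>The second difference at \<open>i\<close> involves the index
    \<open>i + 2\<close>, so the test is applied to the first \<open>n - 1\<close> terms and the
    last term is estimated by 1.\<close>
  case (Suc N)
  define q where "q s = sqrt (lam\<^sup>2 - s\<^sup>2)" for s
  define L where "L = sqrt lam / (M * sqrt M)"
  have L: "L > 0" using lam M by (simp add: L_def)
  have u: "u > 0" "u * u = \<bar>t\<bar> * L" using L t by (simp_all add: u_def L_def[symmetric])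
  define \<phi> where "\<phi> i = real (a + i) * x + q (real (a + i)) * t" for i
  \<comment> \<open>For \<open>t > 0\<close> the phase is concave in \<open>k\<close>; complex
    conjugation makes its second differences positive without changing the modulus of the
    sum.\<close>
  define sg where "sg = (if t > 0 then - 1 else 1 :: real)"
  have sgt: "sg * t = - \<bar>t\<bar>" by (simp add: sg_def)
  have sd: "sg * \<phi> (Suc (Suc i)) - 2 * (sg * \<phi> (Suc i)) + sg * \<phi> i
     = \<bar>t\<bar> * (- (q (real (a + i) + 2) - 2 * q (real (a + i) + 1) + q (real (a + i))))" for i
  proof -
    have "sg * \<phi> (Suc (Suc i)) - 2 * (sg * \<phi> (Suc i)) + sg * \<phi> i
     = (sg * t) * (q (real (a + i) + 2) - 2 * q (real (a + i) + 1) + q (real (a + i)))"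
      by (simp add: \<phi>_def algebra_simps)
    thus ?thesis unfolding sgt by (simp only: minus_mult_left minus_mult_right)
  qed
  have vdc: "norm (\<Sum>i<N. cis (2 * pi * (sg * \<phi> i))) \<le> 5 * 8 * real N * sqrt (u * u / 8) + 10 / sqrt (u * u / 8)"
  proof (rule van_der_corput_second_difference)
    fix i assume i: "Suc i < N"
    have "M \<le> lam - (real (a + i) + 2)" "lam - real (a + i) \<le> 2 * M"
      using block[of i] block[of "Suc (Suc i)"] i Suc by (auto simp: algebra_simps)
    from circle_second_difference[OF _ M this]
    have "L / 8 \<le> - (q (real (a + i) + 2) - 2 * q (real (a + i) + 1) + q (real (a + i)))"
      "- (q (real (a + i) + 2) - 2 * q (real (a + i) + 1) + q (real (a + i))) \<le> L"
      by (simp_all add: q_def L_def)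
    from mult_left_mono[OF this(1), of "\<bar>t\<bar>"] mult_left_mono[OF this(2), of "\<bar>t\<bar>"]
    show "u * u / 8 \<le> sg * \<phi> (Suc (Suc i)) - 2 * (sg * \<phi> (Suc i)) + sg * \<phi> i \<and>
      sg * \<phi> (Suc (Suc i)) - 2 * (sg * \<phi> (Suc i)) + sg * \<phi> i \<le> 8 * (u * u / 8)"
      unfolding sd u(2) by simp
  qed (use u(1) in auto)
  have s8: "sqrt (u * u / 8) = u / sqrt 8" using u(1) by (simp add: real_sqrt_divide)
  have "sqrt 8 \<le> 2.9" by (rule real_le_lsqrt) (simp_all add: power2_eq_square)
  have "2.8 \<le> sqrt 8" by (rule real_le_rsqrt) (simp add: power2_eq_square)
  hence "1 / sqrt 8 \<le> 1 / 2.8" by (intro divide_left_mono) auto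
  have "5 * 8 * real N * sqrt (u * u / 8) = real N * u * (40 * (1 / sqrt 8))" by (simp add: s8)
  also have "\<dots> \<le> real N * u * 15" using u \<open>1 / sqrt 8 \<le> 1 / 2.8\<close> by (intro mult_left_mono) auto
  also have "\<dots> \<le> real n * u * 15" using u Suc by (intro mult_right_mono) auto
  finally have t1: "5 * 8 * real N * sqrt (u * u / 8) \<le> 15 * n * u" by (simp add: mult_ac)
  have "10 / sqrt (u * u / 8) = 10 * sqrt 8 / u" using u(1) by (simp add: s8)
  also have "\<dots> \<le> 29 / u" using u \<open>sqrt 8 \<le> 2.9\<close> by (intro divide_right_mono) auto
  finally have t2: "10 / sqrt (u * u / 8) \<le> 29 / u" .
  \<comment> \<open>Absorbs the single leftover term and raises the constants 15 and 29 to 16 and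
    30.\<close>
  have "1 \<le> real n * u + 1 / u"
  proof (cases "u \<ge> 1")
    case True
    hence "1 * 1 \<le> real n * u" using Suc by (intro mult_mono) auto
    moreover have "0 \<le> 1 / u" using u by simp
    ultimately show ?thesis by linarith
  next
    case False
    hence "1 \<le> 1 / u" using u by simp
    moreover have "0 \<le> real n * u" using u by simp
    ultimately show ?thesis by linarith
  qed
  have "norm (\<Sum>i<N. cis (2 * pi * \<phi> i)) = norm (\<Sum>i<N. cis (2 * pi * (sg * \<phi> i)))"
  proof (cases "t > 0")
    case True
    have "(\<Sum>i<N. cis (2 * pi * (sg * \<phi> i))) = cnj (\<Sum>i<N. cis (2 * pi * \<phi> i))"
      using True by (simp add: sg_def cis_cnj)
    thus ?thesis by (simp only: complex_mod_cnj)
  qed (simp add: sg_def)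
  hence "norm (\<Sum>i<n. cis (2 * pi * \<phi> i)) \<le> (15 * n * u + 29 / u) + 1"
    unfolding Suc sum.lessThan_Suc using vdc t1 t2 unfolding Suc
    by (intro norm_triangle_mono) auto
  also have "\<dots> \<le> 16 * n * u + 30 / u" using \<open>1 \<le> real n * u + 1 / u\<close> add_divide_distrib[of 29 1 u] by (simp add: algebra_simps)
  finally show ?thesis by (simp add: \<phi>_def q_def)
qed

text \<open>The kernel has to compensate \<open>M * u + 1 / u\<close>, with \<open>u\<close>
  proportional to \<open>sqrt \<bar>t\<bar>\<close>. Its decay bounds
  \<open>sqrt (l * \<bar>t\<bar>) * \<kappa>\<close> and takes care of the first part; its zero at
  \<open>t = 0\<close> bounds \<open>\<kappa>\<close> by a multiple of
  \<open>sqrt (\<bar>t\<bar> / r)\<close> and takes care of the second.\<close>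

lemma circle_block_kernel:
  fixes lam M x t :: real and B :: "int set" and \<delta> \<rho> :: real
  assumes M: "M \<ge> 1" and lam: "lam > 0" and \<delta>: "\<delta> > 0" and \<rho>: "\<rho> > 0"
    and B: "B = {k. 0 \<le> k \<and> M \<le> lam - of_int k \<and> lam - of_int k < 2 * M}"
  defines "l \<equiv> \<delta> * sqrt (lam / M)" and "r \<equiv> \<rho> * sqrt M"
  assumes that: "l * r \<le> 1"
  shows "\<bar>l * exp (- pi * (l * t)\<^sup>2) - l * exp (- pi * (t / r)\<^sup>2)\<bar>
     * norm (\<Sum>k\<in>B. cis (2 * pi * (real_of_int k * x + sqrt (lam\<^sup>2 - (real_of_int k)\<^sup>2) * t)))
     \<le> 60 * (sqrt (lam * \<delta>) + \<delta> * sqrt (sqrt lam / \<rho>))"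
proof (cases "t = 0 \<or> B = {}")
  case True
  thus ?thesis using lam \<delta> \<rho> by auto
next
  case False
  hence t: "t \<noteq> 0" and Bne: "B \<noteq> {}" by auto
  have lr: "l > 0" "r > 0" using assms by (auto simp: l_def r_def)
  have "B \<subseteq> {0..\<lfloor>lam\<rfloor>}" using M unfolding B by (auto simp: le_floor_iff)
  hence fin: "finite B" by (rule finite_subset) simp
  define a b where "a = Min B" and "b = Max B"
  have ab: "a \<in> B" "b \<in> B" "a \<le> b" using Bne fin by (auto simp: a_def b_def)
  have Beq: "B = {a..b}"
  proof
    show "B \<subseteq> {a..b}" using fin by (auto simp: a_def b_def)
    show "{a..b} \<subseteq> B"
    proof
      fix i assume i: "i \<in> {a..b}"
      hence "real_of_int a \<le> of_int i" "real_of_int i \<le> of_int b" by auto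
      with ab i show "i \<in> B" unfolding B by auto
    qed
  qed
  define n where "n = nat (b - a + 1)"
  have a0: "a \<ge> 0" using ab(1) unfolding B by simp
  have nb: "real n \<le> 2 * M"
  proof -
    have "real_of_int b \<le> lam - M" "lam - 2 * M < real_of_int a" using ab unfolding B by auto
    moreover have "real n = of_int b - of_int a + 1" using ab(3) by (simp add: n_def)
    ultimately show ?thesis using M by linarith
  qed
  define u where "u = sqrt (\<bar>t\<bar> * (sqrt lam / (M * sqrt M)))"
  have u: "u > 0" using t lam M by (simp add: u_def)
  have "(\<Sum>k\<in>B. cis (2 * pi * (real_of_int k * x + sqrt (lam\<^sup>2 - (real_of_int k)\<^sup>2) * t)))
     = (\<Sum>i<n. cis (2 * pi * (real (nat a + i) * x + sqrt (lam\<^sup>2 - (real (nat a + i))\<^sup>2) * t)))"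
    unfolding Beq using a0
    by (intro sum.reindex_bij_witness[of _ "\<lambda>i. a + int i" "\<lambda>k. nat (k - a)"]) (auto simp: n_def)
  also have "norm \<dots> \<le> 16 * real n * u + 30 / u"
    unfolding u_def
  proof (rule circle_exponential_sum)
    fix i assume "i < n"
    hence "a + int i \<in> B" unfolding Beq using ab(3) by (auto simp: n_def)
    thus "M \<le> lam - real (nat a + i) \<and> lam - real (nat a + i) \<le> 2 * M"
      unfolding B using a0 by auto
  qed (use M lam t in auto)
  also have "\<dots> \<le> 32 * M * u + 30 / u" using nb u by (intro add_mono mult_right_mono) auto
  finally have sum: "norm (\<Sum>k\<in>B. cis (2 * pi * (real_of_int k * x + sqrt (lam\<^sup>2 - (real_of_int k)\<^sup>2) * t)))
     \<le> 32 * M * u + 30 / u" .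
  define \<kappa> where "\<kappa> = exp (- pi * (l * t)\<^sup>2) - exp (- pi * (t / r)\<^sup>2)"
  \<comment> \<open>The assumption \<open>l * r \<le> 1\<close> orders the two Gaussians: as
    functions of \<open>t\<close> their widths are \<open>1 / l\<close> and
    \<open>r\<close>.\<close>
  have "(l * t)\<^sup>2 \<le> (t / r)\<^sup>2"
  proof -
    have "\<bar>l * t\<bar> \<le> \<bar>t / r\<bar>" using that lr t by (simp add: abs_mult field_simps)
    thus ?thesis by (rule abs_le_square_iff[THEN iffD1])
  qed
  hence \<kappa>0: "\<kappa> \<ge> 0" by (simp add: \<kappa>_def)
  have \<kappa>1: "\<kappa> \<le> exp (- pi * (l * t)\<^sup>2)" by (simp add: \<kappa>_def)
  have \<kappa>2: "\<kappa> \<le> 2 * sqrt (\<bar>t\<bar> / r)"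
  proof (cases "\<bar>t\<bar> / r \<le> 1 / 4")
    case True
    define z where "z = sqrt (\<bar>t\<bar> / r)"
    have z: "0 \<le> z" "z * z = \<bar>t\<bar> / r" using lr by (auto simp: z_def)
    have "z \<le> 1 / 2" using real_sqrt_le_mono[OF True] by (simp add: z_def real_sqrt_divide)
    have "1 - pi * (t / r)\<^sup>2 \<le> exp (- pi * (t / r)\<^sup>2)" using exp_ge_add_one_self[of "- pi * (t / r)\<^sup>2"] by simp
    moreover have "exp (- pi * (l * t)\<^sup>2) \<le> 1" unfolding exp_le_one_iff by simp
    ultimately have "\<kappa> \<le> pi * (t / r)\<^sup>2" unfolding \<kappa>_def by linarith
    also have "(t / r)\<^sup>2 = (z * z) * (z * z)" unfolding z(2) using lr by (simp add: power2_eq_square)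
    also have "pi * ((z * z) * (z * z)) \<le> 4 * ((1/2 * (1/2)) * ((1/2) * z))"
      using z(1) \<open>z \<le> 1 / 2\<close> pi_less_4 by (intro mult_mono) auto
    also have "\<dots> \<le> 2 * z" using z by simp
    finally show ?thesis by (simp add: z_def)
  next
    case False
    hence "1 / 2 \<le> sqrt (\<bar>t\<bar> / r)" using real_sqrt_le_mono[of "1/4" "\<bar>t\<bar> / r"] by (simp add: real_sqrt_divide)
    moreover have "\<kappa> \<le> 1" using \<kappa>1 by (rule order_trans) simp
    ultimately show ?thesis by linarith
  qed
  have \<kappa>3: "sqrt (l * \<bar>t\<bar>) * \<kappa> \<le> 1"
  proof -
    have "sqrt (l * \<bar>t\<bar>) \<le> exp (pi * (l * t)\<^sup>2)"
    proof (cases "l * \<bar>t\<bar> \<le> 1")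
      case True
      hence "sqrt (l * \<bar>t\<bar>) \<le> 1" by simp
      also have "1 \<le> exp (pi * (l * t)\<^sup>2)" by simp
      finally show ?thesis .
    next
      case False
      have "sqrt (l * \<bar>t\<bar>) \<le> sqrt ((l * \<bar>t\<bar>) * (l * \<bar>t\<bar>))"
        using mult_right_mono[of 1 "l * \<bar>t\<bar>" "l * \<bar>t\<bar>"] False by (intro real_sqrt_le_mono) simp
      also have "\<dots> = 1 * (l * \<bar>t\<bar>)" unfolding real_sqrt_abs2 using lr by (simp add: abs_mult)
      also have "\<dots> \<le> (l * \<bar>t\<bar>) * (l * \<bar>t\<bar>)" using False lr by (intro mult_right_mono) auto
      also have "\<dots> = 1 * (l * t)\<^sup>2" by (simp add: power2_eq_square)
      also have "\<dots> \<le> pi * (l * t)\<^sup>2" using pi_ge_two by (intro mult_right_mono) auto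
      also have "\<dots> \<le> exp (pi * (l * t)\<^sup>2)" using exp_ge_add_one_self[of "pi * (l * t)\<^sup>2"] by linarith
      finally show ?thesis .
    qed
    hence "sqrt (l * \<bar>t\<bar>) * \<kappa> \<le> exp (pi * (l * t)\<^sup>2) * exp (- pi * (l * t)\<^sup>2)"
      using \<kappa>0 \<kappa>1 by (intro mult_mono) auto
    thus ?thesis by (simp flip: exp_add)
  qed
  define A where "A = sqrt lam"
  define R where "R = sqrt M"
  have AR: "A > 0" "R > 0" "lam = A * A" "M = R * R" using lam M by (auto simp: A_def R_def)
  have lA: "l = \<delta> * A / R" by (simp add: l_def A_def R_def real_sqrt_divide)
  have rR: "r = \<rho> * R" by (simp add: r_def R_def)
  define L where "L = A / (R * R * R)"
  have "sqrt lam / (M * sqrt M) = L" using M by (simp add: L_def A_def R_def)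
  hence uL: "u = sqrt \<bar>t\<bar> * sqrt L" unfolding u_def by (simp add: real_sqrt_mult)
  have sl: "sqrt l > 0" "sqrt L > 0" "sqrt \<bar>t\<bar> > 0" "sqrt r > 0" using lr AR t by (auto simp: L_def)
  have term1: "l * \<kappa> * (M * u) \<le> sqrt (lam * \<delta>)"
  proof -
    have "l * \<kappa> * (M * u) = (sqrt (l * \<bar>t\<bar>) * \<kappa>) * (M * sqrt l * sqrt L)"
    proof -
      have "l * \<kappa> * (M * u) = (sqrt l * sqrt l) * \<kappa> * (M * (sqrt \<bar>t\<bar> * sqrt L))" using lr by (simp add: uL)
      also have "\<dots> = (sqrt (l * \<bar>t\<bar>) * \<kappa>) * (M * sqrt l * sqrt L)" by (simp only: real_sqrt_mult mult_ac)
      finally show ?thesis .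
    qed
    also have "\<dots> \<le> 1 * (M * sqrt l * sqrt L)" using \<kappa>3 sl M by (intro mult_right_mono) auto
    also have "\<dots> = sqrt (lam * \<delta>)"
    proof -
      have "M * sqrt l * sqrt L = sqrt ((R * R) * (R * R) * l * L)" using AR by (simp add: real_sqrt_mult)
      also have "(R * R) * (R * R) * l * L = lam * \<delta>" using AR(1,2) unfolding AR(3) by (simp add: lA L_def field_simps)
      finally show ?thesis by simp
    qed
    finally show ?thesis .
  qed
  have term2: "l * \<kappa> * (1 / u) \<le> 2 * (\<delta> * sqrt (sqrt lam / \<rho>))"
  proof -
    have "l * \<kappa> * (1 / u) \<le> l * (2 * sqrt (\<bar>t\<bar> / r)) * (1 / u)"
      using \<kappa>2 lr u by (intro mult_right_mono mult_left_mono) auto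
    also have "\<dots> = 2 * (l / (sqrt r * sqrt L))" using sl by (simp add: uL real_sqrt_divide field_simps)
    also have "l / (sqrt r * sqrt L) = \<delta> * (A / (R * sqrt (r * L)))" by (simp add: lA real_sqrt_mult)
    also have "A / (R * sqrt (r * L)) = sqrt (sqrt lam / \<rho>)"
    proof -
      have "R * sqrt (r * L) = sqrt (R * R * (r * L))" using AR(1,2) by (simp add: real_sqrt_mult)
      also have "R * R * (r * L) = \<rho> * A" using AR(1,2) by (simp add: rR L_def)
      finally have "A / (R * sqrt (r * L)) = sqrt (A * A) / sqrt (\<rho> * A)" using AR(1) by simp
      also have "\<dots> = sqrt (A / \<rho>)" unfolding real_sqrt_divide[symmetric] using AR(1) \<rho> by simp
      finally show ?thesis by (simp add: A_def)
    qed
    finally show ?thesis .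
  qed
  have "\<bar>l * exp (- pi * (l * t)\<^sup>2) - l * exp (- pi * (t / r)\<^sup>2)\<bar> = l * \<kappa>"
    using lr \<kappa>0 by (simp add: \<kappa>_def abs_mult flip: right_diff_distrib)
  hence "\<bar>l * exp (- pi * (l * t)\<^sup>2) - l * exp (- pi * (t / r)\<^sup>2)\<bar>
     * norm (\<Sum>k\<in>B. cis (2 * pi * (real_of_int k * x + sqrt (lam\<^sup>2 - (real_of_int k)\<^sup>2) * t)))
     \<le> l * \<kappa> * (32 * M * u + 30 / u)"
    using sum lr \<kappa>0 by (simp add: mult_left_mono)
  also have "\<dots> = 32 * (l * \<kappa> * (M * u)) + 30 * (l * \<kappa> * (1 / u))" by (simp add: algebra_simps)
  also have "\<dots> \<le> 60 * (sqrt (lam * \<delta>) + \<delta> * sqrt (sqrt lam / \<rho>))"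
  proof -
    \<comment> \<open>The constant 60 is 30 times the factor 2 in the second bound, and it also
      covers 32.\<close>
    have "32 * X + 30 * Y \<le> 60 * (S + T)" if "X \<le> S" "Y \<le> 2 * T" "0 \<le> S" for X Y S T :: real
      using that by simp
    from this[OF term1 term2] show ?thesis using lam \<delta> by simp
  qed
  finally show ?thesis .
qed

section \<open>From the kernel estimate to sums of frequency integrals\<close>

lemma gaussian_fourier_shift:
  assumes "l > 0"
  shows "(LINT \<eta>|lborel. of_real (exp (- pi * ((\<eta> - c) / l)\<^sup>2)) * cis (- 2 * pi * \<eta> * t))
     = cis (- 2 * pi * c * t) * of_real (l * exp (- pi * (l * t)\<^sup>2))"
proof -
  have "(LINT \<eta>|lborel. of_real (exp (- pi * ((\<eta> - c) / l)\<^sup>2)) * cis (- 2 * pi * \<eta> * t))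
     = \<bar>1\<bar> *\<^sub>R (LINT \<eta>|lborel. of_real (exp (- pi * ((c + 1 * \<eta> - c) / l)\<^sup>2)) * cis (- 2 * pi * (c + 1 * \<eta>) * t))"
    by (rule lborel_integral_real_affine) simp
  also have "\<dots> = (LINT \<eta>|lborel. cis (- 2 * pi * c * t) * (of_real (exp (- pi * (\<eta> / l)\<^sup>2)) * cis (2 * pi * \<eta> * - t)))"
    by (simp only: abs_one scaleR_one mult_1_left add_diff_cancel_left' cis_mult mult.left_commute[of "cis _" "complex_of_real _"])
       (simp add: algebra_simps)
  also have "\<dots> = cis (- 2 * pi * c * t) * of_real (l * exp (- pi * (l * - t)\<^sup>2))"
    using gaussian_fourier[OF assms, of "- t"] by simp
  finally show ?thesis by simp
qed

text \<open>The factor l r makes the two Gaussians cancel on the kernel side at t = 0, where the exponential sum has no decay.\<close>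

lemma gaussian_difference_bound:
  fixes \<kappa> :: "'i \<Rightarrow> int" and c :: "'i \<Rightarrow> real"
  assumes g: "integrable cylinder g" and l: "l > 0" and r: "r > 0" and B: "finite B"
    and S: "\<And>x t. \<bar>l * exp (- pi * (l * t)\<^sup>2) - l * exp (- pi * (t / r)\<^sup>2)\<bar>
       * norm (\<Sum>k\<in>B. cis (- 2 * pi * (real_of_int (\<kappa> k) * x + c k * t))) \<le> S"
  shows "(\<Sum>k\<in>B. (LINT \<eta>|lborel. (exp (- pi * ((\<eta> - c k) / l)\<^sup>2) - l * r * exp (- pi * ((\<eta> - c k) / (1 / r))\<^sup>2))
       * (cmod (cyl_transform g (\<kappa> k) \<eta>))\<^sup>2)) \<le> S * (LINT z|cylinder. cmod (g z))\<^sup>2"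
proof -
  interpret cyl: sigma_finite_measure cylinder by (rule sigma_finite_cylinder)
  interpret cyl2: pair_sigma_finite cylinder cylinder ..
  let ?CC = "cylinder \<Otimes>\<^sub>M cylinder"
  have [measurable]: "g \<in> borel_measurable cylinder" using g by auto
  define w where "w k \<eta> = exp (- pi * ((\<eta> - c k) / l)\<^sup>2) - l * r * exp (- pi * ((\<eta> - c k) / (1 / r))\<^sup>2)" for k \<eta>
  define gk where "gk k z = g z * cis (- 2 * pi * real_of_int (\<kappa> k) * fst z)" for k z
  define h where "h t = l * exp (- pi * (l * t)\<^sup>2) - l * exp (- pi * (t / r)\<^sup>2)" for t
  have r': "1 / r > 0" using r by simp
  have wint: "integrable lborel (w k)" for k
    unfolding w_def[abs_def]
    by (intro Bochner_Integration.integrable_diff integrable_mult_right gaussian_integrable(1) l r')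
  have osc: "integrable lborel (\<lambda>\<eta>. of_real (exp (- pi * ((\<eta> - a) / b)\<^sup>2)) * cis (- 2 * pi * \<eta> * t))" if "b > 0" for a b t
    by (rule Bochner_Integration.integrable_bound[OF gaussian_integrable(1)[OF that, of a]]) (auto simp: norm_mult)
  \<comment> \<open>The transform depends on \<open>k\<close> only through the modulation by
    \<open>c k\<close>. The sum over \<open>k\<close> therefore factors into the common kernel
    \<open>h\<close> and one exponential sum.\<close>
  have what: "(LINT \<eta>|lborel. of_real (w k \<eta>) * cis (- 2 * pi * \<eta> * t)) = of_real (h t) * cis (- 2 * pi * c k * t)" for k t
  proof -
    have "(LINT \<eta>|lborel. of_real (w k \<eta>) * cis (- 2 * pi * \<eta> * t))
      = (LINT \<eta>|lborel. of_real (exp (- pi * ((\<eta> - c k) / l)\<^sup>2)) * cis (- 2 * pi * \<eta> * t)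
         - of_real (l * r) * (of_real (exp (- pi * ((\<eta> - c k) / (1 / r))\<^sup>2)) * cis (- 2 * pi * \<eta> * t)))"
      unfolding w_def by (intro Bochner_Integration.integral_cong refl) (simp add: algebra_simps)
    also have "\<dots> = cis (- 2 * pi * c k * t) * of_real (l * exp (- pi * (l * t)\<^sup>2))
        - of_real (l * r) * (cis (- 2 * pi * c k * t) * of_real ((1 / r) * exp (- pi * (1 / r * t)\<^sup>2)))"
      unfolding gaussian_fourier_shift[OF l, symmetric] gaussian_fourier_shift[OF r', symmetric]
      using osc[OF l] osc[OF r'] by (subst Bochner_Integration.integral_diff) auto
    also have "\<dots> = of_real (h t) * cis (- 2 * pi * c k * t)"
      using r by (simp add: h_def algebra_simps)
    finally show ?thesis .
  qed
  have gkint: "integrable cylinder (gk k)" for k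
    unfolding gk_def by (rule Bochner_Integration.integrable_bound[OF g]) (auto simp: norm_mult)
  have tr: "cyl_transform g (\<kappa> k) \<eta> = (LINT z|cylinder. gk k z * cis (- 2 * pi * \<eta> * snd z))" for k \<eta>
    by (simp add: cyl_transform_def gk_def)
  let ?I = "\<lambda>k p. gk k (fst p) * cnj (gk k (snd p)) * (of_real (h (snd (fst p) - snd (snd p))) * cis (- 2 * pi * c k * (snd (fst p) - snd (snd p))))"
  have W: "of_real (LINT \<eta>|lborel. w k \<eta> * (cmod (cyl_transform g (\<kappa> k) \<eta>))\<^sup>2) = (LINT p|?CC. ?I k p)" for k
    unfolding integral_complex_of_real[symmetric] tr
    using weighted_norm_square_integral(1)[OF sigma_finite_cylinder gkint[of k] measurable_cylinder_fst_snd(2) wint[of k]]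
    unfolding what by simp
  have gg: "integrable ?CC (\<lambda>p. of_real (cmod (g (fst p))) * complex_of_real (cmod (g (snd p))))"
    "(LINT p|?CC. of_real (cmod (g (fst p))) * complex_of_real (cmod (g (snd p)))) = of_real ((LINT z|cylinder. cmod (g z))\<^sup>2)"
    using integrable_integral_product[OF sigma_finite_cylinder sigma_finite_cylinder, of "\<lambda>z. of_real (cmod (g z))" "\<lambda>z. of_real (cmod (g z))"] g
    by (auto simp: power2_eq_square)
  have hb: "\<bar>h t\<bar> \<le> 2 * l" for t
  proof -
    have "0 \<le> exp (- pi * (l * t)\<^sup>2)" "exp (- pi * (l * t)\<^sup>2) \<le> 1" "0 \<le> exp (- pi * (t / r)\<^sup>2)" "exp (- pi * (t / r)\<^sup>2) \<le> 1"
      by simp_all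
    hence "\<bar>exp (- pi * (l * t)\<^sup>2) - exp (- pi * (t / r)\<^sup>2)\<bar> \<le> 2" by linarith
    hence "l * \<bar>exp (- pi * (l * t)\<^sup>2) - exp (- pi * (t / r)\<^sup>2)\<bar> \<le> l * 2" using l by (intro mult_left_mono) auto
    thus ?thesis using l unfolding h_def right_diff_distrib[symmetric] abs_mult by simp
  qed
  have hm [measurable]: "h \<in> borel_measurable borel" unfolding h_def by measurable
  have sndm [measurable]: "(\<lambda>p. snd (fst p)) \<in> borel_measurable ?CC" "(\<lambda>p. snd (snd p)) \<in> borel_measurable ?CC"
     "(\<lambda>p. fst (fst p)) \<in> borel_measurable ?CC" "(\<lambda>p. fst (snd p)) \<in> borel_measurable ?CC"
    using measurable_compose[OF measurable_fst measurable_cylinder_fst_snd(2)] measurable_compose[OF measurable_snd measurable_cylinder_fst_snd(2)]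
      measurable_compose[OF measurable_fst measurable_cylinder_fst_snd(1)] measurable_compose[OF measurable_snd measurable_cylinder_fst_snd(1)] by auto
  have Im: "?I k \<in> borel_measurable ?CC" for k unfolding gk_def by measurable
  have Iint: "integrable ?CC (?I k)" for k
  proof (rule Bochner_Integration.integrable_bound[OF integrable_mult_right[OF gg(1), of "of_real (2 * l)"] Im], rule AE_I2)
    fix p
    have "cmod (?I k p) = cmod (g (fst p)) * cmod (g (snd p)) * \<bar>h (snd (fst p) - snd (snd p))\<bar>"
      by (simp add: gk_def norm_mult)
    also have "\<dots> \<le> cmod (g (fst p)) * cmod (g (snd p)) * (2 * l)" by (intro mult_left_mono hb) auto
    finally show "cmod (?I k p) \<le> cmod (of_real (2 * l) * (of_real (cmod (g (fst p))) * complex_of_real (cmod (g (snd p)))))"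
      using l by (simp add: norm_mult mult_ac)
  qed
  have le: "x \<le> cmod z" if "complex_of_real x = z" for x z using that abs_ge_self[of x] by auto
  have "complex_of_real (\<Sum>k\<in>B. (LINT \<eta>|lborel. w k \<eta> * (cmod (cyl_transform g (\<kappa> k) \<eta>))\<^sup>2)) = (LINT p|?CC. (\<Sum>k\<in>B. ?I k p))"
    by (simp only: of_real_sum W) (rule Bochner_Integration.integral_sum[symmetric], rule Iint)
  hence "(\<Sum>k\<in>B. (LINT \<eta>|lborel. w k \<eta> * (cmod (cyl_transform g (\<kappa> k) \<eta>))\<^sup>2)) \<le> cmod (LINT p|?CC. (\<Sum>k\<in>B. ?I k p))"
    by (rule le)
  also have "\<dots> \<le> (LINT p|?CC. S * (cmod (g (fst p)) * cmod (g (snd p))))"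
  proof (rule Bochner_Integration.integral_norm_bound_integral)
    show "integrable ?CC (\<lambda>p. \<Sum>k\<in>B. ?I k p)" by (intro Bochner_Integration.integrable_sum Iint)
    show "integrable ?CC (\<lambda>p. S * (cmod (g (fst p)) * cmod (g (snd p))))"
      using integrable_Re[OF gg(1)] by (intro integrable_mult_right) simp
    fix p :: "(real \<times> real) \<times> real \<times> real"
    let ?x = "fst (fst p) - fst (snd p)" and ?t = "snd (fst p) - snd (snd p)"
    \<comment> \<open>After collecting phases, only the differences of the two points remain in the
      exponentials, which is the form in which the hypothesis \<open>S\<close> applies.\<close>
    have "?I k p = (g (fst p) * cnj (g (snd p)) * of_real (h ?t)) * cis (- 2 * pi * (real_of_int (\<kappa> k) * ?x + c k * ?t))" for k
    proof -
      have "cis (- 2 * pi * (real_of_int (\<kappa> k) * ?x + c k * ?t)) = cis (- 2 * pi * real_of_int (\<kappa> k) * fst (fst p))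
         * cnj (cis (- 2 * pi * real_of_int (\<kappa> k) * fst (snd p))) * cis (- 2 * pi * c k * ?t)"
        by (simp add: cis_cnj cis_mult algebra_simps)
      thus ?thesis by (simp add: gk_def mult_ac)
    qed
    hence "cmod (\<Sum>k\<in>B. ?I k p) = cmod (g (fst p)) * cmod (g (snd p)) * (\<bar>h ?t\<bar> * norm (\<Sum>k\<in>B. cis (- 2 * pi * (real_of_int (\<kappa> k) * ?x + c k * ?t))))"
      by (simp only: sum_distrib_left[symmetric] norm_mult complex_mod_cnj norm_of_real mult_ac)
    also have "\<dots> \<le> cmod (g (fst p)) * cmod (g (snd p)) * S"
      unfolding h_def by (intro mult_left_mono S) auto
    finally show "cmod (\<Sum>k\<in>B. ?I k p) \<le> S * (cmod (g (fst p)) * cmod (g (snd p)))" by (simp add: mult_ac)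
  qed
  also have "\<dots> = S * (LINT p|?CC. cmod (g (fst p)) * cmod (g (snd p)))" by simp
  also have "(LINT p|?CC. cmod (g (fst p)) * cmod (g (snd p))) = (LINT z|cylinder. cmod (g z))\<^sup>2"
    using gg(2) by (simp only: of_real_mult[symmetric] integral_complex_of_real of_real_eq_iff)
  finally show ?thesis by (simp add: w_def)
qed

section \<open>Energy estimates for annular multipliers\<close>

text \<open>Only nonnegative frequencies are listed; the negative ones are reached by a sign
  \<open>s\<close> multiplying \<open>k\<close>.\<close>

definition lattice_block :: "real \<Rightarrow> real \<Rightarrow> int set" where
  "lattice_block lam M = {k. 0 \<le> k \<and> M \<le> lam - of_int k \<and> lam - of_int k < 2 * M}"

lemma finite_lattice_block: "M \<ge> 0 \<Longrightarrow> finite (lattice_block lam M)"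
  by (rule finite_subset[of _ "{0..\<lfloor>lam\<rfloor>}"]) (auto simp: lattice_block_def le_floor_iff)

lemma card_lattice_block:
  assumes "M \<ge> 1"
  shows "real (card (lattice_block lam M)) \<le> 2 * M"
proof -
  have "lattice_block lam M \<subseteq> {\<lfloor>lam - 2 * M\<rfloor> + 1..\<lfloor>lam - M\<rfloor>}"
    by (auto simp: lattice_block_def le_floor_iff) linarith
  hence "card (lattice_block lam M) \<le> nat (\<lfloor>lam - M\<rfloor> - \<lfloor>lam - 2 * M\<rfloor>)"
    using card_mono[OF finite_atLeastAtMost_int, of "lattice_block lam M" "\<lfloor>lam - 2 * M\<rfloor> + 1" "\<lfloor>lam - M\<rfloor>"] by simp
  moreover have "real (nat (\<lfloor>lam - M\<rfloor> - \<lfloor>lam - 2 * M\<rfloor>)) \<le> M + 1"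
    using assms by linarith
  ultimately show ?thesis using assms by linarith
qed

text \<open>Subadditivity for a cover that may overlap: with both signs, \<open>k = 0\<close> can be
  covered twice.\<close>

lemma sum_UN_le:
  fixes f :: "'a \<Rightarrow> real"
  assumes "finite I" "\<And>i. i \<in> I \<Longrightarrow> finite (A i)" "\<And>x. 0 \<le> f x"
  shows "sum f (\<Union>i\<in>I. A i) \<le> (\<Sum>i\<in>I. sum f (A i))"
  using assms(1,2)
proof (induction I rule: finite_induct)
  case (insert i I)
  have "sum f (A i \<union> (\<Union>i\<in>I. A i)) \<le> sum f (A i) + sum f (\<Union>i\<in>I. A i)"
    using insert.prems insert.hyps sum.union_inter[of "A i" "\<Union>i\<in>I. A i" f] sum_nonneg[of "A i \<inter> (\<Union>i\<in>I. A i)" f] assms(3)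
    by force
  moreover have "sum f (\<Union>i\<in>I. A i) \<le> (\<Sum>i\<in>I. sum f (A i))" using insert by auto
  ultimately show ?case using insert.hyps by simp
qed simp

text \<open>Common bookkeeping for the measure and the energy of the symbol. The lines with
  \<open>\<bar>k\<bar> > lam - 2\<close>, at most \<open>D + 4\<close> of each sign, are charged
  \<open>e\<close>; the others lie in at most \<open>log 2 lam\<close> blocks per sign, each charged
  \<open>b\<close>. For \<open>lam < 2\<close> there are no blocks, which is why
  \<open>ln lam\<close> stands without an additive constant.\<close>

lemma dyadic_lattice_decomposition:
  fixes \<Phi> :: "int \<Rightarrow> real"
  assumes lam: "lam > 1" and K: "finite K" and nonneg: "\<And>k. 0 \<le> \<Phi> k" and D: "D \<ge> 0"
    and far: "\<And>k. lam + D < \<bar>of_int k\<bar> \<Longrightarrow> \<Phi> k = 0"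
    and edge: "\<And>k. \<Phi> k \<le> e"
    and block: "\<And>M s. 2 \<le> M \<Longrightarrow> M \<le> lam \<Longrightarrow> s \<in> {1, - 1} \<Longrightarrow> (\<Sum>k\<in>lattice_block lam M. \<Phi> (s * k)) \<le> b"
    and b: "b \<ge> 0"
  shows "(\<Sum>k\<in>K. \<Phi> k) \<le> 2 * (D + 4) * e + 4 * ln lam * b"
proof -
  define J where "J = nat \<lfloor>log 2 lam\<rfloor>"
  define E where "E s = (\<lambda>k. s * k) ` {\<lfloor>lam\<rfloor> - 2..\<lfloor>lam + D\<rfloor>}" for s :: int
  \<comment> \<open>The shift by one makes the first block begin at distance 2 from
    \<open>lam\<close>, where the edge set ends.\<close>
  define A where "A p = (\<lambda>k. snd p * k) ` lattice_block lam (2 ^ (fst p + 1))" for p :: "nat \<times> int"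
  define I where "I = {..<J} \<times> {1, - 1 :: int}"
  have fin: "finite I" "finite (E s)" "finite (A p)" for p s
    unfolding I_def A_def E_def by (auto intro!: finite_imageI finite_lattice_block)
  have e: "e \<ge> 0" using nonneg edge order_trans by blast
  have cover: "k \<in> E 1 \<union> E (- 1) \<union> (\<Union>p\<in>I. A p)" if "\<Phi> k \<noteq> 0" for k
  proof -
    have kD: "\<bar>of_int k\<bar> \<le> lam + D" using far[of k] that by force
    define s where "s = (if k \<ge> 0 then 1 else - 1 :: int)"
    have s: "s * s = 1" "s \<in> {1, - 1}" "\<bar>k\<bar> = s * k" by (auto simp: s_def)
    have k: "k = s * \<bar>k\<bar>" by (simp add: s(3) mult.assoc[symmetric] s(1))
    show ?thesis
    proof (cases "lam - 2 < \<bar>of_int k\<bar>")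
      case True
      have "\<bar>k\<bar> \<in> {\<lfloor>lam\<rfloor> - 2..\<lfloor>lam + D\<rfloor>}"
        using True kD by (auto simp: le_floor_iff) linarith
      hence "k \<in> E s" unfolding E_def using k by blast
      thus ?thesis using s(2) by auto
    next
      case False
      define y where "y = lam - \<bar>of_int k\<bar>"
      have y: "2 \<le> y" "y \<le> lam" using False by (auto simp: y_def)
      define n where "n = nat \<lfloor>log 2 y\<rfloor>"
      have "1 \<le> log 2 y" using y by simp
      hence n: "real n \<le> log 2 y" "log 2 y < real n + 1" "n \<ge> 1" by (auto simp: n_def le_nat_iff le_floor_iff)
      have "2 powr real n \<le> 2 powr log 2 y" "2 powr log 2 y < 2 powr (real n + 1)"
        using n by auto
      hence n2: "2 ^ n \<le> y" "y < 2 * 2 ^ n" using y by (simp_all add: powr_realpow powr_add)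
      have "log 2 y \<le> log 2 lam" using y by simp
      hence "n \<le> J" unfolding n_def J_def by (intro nat_mono floor_mono)
      hence "(n - 1, s) \<in> I" using n(3) s(2) by (auto simp: I_def)
      moreover have "\<bar>k\<bar> \<in> lattice_block lam (2 ^ (n - 1 + 1))"
        using n2 n(3) by (auto simp: lattice_block_def y_def)
      hence "k \<in> A (n - 1, s)" unfolding A_def using k by auto
      ultimately show ?thesis by blast
    qed
  qed
  have "(\<Sum>k\<in>K. \<Phi> k) = (\<Sum>k\<in>{k\<in>K. \<Phi> k \<noteq> 0}. \<Phi> k)" using K by (intro sum.mono_neutral_right) auto
  also have "\<dots> \<le> (\<Sum>k\<in>(E 1 \<union> E (- 1)) \<union> (\<Union>p\<in>I. A p). \<Phi> k)"
  proof (rule sum_mono2)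
    show "{k \<in> K. \<Phi> k \<noteq> 0} \<subseteq> (E 1 \<union> E (- 1)) \<union> (\<Union>p\<in>I. A p)" using cover by blast
  qed (use fin nonneg in auto)
  also have "\<dots> \<le> (\<Sum>k\<in>E 1 \<union> E (- 1). \<Phi> k) + (\<Sum>k\<in>(\<Union>p\<in>I. A p). \<Phi> k)"
    using fin sum.union_inter[of "E 1 \<union> E (- 1)" "\<Union>p\<in>I. A p" \<Phi>] nonneg sum_nonneg[of "(E 1 \<union> E (- 1)) \<inter> (\<Union>p\<in>I. A p)" \<Phi>] by force
  also have "\<dots> \<le> 2 * (D + 4) * e + 4 * ln lam * b"
  proof (rule add_mono)
    have cE: "real (card (E s)) \<le> D + 3 + 1" for s
    proof -
      have "card (E s) \<le> card {\<lfloor>lam\<rfloor> - 2..\<lfloor>lam + D\<rfloor>}" unfolding E_def by (rule card_image_le) simp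
      also have "real \<dots> \<le> D + 3 + 1" using D by (simp, linarith)
      finally show ?thesis by simp
    qed
    have "(\<Sum>k\<in>E 1 \<union> E (- 1). \<Phi> k) \<le> real (card (E 1 \<union> E (- 1))) * e"
      by (rule sum_bounded_above) (rule edge)
    also have "\<dots> \<le> 2 * (D + 4) * e"
    proof (rule mult_right_mono[OF _ e])
      have "real (card (E 1 \<union> E (- 1))) \<le> real (card (E 1)) + real (card (E (- 1)))"
        using card_Un_le[of "E 1" "E (- 1)"] by linarith
      thus "real (card (E 1 \<union> E (- 1))) \<le> 2 * (D + 4)" using cE[of 1] cE[of "- 1"] by simp
    qed
    finally show "(\<Sum>k\<in>E 1 \<union> E (- 1). \<Phi> k) \<le> 2 * (D + 4) * e" .
    have "(\<Sum>k\<in>(\<Union>p\<in>I. A p). \<Phi> k) \<le> (\<Sum>p\<in>I. \<Sum>k\<in>A p. \<Phi> k)" by (intro sum_UN_le fin nonneg)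
    also have "\<dots> \<le> (\<Sum>p\<in>I. b)"
    proof (rule sum_mono)
      fix p assume p: "p \<in> I"
      have "(\<Sum>k\<in>A p. \<Phi> k) = (\<Sum>k\<in>lattice_block lam (2 ^ (fst p + 1)). \<Phi> (snd p * k))"
        unfolding A_def using p by (subst sum.reindex) (auto simp: inj_on_def I_def)
      also have "\<dots> \<le> b"
      proof (rule block)
        have "fst p < nat \<lfloor>log 2 lam\<rfloor>" using p by (auto simp: I_def J_def)
        hence "real (fst p + 1) \<le> log 2 lam" by linarith
        hence "2 powr real (fst p + 1) \<le> 2 powr log 2 lam" by simp
        thus "2 ^ (fst p + 1) \<le> lam" using lam by (simp only: powr_realpow powr_log_cancel) 
        show "(2::real) \<le> 2 ^ (fst p + 1)" by simp
        show "snd p \<in> {1, - 1}" using p by (auto simp: I_def)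
      qed
      finally show "(\<Sum>k\<in>A p. \<Phi> k) \<le> b" .
    qed
    also have "\<dots> = (2 * real J) * b" by (simp add: I_def card_cartesian_product)
    also have "\<dots> \<le> (2 * (2 * ln lam)) * b"
    proof (rule mult_right_mono[OF mult_left_mono b])
      have "real J \<le> log 2 lam" using lam by (simp add: J_def)
      also have "log 2 lam = ln lam / ln 2" by (simp add: log_def)
      \<comment> \<open>The crude bound \<open>ln 2 \<ge> 1 / 2\<close> produces the factor 2 per
        sign.\<close>
      also have "\<dots> \<le> ln lam / (1 / 2)"
      proof (rule divide_left_mono)
        show "1 / 2 \<le> ln (2::real)" using ln2_ge_two_thirds by simp
      qed (use lam ln2_ge_two_thirds in auto)
      finally show "real J \<le> 2 * ln lam" by simp
    qed simp
    finally show "(\<Sum>k\<in>(\<Union>p\<in>I. A p). \<Phi> k) \<le> 4 * ln lam * b" by simp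
  qed
  finally show ?thesis .
qed

section \<open>Energy of the dual function on one block\<close>

text \<open>For \<open>cmod (g z) \<le> 1\<close> the squared L^2 norm is at most the L^1 norm, so
  the L^1 norm alone controls both the Bessel sum and the supremum of the transform.\<close>

lemma cyl_transform_properties:
  assumes g: "integrable cylinder g" and g1: "\<And>z. cmod (g z) \<le> 1"
  shows "cyl_transform g k \<in> borel_measurable borel"
    and "integrable lborel (\<lambda>\<eta>. (cmod (cyl_transform g k \<eta>))\<^sup>2)"
    and "finite K \<Longrightarrow> (\<Sum>k\<in>K. LINT \<eta>|lborel. (cmod (cyl_transform g k \<eta>))\<^sup>2) \<le> (LINT z|cylinder. cmod (g z))"
    and "cmod (cyl_transform g k \<eta>) \<le> (LINT z|cylinder. cmod (g z))"
proof -
  interpret cyl: sigma_finite_measure cylinder by (rule sigma_finite_cylinder)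
  have [measurable]: "g \<in> borel_measurable cylinder" using g by auto
  have meas: "cyl_transform g k \<in> borel_measurable lborel" for k
  proof -
    have "fst \<in> borel_measurable ((lborel :: real measure) \<Otimes>\<^sub>M cylinder)"
      using measurable_fst[of "lborel :: real measure" cylinder] by simp
    note [measurable] = this measurable_compose[OF measurable_snd measurable_cylinder_fst_snd(2)] measurable_compose[OF measurable_snd measurable_cylinder_fst_snd(1)]
    show ?thesis unfolding cyl_transform_def[abs_def] by (intro cyl.borel_measurable_lebesgue_integral) (simp add: case_prod_beta')
  qed
  thus [measurable]: "cyl_transform g k \<in> borel_measurable borel" for k by simp
  have gfin: "(\<integral>\<^sup>+z. ennreal ((cmod (g z))\<^sup>2) \<partial>cylinder) \<le> ennreal (LINT z|cylinder. cmod (g z))"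
  proof -
    have "(\<integral>\<^sup>+z. ennreal ((cmod (g z))\<^sup>2) \<partial>cylinder) \<le> (\<integral>\<^sup>+z. ennreal (cmod (g z)) \<partial>cylinder)"
    proof (intro nn_integral_mono ennreal_leI)
      fix z show "(cmod (g z))\<^sup>2 \<le> cmod (g z)"
        using mult_left_mono[OF g1[of z], of "cmod (g z)"] by (simp add: power2_eq_square)
    qed
    also have "\<dots> = ennreal (LINT z|cylinder. cmod (g z))"
      using g by (intro nn_integral_eq_integral) auto
    finally show ?thesis .
  qed
  have B: "finite K \<Longrightarrow> (\<Sum>k\<in>K. \<integral>\<^sup>+\<eta>. ennreal ((cmod (cyl_transform g k \<eta>))\<^sup>2) \<partial>lborel) \<le> ennreal (LINT z|cylinder. cmod (g z))" for K
    using order_trans[OF bessel_cyl_transform[OF g] gfin] by blast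
  show int: "integrable lborel (\<lambda>\<eta>. (cmod (cyl_transform g k \<eta>))\<^sup>2)" for k
    using B[of "{k}"] by (intro integrableI_bounded) (auto simp: le_less_trans[OF _ ennreal_less_top])
  show "(\<Sum>k\<in>K. LINT \<eta>|lborel. (cmod (cyl_transform g k \<eta>))\<^sup>2) \<le> (LINT z|cylinder. cmod (g z))" if K: "finite K"
  proof -
    have "ennreal (\<Sum>k\<in>K. LINT \<eta>|lborel. (cmod (cyl_transform g k \<eta>))\<^sup>2) = (\<Sum>k\<in>K. \<integral>\<^sup>+\<eta>. ennreal ((cmod (cyl_transform g k \<eta>))\<^sup>2) \<partial>lborel)"
      by (subst sum_ennreal[symmetric]) (auto simp: nn_integral_eq_integral[OF int])
    with B[OF K] have "ennreal (\<Sum>k\<in>K. LINT \<eta>|lborel. (cmod (cyl_transform g k \<eta>))\<^sup>2) \<le> ennreal (LINT z|cylinder. cmod (g z))" by simp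
    thus ?thesis by (subst (asm) ennreal_le_iff) auto
  qed
  show "cmod (cyl_transform g k \<eta>) \<le> (LINT z|cylinder. cmod (g z))"
    unfolding cyl_transform_def by (rule order_trans[OF integral_norm_bound]) (simp add: norm_mult)
qed

text \<open>If \<open>l * r > 1\<close>, the comparison Gaussian is narrower than the given one and
  no splitting is made: Bessel's inequality yields \<open>\<nu> \<le> l * r * \<nu>\<close>. The
  parameter \<open>\<rho>\<close> stays free until \<open>level_set_large\<close>.\<close>

lemma gaussian_block_estimate:
  assumes g: "integrable cylinder g" and g1: "\<And>z. cmod (g z) \<le> 1"
    and M: "M \<ge> 1" and lam: "lam > 0" and \<delta>: "\<delta> > 0" and \<rho>: "\<rho> > 0"
    and s: "s \<in> {1, - 1 :: int}" and \<sigma>: "\<sigma> \<in> {1, - 1 :: real}"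
  defines "\<nu> \<equiv> LINT z|cylinder. cmod (g z)" and "l \<equiv> \<delta> * sqrt (lam / M)"
  shows "(\<Sum>k\<in>lattice_block lam M. LINT \<eta>|lborel. exp (- pi * ((\<eta> - \<sigma> * sqrt (lam\<^sup>2 - (real_of_int k)\<^sup>2)) / l)\<^sup>2)
            * (cmod (cyl_transform g (s * k) \<eta>))\<^sup>2)
     \<le> 60 * (sqrt (lam * \<delta>) + \<delta> * sqrt (sqrt lam / \<rho>)) * \<nu>\<^sup>2 + \<delta> * sqrt lam * \<rho> * \<nu>"
    (is "(\<Sum>k\<in>?B. LINT \<eta>|lborel. ?W k \<eta> * ?G k \<eta>) \<le> ?S * \<nu>\<^sup>2 + ?R")
proof -
  note G = cyl_transform_properties[OF g g1]
  note [measurable] = G(1)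
  define r where "r = \<rho> * sqrt M"
  have l: "l > 0" using \<delta> lam M by (simp add: l_def)
  have r: "r > 0" using \<rho> M by (simp add: r_def)
  have \<nu>: "\<nu> \<ge> 0" unfolding \<nu>_def by simp
  have fin: "finite ?B" using M by (intro finite_lattice_block) auto
  have lr: "l * r = \<delta> * sqrt lam * \<rho>" using M by (simp add: l_def r_def real_sqrt_divide)
  have R: "?R = l * r * \<nu>" by (simp add: lr)
  have tot: "(\<Sum>k\<in>?B. LINT \<eta>|lborel. ?G k \<eta>) \<le> \<nu>"
  proof -
    have "(\<Sum>k\<in>?B. LINT \<eta>|lborel. ?G k \<eta>) = (\<Sum>k\<in>(\<lambda>k. s * k) ` ?B. LINT \<eta>|lborel. (cmod (cyl_transform g k \<eta>))\<^sup>2)"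
      using s by (subst sum.reindex) (auto simp: inj_on_def)
    also have "\<dots> \<le> \<nu>" unfolding \<nu>_def using fin by (intro G(3)) auto
    finally show ?thesis .
  qed
  have Vint: "integrable lborel (\<lambda>\<eta>. exp (- pi * ((\<eta> - a) / b)\<^sup>2) * ?G k \<eta>)" for a b k
    by (rule Bochner_Integration.integrable_bound[OF G(2)[of "s * k"]]) (auto simp: mult_left_le_one_le)
  have Vle: "(LINT \<eta>|lborel. exp (- pi * ((\<eta> - a) / b)\<^sup>2) * ?G k \<eta>) \<le> (LINT \<eta>|lborel. ?G k \<eta>)" for a b k
    by (intro integral_mono Vint G(2)) (simp add: mult_left_le_one_le)
  show ?thesis
  proof (cases "l * r \<le> 1")
    case False
    have "(\<Sum>k\<in>?B. LINT \<eta>|lborel. ?W k \<eta> * ?G k \<eta>) \<le> (\<Sum>k\<in>?B. LINT \<eta>|lborel. ?G k \<eta>)"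
      by (intro sum_mono Vle)
    also have "\<dots> \<le> 1 * \<nu>" using tot by simp
    also have "\<dots> \<le> l * r * \<nu>" using False \<nu> by (intro mult_right_mono) auto
    also have "\<dots> \<le> ?S * \<nu>\<^sup>2 + ?R"
    proof -
      have "0 \<le> ?S * \<nu>\<^sup>2" using lam \<delta> \<rho> by (intro mult_nonneg_nonneg add_nonneg_nonneg) auto
      thus ?thesis unfolding R by simp
    qed
    finally show ?thesis .
  next
    case True
    define c where "c k = \<sigma> * sqrt (lam\<^sup>2 - (real_of_int k)\<^sup>2)" for k :: int
    have kernel: "\<bar>l * exp (- pi * (l * t)\<^sup>2) - l * exp (- pi * (t / r)\<^sup>2)\<bar>
       * norm (\<Sum>k\<in>?B. cis (- 2 * pi * (real_of_int (s * k) * x + c k * t))) \<le> ?S" for x t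
    proof -
      \<comment> \<open>The signs \<open>s\<close> and \<open>\<sigma>\<close> are moved to the
        space variables, so that one kernel bound covers all four combinations.\<close>
      define x' t' where "x' = - real_of_int s * x" and "t' = - \<sigma> * t"
      have sq: "(l * t)\<^sup>2 = (l * t')\<^sup>2" "(t / r)\<^sup>2 = (t' / r)\<^sup>2"
        using \<sigma> by (auto simp: t'_def power2_eq_square)
      have "- 2 * pi * (real_of_int (s * k) * x + c k * t) = 2 * pi * (real_of_int k * x' + sqrt (lam\<^sup>2 - (real_of_int k)\<^sup>2) * t')" for k
        by (simp add: x'_def t'_def c_def algebra_simps)
      thus ?thesis unfolding sq
        using circle_block_kernel[OF M lam \<delta> \<rho> lattice_block_def True[unfolded l_def r_def], of t' x'] by (simp only: l_def r_def)
    qed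
    have "(\<Sum>k\<in>?B. LINT \<eta>|lborel. ?W k \<eta> * ?G k \<eta>)
      = (\<Sum>k\<in>?B. (LINT \<eta>|lborel. (exp (- pi * ((\<eta> - c k) / l)\<^sup>2) - l * r * exp (- pi * ((\<eta> - c k) / (1 / r))\<^sup>2)) * ?G k \<eta>)
         + l * r * (LINT \<eta>|lborel. exp (- pi * ((\<eta> - c k) / (1 / r))\<^sup>2) * ?G k \<eta>))"
    proof (intro sum.cong refl)
      fix k
      have "(LINT \<eta>|lborel. (exp (- pi * ((\<eta> - c k) / l)\<^sup>2) - l * r * exp (- pi * ((\<eta> - c k) / (1 / r))\<^sup>2)) * ?G k \<eta>)
        = (LINT \<eta>|lborel. exp (- pi * ((\<eta> - c k) / l)\<^sup>2) * ?G k \<eta> - (l * r) * (exp (- pi * ((\<eta> - c k) / (1 / r))\<^sup>2) * ?G k \<eta>))"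
        by (intro Bochner_Integration.integral_cong refl) (simp add: algebra_simps)
      also have "\<dots> = (LINT \<eta>|lborel. exp (- pi * ((\<eta> - c k) / l)\<^sup>2) * ?G k \<eta>) - (l * r) * (LINT \<eta>|lborel. exp (- pi * ((\<eta> - c k) / (1 / r))\<^sup>2) * ?G k \<eta>)"
        by (subst Bochner_Integration.integral_diff[OF Vint integrable_mult_right[OF Vint]]) simp
      finally show "(LINT \<eta>|lborel. ?W k \<eta> * ?G k \<eta>)
         = (LINT \<eta>|lborel. (exp (- pi * ((\<eta> - c k) / l)\<^sup>2) - l * r * exp (- pi * ((\<eta> - c k) / (1 / r))\<^sup>2)) * ?G k \<eta>)
         + l * r * (LINT \<eta>|lborel. exp (- pi * ((\<eta> - c k) / (1 / r))\<^sup>2) * ?G k \<eta>)"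
        by (simp add: c_def)
    qed
    also have "\<dots> \<le> ?S * \<nu>\<^sup>2 + l * r * \<nu>"
      unfolding sum.distrib sum_distrib_left[symmetric]
    proof (rule add_mono)
      show "(\<Sum>k\<in>?B. LINT \<eta>|lborel. (exp (- pi * ((\<eta> - c k) / l)\<^sup>2) - l * r * exp (- pi * ((\<eta> - c k) / (1 / r))\<^sup>2)) * ?G k \<eta>) \<le> ?S * \<nu>\<^sup>2"
        unfolding \<nu>_def by (rule gaussian_difference_bound[OF g l r fin kernel])
      have "(\<Sum>k\<in>?B. LINT \<eta>|lborel. exp (- pi * ((\<eta> - c k) / (1 / r))\<^sup>2) * ?G k \<eta>) \<le> (\<Sum>k\<in>?B. LINT \<eta>|lborel. ?G k \<eta>)"
        by (intro sum_mono Vle)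
      also note tot
      finally show "l * r * (\<Sum>k\<in>?B. LINT \<eta>|lborel. exp (- pi * ((\<eta> - c k) / (1 / r))\<^sup>2) * ?G k \<eta>) \<le> l * r * \<nu>"
        using l r by (intro mult_left_mono) auto
    qed
    finally show ?thesis unfolding R .
  qed
qed

section \<open>Symbols supported in a thin annulus\<close>

lemma two_interval_integral:
  fixes f :: "real \<Rightarrow> real"
  assumes [measurable]: "f \<in> borel_measurable borel" and f: "\<And>x. 0 \<le> f x" "\<And>x. f x \<le> F" and w: "w \<ge> 0"
    and supp: "\<And>x. f x \<noteq> 0 \<Longrightarrow> \<bar>\<bar>x\<bar> - s\<bar> \<le> w"
  shows "integrable lborel f" "(LINT x|lborel. f x) \<le> F * (4 * w)"
proof -
  have F: "F \<ge> 0" using f order_trans by blast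
  let ?i = "\<lambda>x. F * (indicator {s - w..s + w} x + indicator {- s - w..- s + w} x)"
  have i: "integrable lborel ?i" using w by (intro integrable_mult_right Bochner_Integration.integrable_add) auto
  have le: "f x \<le> ?i x" for x
  proof (cases "f x = 0")
    case False
    have "x \<in> {s - w..s + w} \<or> x \<in> {- s - w..- s + w}" using supp[OF False] by (auto simp: abs_if split: if_splits)
    hence "1 \<le> indicator {s - w..s + w} x + (indicator {- s - w..- s + w} x :: real)" by (auto simp: indicator_def)
    hence "F * 1 \<le> ?i x" using F by (intro mult_left_mono) auto
    thus ?thesis using f(2)[of x] by linarith
  qed (use F in auto)
  show fi: "integrable lborel f"
    by (rule Bochner_Integration.integrable_bound[OF i]) (use f(1) F le in auto)
  have "(LINT x|lborel. f x) \<le> (LINT x|lborel. ?i x)" by (rule integral_mono[OF fi i le])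
  also have "\<dots> = F * (4 * w)"
    using w by (subst integral_mult_right_zero, subst Bochner_Integration.integral_add) auto
  finally show "(LINT x|lborel. f x) \<le> F * (4 * w)" .
qed

text \<open>The source is \<open>\<bar>\<eta>^2 - q^2\<bar> = \<bar>\<bar>\<eta>\<bar> - q\<bar> *
  (\<bar>\<eta>\<bar> + q)\<close>. Bounding the last factor below by
  \<open>\<bar>\<bar>\<eta>\<bar> - q\<bar>\<close> gives the square-root width, valid up to and
  beyond tangency; bounding it below by \<open>q \<ge> sqrt (M * lam)\<close> gives the width inside
  a block.\<close>

lemma annulus_support:
  fixes \<eta> lam \<delta> D :: real and k :: real
  assumes D: "D \<ge> 1" and lam: "lam > 1" and \<delta>: "0 < \<delta>" "\<delta> < 1"
    and near: "\<bar>k\<^sup>2 + \<eta>\<^sup>2 - lam\<^sup>2\<bar> \<le> D * lam * \<delta>"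
  shows "\<bar>\<bar>\<eta>\<bar> - sqrt (max (lam\<^sup>2 - k\<^sup>2) 0)\<bar> \<le> sqrt (D * lam * \<delta>)"
    and "\<bar>k\<bar> \<le> lam + D"
    and "M \<ge> 1 \<Longrightarrow> 0 \<le> k \<Longrightarrow> M \<le> lam - k \<Longrightarrow> \<bar>\<bar>\<eta>\<bar> - sqrt (lam\<^sup>2 - k\<^sup>2)\<bar> \<le> D * (\<delta> * sqrt (lam / M))"
proof -
  have pos: "0 < D * lam * \<delta>" using assms by simp
  \<comment> \<open>Truncation at 0 includes the lines with \<open>\<bar>k\<bar> > lam\<close>,
    which miss the circle but may meet the annulus.\<close>
  define q where "q = sqrt (max (lam\<^sup>2 - k\<^sup>2) 0)"
  have q: "q \<ge> 0" "q\<^sup>2 = max (lam\<^sup>2 - k\<^sup>2) 0" by (auto simp: q_def)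
  have "\<bar>\<eta>\<^sup>2 - q\<^sup>2\<bar> \<le> D * lam * \<delta>"
    using near unfolding q(2) max_def by (auto simp: abs_if split: if_splits)
  moreover have eq: "\<bar>\<eta>\<^sup>2 - q\<^sup>2\<bar> = \<bar>\<bar>\<eta>\<bar> - q\<bar> * (\<bar>\<eta>\<bar> + q)"
  proof -
    have "\<eta>\<^sup>2 - q\<^sup>2 = (\<bar>\<eta>\<bar> - q) * (\<bar>\<eta>\<bar> + q)" by (simp add: algebra_simps power2_eq_square)
    thus ?thesis using q by (simp add: abs_mult)
  qed
  moreover have "\<bar>\<bar>\<eta>\<bar> - q\<bar> * \<bar>\<bar>\<eta>\<bar> - q\<bar> \<le> \<bar>\<bar>\<eta>\<bar> - q\<bar> * (\<bar>\<eta>\<bar> + q)"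
    using q by (intro mult_left_mono) auto
  ultimately have prod: "\<bar>\<bar>\<eta>\<bar> - q\<bar> * (\<bar>\<eta>\<bar> + q) \<le> D * lam * \<delta>" "\<bar>\<bar>\<eta>\<bar> - q\<bar> * \<bar>\<bar>\<eta>\<bar> - q\<bar> \<le> D * lam * \<delta>" by linarith+
  show "\<bar>\<bar>\<eta>\<bar> - sqrt (max (lam\<^sup>2 - k\<^sup>2) 0)\<bar> \<le> sqrt (D * lam * \<delta>)"
    unfolding q_def[symmetric] using prod(2) by (intro real_le_rsqrt) (simp add: power2_eq_square)
  show "\<bar>k\<bar> \<le> lam + D"
  proof (rule ccontr)
    assume "\<not> ?thesis"
    hence "(lam + D)\<^sup>2 \<le> \<bar>k\<bar>\<^sup>2" using lam D by (intro power_mono) auto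
    hence "lam\<^sup>2 + 2 * (D * lam) + D\<^sup>2 \<le> k\<^sup>2" by (simp add: power2_sum algebra_simps)
    moreover have "k\<^sup>2 \<le> lam\<^sup>2 + D * lam * \<delta>" using near zero_le_power2[of \<eta>] by linarith
    moreover have "D * lam * \<delta> \<le> D * lam" using D lam \<delta> mult_left_mono[of \<delta> 1 "D * lam"] by simp
    moreover have "0 \<le> D\<^sup>2" "0 < D * lam" using D lam by auto
    ultimately show False by linarith
  qed
  assume M: "M \<ge> 1" "0 \<le> k" "M \<le> lam - k"
  have "M * lam \<le> (lam - k) * (lam + k)" using M lam by (intro mult_mono) auto
  hence Ml: "M * lam \<le> lam\<^sup>2 - k\<^sup>2" by (simp add: algebra_simps power2_eq_square)
  hence qq: "q = sqrt (lam\<^sup>2 - k\<^sup>2)" using M lam by (auto simp: q_def max_def)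
  have qM: "sqrt M * sqrt lam \<le> q" unfolding qq real_sqrt_mult[symmetric] using Ml by simp
  have sM: "sqrt M > 0" "sqrt lam > 0" using M lam by auto
  have "\<bar>\<bar>\<eta>\<bar> - q\<bar> * (sqrt M * sqrt lam) \<le> \<bar>\<bar>\<eta>\<bar> - q\<bar> * (\<bar>\<eta>\<bar> + q)"
    using qM by (intro mult_left_mono) auto
  also have "\<dots> \<le> D * lam * \<delta>" by (rule prod)
  finally have "\<bar>\<bar>\<eta>\<bar> - q\<bar> \<le> D * (sqrt lam * sqrt lam) * \<delta> / (sqrt M * sqrt lam)" using sM lam by (simp add: field_simps)
  also have "\<dots> = D * (\<delta> * sqrt (lam / M))"
  proof -
    have "D * (a * a) * \<delta> / (b * a) = D * (\<delta> * (a / b))" if "a > 0" for a b :: real using that by simp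
    from this[OF sM(2)] show ?thesis unfolding real_sqrt_divide .
  qed
  finally show "\<bar>\<bar>\<eta>\<bar> - sqrt (lam\<^sup>2 - k\<^sup>2)\<bar> \<le> D * (\<delta> * sqrt (lam / M))" by (simp add: qq)
qed

text \<open>What the estimates extract from the symbol: size, measurability and support. The support
  is described through squares so that \<open>annulus_support\<close> can factor the condition on
  each line.\<close>

locale annulus_multiplier =
  fixes m :: "int \<Rightarrow> real \<Rightarrow> real" and lam \<delta> D :: real
  assumes D: "D \<ge> 1" and lam: "lam > 1" and \<delta>: "0 < \<delta>" "\<delta> < 1"
    and measurable_m [measurable]: "\<And>k. m k \<in> borel_measurable borel"
    and m_le_1: "\<And>k \<eta>. \<bar>m k \<eta>\<bar> \<le> 1"
    and m_support: "\<And>k \<eta>. m k \<eta> \<noteq> 0 \<Longrightarrow> \<bar>(real_of_int k)\<^sup>2 + \<eta>\<^sup>2 - lam\<^sup>2\<bar> \<le> D * lam * \<delta>"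
begin

lemma m2_le_1: "(m k \<eta>)\<^sup>2 \<le> 1"
  using m_le_1[of k \<eta>] abs_square_le_1 by blast

lemma far: "lam + D < \<bar>real_of_int k\<bar> \<Longrightarrow> m k \<eta> = 0"
  using annulus_support(2)[OF D lam \<delta> m_support[of k \<eta>]] by linarith

lemma weighted_edge:
  assumes [measurable]: "f \<in> borel_measurable borel" and f: "\<And>\<eta>. 0 \<le> f \<eta>" "\<And>\<eta>. f \<eta> \<le> F"
  shows "integrable lborel (\<lambda>\<eta>. (m k \<eta>)\<^sup>2 * f \<eta>)"
    and "(LINT \<eta>|lborel. (m k \<eta>)\<^sup>2 * f \<eta>) \<le> F * (4 * sqrt (D * lam * \<delta>))"
proof -
  have le: "(m k \<eta>)\<^sup>2 * f \<eta> \<le> F" for \<eta>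
    using mult_right_mono[OF m2_le_1[of k \<eta>] f(1)[of \<eta>]] f(2)[of \<eta>] by simp
  have supp: "\<bar>\<bar>\<eta>\<bar> - sqrt (max (lam\<^sup>2 - (real_of_int k)\<^sup>2) 0)\<bar> \<le> sqrt (D * lam * \<delta>)" if "(m k \<eta>)\<^sup>2 * f \<eta> \<noteq> 0" for \<eta>
    using that by (intro annulus_support(1)[OF D lam \<delta>] m_support) auto
  show "integrable lborel (\<lambda>\<eta>. (m k \<eta>)\<^sup>2 * f \<eta>)" "(LINT \<eta>|lborel. (m k \<eta>)\<^sup>2 * f \<eta>) \<le> F * (4 * sqrt (D * lam * \<delta>))"
    using D lam \<delta> by (auto intro!: two_interval_integral[OF _ _ le _ supp] mult_nonneg_nonneg f(1))
qed

text \<open>A block has at most \<open>2 * M\<close> lines with two intervals of length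
  \<open>2 * D * \<delta> * sqrt (lam / M)\<close> each, in total
  \<open>8 * D * \<delta> * sqrt (M * lam)\<close>, and \<open>M \<le> lam\<close>. The sum is the
  quantity behind the supremum bound.\<close>

lemma multiplier_measure:
  assumes "finite K"
  shows "(\<Sum>k\<in>K. LINT \<eta>|lborel. (m k \<eta>)\<^sup>2) \<le> 2 * (D + 4) * (4 * sqrt (D * lam * \<delta>)) + 4 * ln lam * (8 * D * (lam * \<delta>))"
proof (rule dyadic_lattice_decomposition[OF lam assms])
  show "(LINT \<eta>|lborel. (m k \<eta>)\<^sup>2) \<le> 4 * sqrt (D * lam * \<delta>)" for k
    using weighted_edge(2)[of "\<lambda>_. 1" 1 k] by simp
  show "(LINT \<eta>|lborel. (m k \<eta>)\<^sup>2) = 0" if "lam + D < \<bar>real_of_int k\<bar>" for k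
    using far[OF that] by simp
  fix M :: real and s :: int assume M: "2 \<le> M" "M \<le> lam" and s: "s \<in> {1, - 1}"
  have "(\<Sum>k\<in>lattice_block lam M. LINT \<eta>|lborel. (m (s * k) \<eta>)\<^sup>2) \<le> (\<Sum>k\<in>lattice_block lam M. 1 * (4 * (D * (\<delta> * sqrt (lam / M)))))"
  proof (intro sum_mono two_interval_integral)
    fix k \<eta> assume k: "k \<in> lattice_block lam M" and "(m (s * k) \<eta>)\<^sup>2 \<noteq> 0"
    hence "\<bar>(real_of_int (s * k))\<^sup>2 + \<eta>\<^sup>2 - lam\<^sup>2\<bar> \<le> D * lam * \<delta>" by (intro m_support) auto
    hence "\<bar>(real_of_int k)\<^sup>2 + \<eta>\<^sup>2 - lam\<^sup>2\<bar> \<le> D * lam * \<delta>" using s by (auto simp: power2_eq_square)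
    thus "\<bar>\<bar>\<eta>\<bar> - sqrt (lam\<^sup>2 - (real_of_int k)\<^sup>2)\<bar> \<le> D * (\<delta> * sqrt (lam / M))"
      using k M by (intro annulus_support(3)[OF D lam \<delta>]) (auto simp: lattice_block_def)
  qed (use m2_le_1 D \<delta> lam M in auto)
  also have "\<dots> = real (card (lattice_block lam M)) * (4 * (D * (\<delta> * sqrt (lam / M))))" by simp
  also have "\<dots> \<le> (2 * M) * (4 * (D * (\<delta> * sqrt (lam / M))))"
    using M D \<delta> lam by (intro mult_right_mono card_lattice_block) auto
  also have "\<dots> = 8 * D * \<delta> * (sqrt M * sqrt lam)"
    using M real_sqrt_mult_self[of M] by (simp add: real_sqrt_divide field_simps)
  also have "\<dots> \<le> 8 * D * \<delta> * (sqrt lam * sqrt lam)" using M D \<delta> lam by (intro mult_left_mono mult_right_mono) auto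
  also have "\<dots> = 8 * D * (lam * \<delta>)" using lam by simp
  finally show "(\<Sum>k\<in>lattice_block lam M. LINT \<eta>|lborel. (m (s * k) \<eta>)\<^sup>2) \<le> 8 * D * (lam * \<delta>)" .
qed (use D lam \<delta> in auto)

text \<open>On the support, one of the two centres is at distance at most \<open>D * l\<close>, so
  the majorizing Gaussians lose only the factor \<open>exp (pi * D^2)\<close>. On the lines near
  tangency the transform is bounded by its supremum, which gives \<open>\<nu>^2\<close> times the
  length of the support.\<close>

lemma multiplier_energy:
  assumes K: "finite K" and g: "integrable cylinder g" and g1: "\<And>z. cmod (g z) \<le> 1" and \<rho>: "\<rho> > 0"
  defines "\<nu> \<equiv> LINT z|cylinder. cmod (g z)"
  shows "(\<Sum>k\<in>K. LINT \<eta>|lborel. (m k \<eta>)\<^sup>2 * (cmod (cyl_transform g k \<eta>))\<^sup>2)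
     \<le> 2 * (D + 4) * (\<nu>\<^sup>2 * (4 * sqrt (D * lam * \<delta>))) + 4 * ln lam * (exp (pi * D\<^sup>2) *
        (2 * (60 * (sqrt (lam * \<delta>) + \<delta> * sqrt (sqrt lam / \<rho>)) * \<nu>\<^sup>2 + \<delta> * sqrt lam * \<rho> * \<nu>)))"
proof -
  note G = cyl_transform_properties[OF g g1]
  note [measurable] = G(1)
  have \<nu>: "\<nu> \<ge> 0" unfolding \<nu>_def by simp
  have G2: "(cmod (cyl_transform g k \<eta>))\<^sup>2 \<le> \<nu>\<^sup>2" for k \<eta>
    unfolding \<nu>_def by (intro power_mono G(4)) auto
  let ?Q = "60 * (sqrt (lam * \<delta>) + \<delta> * sqrt (sqrt lam / \<rho>)) * \<nu>\<^sup>2 + \<delta> * sqrt lam * \<rho> * \<nu>"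
  have Q: "?Q \<ge> 0" using lam \<delta> \<rho> \<nu> by (intro add_nonneg_nonneg mult_nonneg_nonneg) auto
  show ?thesis
  proof (rule dyadic_lattice_decomposition[OF lam K])
    show "(LINT \<eta>|lborel. (m k \<eta>)\<^sup>2 * (cmod (cyl_transform g k \<eta>))\<^sup>2) \<le> \<nu>\<^sup>2 * (4 * sqrt (D * lam * \<delta>))" for k
      by (rule weighted_edge(2)) (auto intro: G2)
    show "(LINT \<eta>|lborel. (m k \<eta>)\<^sup>2 * (cmod (cyl_transform g k \<eta>))\<^sup>2) = 0" if "lam + D < \<bar>real_of_int k\<bar>" for k
      using far[OF that] by simp
    show "0 \<le> exp (pi * D\<^sup>2) * (2 * ?Q)" using Q by simp
    fix M :: real and s :: int assume M: "2 \<le> M" "M \<le> lam" and s: "s \<in> {1, - 1}"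
    define l where "l = \<delta> * sqrt (lam / M)"
    have l: "l > 0" using \<delta> lam M by (simp add: l_def)
    define q where "q k = sqrt (lam\<^sup>2 - (real_of_int k)\<^sup>2)" for k
    let ?G = "\<lambda>k \<eta>. (cmod (cyl_transform g (s * k) \<eta>))\<^sup>2"
    let ?V = "\<lambda>\<sigma> k \<eta>. exp (- pi * ((\<eta> - \<sigma> * q k) / l)\<^sup>2)"
    have Vint: "integrable lborel (\<lambda>\<eta>. ?V \<sigma> k \<eta> * ?G k \<eta>)" for \<sigma> k
      by (rule Bochner_Integration.integrable_bound[OF G(2)[of "s * k"]]) (auto simp: mult_left_le_one_le)
    have "(\<Sum>k\<in>lattice_block lam M. LINT \<eta>|lborel. (m (s * k) \<eta>)\<^sup>2 * ?G k \<eta>)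
       \<le> (\<Sum>k\<in>lattice_block lam M. LINT \<eta>|lborel. exp (pi * D\<^sup>2) * (?V 1 k \<eta> * ?G k \<eta> + ?V (- 1) k \<eta> * ?G k \<eta>))"
    proof (intro sum_mono integral_mono)
      fix k assume k: "k \<in> lattice_block lam M"
      show "integrable lborel (\<lambda>\<eta>. (m (s * k) \<eta>)\<^sup>2 * ?G k \<eta>)" by (rule weighted_edge(1)) (auto intro: G2)
      show "integrable lborel (\<lambda>\<eta>. exp (pi * D\<^sup>2) * (?V 1 k \<eta> * ?G k \<eta> + ?V (- 1) k \<eta> * ?G k \<eta>))"
        by (intro integrable_mult_right Bochner_Integration.integrable_add Vint)
      fix \<eta>
      have "(m (s * k) \<eta>)\<^sup>2 \<le> exp (pi * D\<^sup>2) * (?V 1 k \<eta> + ?V (- 1) k \<eta>)"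
      proof (cases "m (s * k) \<eta> = 0")
        case False
        hence "\<bar>(real_of_int (s * k))\<^sup>2 + \<eta>\<^sup>2 - lam\<^sup>2\<bar> \<le> D * lam * \<delta>" by (intro m_support) auto
        hence "\<bar>(real_of_int k)\<^sup>2 + \<eta>\<^sup>2 - lam\<^sup>2\<bar> \<le> D * lam * \<delta>" using s by (auto simp: power2_eq_square)
        hence near: "\<bar>\<bar>\<eta>\<bar> - q k\<bar> \<le> D * l"
          unfolding q_def l_def using k M by (intro annulus_support(3)[OF D lam \<delta>]) (auto simp: lattice_block_def)
        have V: "1 \<le> exp (pi * D\<^sup>2) * exp (- pi * (a / l)\<^sup>2)" if "\<bar>a\<bar> \<le> D * l" for a
        proof -
          have "\<bar>a / l\<bar> \<le> \<bar>D\<bar>" using that l D by (simp add: field_simps)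
          hence "(a / l)\<^sup>2 \<le> D\<^sup>2" by (rule abs_le_square_iff[THEN iffD1])
          hence "0 \<le> pi * D\<^sup>2 + - pi * (a / l)\<^sup>2" by (simp add: mult_left_mono)
          thus ?thesis unfolding exp_add[symmetric] by simp
        qed
        have "1 \<le> exp (pi * D\<^sup>2) * (?V 1 k \<eta> + ?V (- 1) k \<eta>)"
        proof (cases "\<eta> \<ge> 0")
          case True
          hence "1 \<le> exp (pi * D\<^sup>2) * ?V 1 k \<eta>" using near by (intro V) auto
          moreover have "0 \<le> exp (pi * D\<^sup>2) * ?V (- 1) k \<eta>" by simp
          ultimately show ?thesis by (simp only: distrib_left)
        next
          case False
          hence "1 \<le> exp (pi * D\<^sup>2) * ?V (- 1) k \<eta>" using near by (intro V) auto
          moreover have "0 \<le> exp (pi * D\<^sup>2) * ?V 1 k \<eta>" by simp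
          ultimately show ?thesis by (simp only: distrib_left)
        qed
        thus ?thesis using m2_le_1[of "s * k" \<eta>] by linarith
      qed simp
      from mult_right_mono[OF this, of "?G k \<eta>"]
      show "(m (s * k) \<eta>)\<^sup>2 * ?G k \<eta> \<le> exp (pi * D\<^sup>2) * (?V 1 k \<eta> * ?G k \<eta> + ?V (- 1) k \<eta> * ?G k \<eta>)"
        by (simp add: algebra_simps)
    qed
    also have "\<dots> = exp (pi * D\<^sup>2) * ((\<Sum>k\<in>lattice_block lam M. LINT \<eta>|lborel. ?V 1 k \<eta> * ?G k \<eta>)
        + (\<Sum>k\<in>lattice_block lam M. LINT \<eta>|lborel. ?V (- 1) k \<eta> * ?G k \<eta>))"
      unfolding integral_mult_right_zero Bochner_Integration.integral_add[OF Vint Vint] sum_distrib_left[symmetric] sum.distrib ..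
    also have "\<dots> \<le> exp (pi * D\<^sup>2) * (2 * ?Q)"
    proof -
      have "(\<Sum>k\<in>lattice_block lam M. LINT \<eta>|lborel. ?V \<sigma> k \<eta> * ?G k \<eta>) \<le> ?Q" if "\<sigma> \<in> {1, - 1}" for \<sigma>
        unfolding q_def l_def \<nu>_def using M lam \<delta> by (intro gaussian_block_estimate[OF g g1 _ _ _ \<rho> s that]) auto
      from this[of 1] this[of "- 1"] show ?thesis by (intro mult_left_mono) auto
    qed
    finally show "(\<Sum>k\<in>lattice_block lam M. LINT \<eta>|lborel. (m (s * k) \<eta>)\<^sup>2 * ?G k \<eta>) \<le> exp (pi * D\<^sup>2) * (2 * ?Q)" .
  qed (use D in auto)
qed

end

section \<open>Level sets and the upper bound\<close>

context annulus_multiplier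
begin

definition freqs :: "int set" where "freqs = {- \<lceil>lam + D\<rceil>..\<lceil>lam + D\<rceil>}"

text \<open>Collects \<open>2 * 4 * (D + 4) * sqrt D\<close> from the lines near tangency,
  \<open>480 = 4 * 2 * 60\<close> from the kernel estimate and \<open>32 = 4 * 8\<close> from the
  measure of the blocks.\<close>

definition C1 :: real where "C1 = 8 * (D + 4) * sqrt D + 480 * exp (pi * D\<^sup>2) + 32 * D"

text \<open>The spectral projector with free Fourier data \<open>\<phi>\<close> in place of
  \<open>fourier_cyl f\<close>, so that only the energy of the data enters.\<close>

definition synthesis :: "(int \<Rightarrow> real \<Rightarrow> complex) \<Rightarrow> real \<times> real \<Rightarrow> complex" where
  "synthesis \<phi> = (\<lambda>(x, y). \<Sum>\<^sub>\<infinity>k::int. (LINT \<eta>|lborel. of_real (m k \<eta>) * \<phi> k \<eta> * cis (2 * pi * (of_int k * x + \<eta> * y))))"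

lemma finite_freqs: "finite freqs"
  by (simp add: freqs_def)

lemma synthesis_eq:
  "synthesis \<phi> z = (\<Sum>k\<in>freqs. LINT \<eta>|lborel. of_real (m k \<eta>) * \<phi> k \<eta> * cis (2 * pi * (of_int k * fst z + \<eta> * snd z)))"
proof -
  have zero: "m k \<eta> = 0" if "k \<notin> freqs" for k \<eta>
  proof (rule far)
    have "\<lceil>lam + D\<rceil> < \<bar>k\<bar>" using that by (auto simp: freqs_def)
    thus "lam + D < \<bar>real_of_int k\<bar>" by linarith
  qed
  have "synthesis \<phi> z = (\<Sum>\<^sub>\<infinity>k\<in>freqs. LINT \<eta>|lborel. of_real (m k \<eta>) * \<phi> k \<eta> * cis (2 * pi * (of_int k * fst z + \<eta> * snd z)))"
    unfolding synthesis_def case_prod_beta' by (intro infsum_cong_neutral) (auto simp: zero)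
  thus ?thesis using finite_freqs by simp
qed

end

text \<open>The energy is 2 and not 1 because of the factor in
  \<open>bessel_fourier_cyl\<close>.\<close>

locale annulus_synthesis = annulus_multiplier +
  fixes \<phi> :: "int \<Rightarrow> real \<Rightarrow> complex"
  assumes \<phi>_measurable [measurable]: "\<And>k. \<phi> k \<in> borel_measurable borel"
    and \<phi>_energy: "(\<Sum>k\<in>freqs. \<integral>\<^sup>+\<eta>. ennreal ((cmod (\<phi> k \<eta>))\<^sup>2) \<partial>lborel) \<le> 2"
begin

abbreviation F :: "real \<times> real \<Rightarrow> complex" where "F \<equiv> synthesis \<phi>"

lemma \<phi>2_integrable: "k \<in> freqs \<Longrightarrow> integrable lborel (\<lambda>\<eta>. (cmod (\<phi> k \<eta>))\<^sup>2)"
  and \<phi>2_sum: "(\<Sum>k\<in>freqs. LINT \<eta>|lborel. (cmod (\<phi> k \<eta>))\<^sup>2) \<le> 2"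
proof -
  have fin: "(\<integral>\<^sup>+\<eta>. ennreal ((cmod (\<phi> k \<eta>))\<^sup>2) \<partial>lborel) < \<infinity>" if "k \<in> freqs" for k
  proof -
    have "(\<integral>\<^sup>+\<eta>. ennreal ((cmod (\<phi> k \<eta>))\<^sup>2) \<partial>lborel) \<le> (\<Sum>k\<in>freqs. \<integral>\<^sup>+\<eta>. ennreal ((cmod (\<phi> k \<eta>))\<^sup>2) \<partial>lborel)"
      using that finite_freqs by (intro member_le_sum) auto
    also have "\<dots> \<le> 2" by (rule \<phi>_energy)
    also have "(2::ennreal) < \<infinity>" by simp
    finally show ?thesis .
  qed
  show int: "integrable lborel (\<lambda>\<eta>. (cmod (\<phi> k \<eta>))\<^sup>2)" if "k \<in> freqs" for k
    using fin[OF that] by (intro integrableI_bounded) auto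
  have "ennreal (\<Sum>k\<in>freqs. LINT \<eta>|lborel. (cmod (\<phi> k \<eta>))\<^sup>2) = (\<Sum>k\<in>freqs. \<integral>\<^sup>+\<eta>. ennreal ((cmod (\<phi> k \<eta>))\<^sup>2) \<partial>lborel)"
    by (subst sum_ennreal[symmetric]) (auto simp: nn_integral_eq_integral[OF int])
  with \<phi>_energy have "ennreal (\<Sum>k\<in>freqs. LINT \<eta>|lborel. (cmod (\<phi> k \<eta>))\<^sup>2) \<le> ennreal 2" by simp
  thus "(\<Sum>k\<in>freqs. LINT \<eta>|lborel. (cmod (\<phi> k \<eta>))\<^sup>2) \<le> 2" by (subst (asm) ennreal_le_iff) auto
qed

text \<open>The Cauchy-Schwarz inequality in the form
  \<open>a * b \<le> s / 2 * a^2 + b^2 / (2 * s)\<close>, where the energy 2 turns the first part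
  into \<open>s\<close>. Each application picks its own \<open>s\<close>, with \<open>f\<close> a
  plane wave or the transform of a dual function.\<close>

lemma weighted_cauchy_schwarz:
  assumes s: "s > 0" and meas [measurable]: "\<And>k. f k \<in> borel_measurable borel"
    and f: "\<And>k \<eta>. cmod (f k \<eta>) \<le> A"
  shows "k \<in> freqs \<Longrightarrow> integrable lborel (\<lambda>\<eta>. of_real (m k \<eta>) * \<phi> k \<eta> * f k \<eta>)"
    and "cmod (\<Sum>k\<in>freqs. LINT \<eta>|lborel. of_real (m k \<eta>) * \<phi> k \<eta> * f k \<eta>)
      \<le> s + (\<Sum>k\<in>freqs. LINT \<eta>|lborel. (m k \<eta>)\<^sup>2 * (cmod (f k \<eta>))\<^sup>2) / (2 * s)"
proof -
  have fi: "integrable lborel (\<lambda>\<eta>. (m k \<eta>)\<^sup>2 * (cmod (f k \<eta>))\<^sup>2)" for k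
    by (rule weighted_edge(1)[where F = "A\<^sup>2"]) (auto intro!: power_mono f)
  have le: "cmod (of_real (m k \<eta>) * \<phi> k \<eta> * f k \<eta>) \<le> s / 2 * (cmod (\<phi> k \<eta>))\<^sup>2 + (m k \<eta>)\<^sup>2 * (cmod (f k \<eta>))\<^sup>2 / (2 * s)" for k \<eta>
  proof -
    define a b where "a = cmod (\<phi> k \<eta>)" and "b = \<bar>m k \<eta>\<bar> * cmod (f k \<eta>)"
    have "0 \<le> (s * a - b)\<^sup>2 / (2 * s)" using s by simp
    also have "(s * a - b)\<^sup>2 / (2 * s) = s / 2 * a\<^sup>2 + b\<^sup>2 / (2 * s) - a * b"
      using s by (simp add: field_simps power2_eq_square)
    finally have "a * b \<le> s / 2 * a\<^sup>2 + b\<^sup>2 / (2 * s)" by simp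
    thus ?thesis by (simp add: a_def b_def norm_mult power_mult_distrib mult_ac)
  qed
  have ri: "integrable lborel (\<lambda>\<eta>. s / 2 * (cmod (\<phi> k \<eta>))\<^sup>2 + (m k \<eta>)\<^sup>2 * (cmod (f k \<eta>))\<^sup>2 / (2 * s))" if "k \<in> freqs" for k
    by (intro Bochner_Integration.integrable_add integrable_mult_right integrable_divide fi \<phi>2_integrable that)
  show int: "integrable lborel (\<lambda>\<eta>. of_real (m k \<eta>) * \<phi> k \<eta> * f k \<eta>)" if "k \<in> freqs" for k
  proof (rule Bochner_Integration.integrable_bound[OF ri[OF that]])
    show "(\<lambda>\<eta>. of_real (m k \<eta>) * \<phi> k \<eta> * f k \<eta>) \<in> borel_measurable lborel" by auto
    show "AE \<eta> in lborel. norm (of_real (m k \<eta>) * \<phi> k \<eta> * f k \<eta>) \<le> norm (s / 2 * (cmod (\<phi> k \<eta>))\<^sup>2 + (m k \<eta>)\<^sup>2 * (cmod (f k \<eta>))\<^sup>2 / (2 * s))"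
      unfolding real_norm_def by (intro AE_I2 order_trans[OF le abs_ge_self])
  qed
  have "cmod (\<Sum>k\<in>freqs. LINT \<eta>|lborel. of_real (m k \<eta>) * \<phi> k \<eta> * f k \<eta>)
     \<le> (\<Sum>k\<in>freqs. LINT \<eta>|lborel. s / 2 * (cmod (\<phi> k \<eta>))\<^sup>2 + (m k \<eta>)\<^sup>2 * (cmod (f k \<eta>))\<^sup>2 / (2 * s))"
    by (rule order_trans[OF norm_sum sum_mono]) (rule Bochner_Integration.integral_norm_bound_integral[OF int ri le])
  also have "\<dots> = s / 2 * (\<Sum>k\<in>freqs. LINT \<eta>|lborel. (cmod (\<phi> k \<eta>))\<^sup>2)
     + (\<Sum>k\<in>freqs. LINT \<eta>|lborel. (m k \<eta>)\<^sup>2 * (cmod (f k \<eta>))\<^sup>2) / (2 * s)"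
    unfolding sum_distrib_left sum_divide_distrib sum.distrib[symmetric]
    by (intro sum.cong refl, subst Bochner_Integration.integral_add) (auto intro!: integrable_mult_right integrable_divide fi \<phi>2_integrable)
  also have "s / 2 * (\<Sum>k\<in>freqs. LINT \<eta>|lborel. (cmod (\<phi> k \<eta>))\<^sup>2) \<le> s / 2 * 2"
    using s by (intro mult_left_mono \<phi>2_sum) auto
  finally show "cmod (\<Sum>k\<in>freqs. LINT \<eta>|lborel. of_real (m k \<eta>) * \<phi> k \<eta> * f k \<eta>)
      \<le> s + (\<Sum>k\<in>freqs. LINT \<eta>|lborel. (m k \<eta>)\<^sup>2 * (cmod (f k \<eta>))\<^sup>2) / (2 * s)" by simp
qed

lemma C1_pos: "C1 > 0"
  unfolding C1_def using D by (intro add_pos_pos add_nonneg_pos) auto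

text \<open>A plane wave has modulus 1, so only the measure of the symbol remains;
  \<open>s = sqrt Y\<close> yields \<open>3 / 2 * sqrt Y\<close>. This is the case of infinite
  exponent and the top level in the case of finite exponent.\<close>

lemma synthesis_bounded:
  "cmod (F z) \<le> 2 * sqrt (C1 * (1 + ln lam) * (sqrt (lam * \<delta>) + lam * \<delta>))"
proof -
  define Y where "Y = C1 * (1 + ln lam) * (sqrt (lam * \<delta>) + lam * \<delta>)"
  have ln: "ln lam > 0" using lam by simp
  have Y: "Y > 0" unfolding Y_def using C1_pos ln lam \<delta> by (intro mult_pos_pos add_pos_pos) auto
  have "(\<Sum>k\<in>freqs. LINT \<eta>|lborel. (m k \<eta>)\<^sup>2) \<le> 2 * (D + 4) * (4 * sqrt (D * lam * \<delta>)) + 4 * ln lam * (8 * D * (lam * \<delta>))"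
    by (rule multiplier_measure[OF finite_freqs])
  also have "\<dots> = (8 * (D + 4) * sqrt D) * sqrt (lam * \<delta>) + (32 * D) * ln lam * (lam * \<delta>)"
    by (simp add: real_sqrt_mult)
  also have "\<dots> \<le> (C1 * (1 + ln lam)) * sqrt (lam * \<delta>) + (C1 * (1 + ln lam)) * (lam * \<delta>)"
  proof (intro add_mono mult_right_mono)
    have a: "8 * (D + 4) * sqrt D \<le> C1" "32 * D \<le> C1" using D by (auto simp: C1_def)
    show "8 * (D + 4) * sqrt D \<le> C1 * (1 + ln lam)" using order_trans[OF a(1)] mult_left_mono[of 1 "1 + ln lam" C1] C1_pos ln by simp
    show "32 * D * ln lam \<le> C1 * (1 + ln lam)" using a(2) C1_pos ln D by (intro mult_mono) auto
  qed (use lam \<delta> in auto)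
  also have "\<dots> = Y" by (simp add: Y_def algebra_simps)
  finally have mY: "(\<Sum>k\<in>freqs. LINT \<eta>|lborel. (m k \<eta>)\<^sup>2) \<le> Y" .
  have "cmod (F z) \<le> sqrt Y + (\<Sum>k\<in>freqs. LINT \<eta>|lborel. (m k \<eta>)\<^sup>2) / (2 * sqrt Y)"
    using weighted_cauchy_schwarz(2)[of "sqrt Y" "\<lambda>k \<eta>. cis (2 * pi * (of_int k * fst z + \<eta> * snd z))" 1] Y
    by (simp add: synthesis_eq)
  also have "\<dots> \<le> sqrt Y + Y / (2 * sqrt Y)" using mY Y by (intro add_left_mono divide_right_mono) auto
  also have "Y / (2 * sqrt Y) = sqrt Y / 2" using Y real_sqrt_mult_self[of Y] by (simp add: field_simps)
  also have "sqrt Y + sqrt Y / 2 \<le> 2 * sqrt Y" using Y by simp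
  finally show ?thesis by (simp add: Y_def)
qed

lemma synthesis_measurable [measurable]: "F \<in> borel_measurable cylinder"
proof -
  have "snd \<in> borel_measurable (cylinder \<Otimes>\<^sub>M (lborel :: real measure))"
    using measurable_snd[of cylinder "lborel :: real measure"] by simp
  note [measurable] = this measurable_compose[OF measurable_fst measurable_cylinder_fst_snd(2)] measurable_compose[OF measurable_fst measurable_cylinder_fst_snd(1)]
    measurable_compose[OF this measurable_m] measurable_compose[OF this \<phi>_measurable]
  have "(\<lambda>z. LINT \<eta>|lborel. of_real (m k \<eta>) * \<phi> k \<eta> * cis (2 * pi * (of_int k * fst z + \<eta> * snd z))) \<in> borel_measurable cylinder" for k
    by (intro lborel.borel_measurable_lebesgue_integral) (simp add: case_prod_beta')
  thus ?thesis unfolding synthesis_eq[abs_def] by (intro borel_measurable_sum)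
qed

text \<open>Fubini's theorem moves the synthesis onto \<open>g\<close>, leaving the frequency energy
  of \<open>g\<close> weighted by the squared symbol.\<close>

lemma synthesis_duality:
  assumes g: "integrable cylinder g" and g1: "\<And>z. cmod (g z) \<le> 1" and s: "s > 0"
  shows "cmod (LINT z|cylinder. F z * cnj (g z))
     \<le> s + (\<Sum>k\<in>freqs. LINT \<eta>|lborel. (m k \<eta>)\<^sup>2 * (cmod (cyl_transform g k \<eta>))\<^sup>2) / (2 * s)"
proof -
  interpret cyl: sigma_finite_measure cylinder by (rule sigma_finite_cylinder)
  interpret cl: pair_sigma_finite cylinder "lborel :: real measure" ..
  note G = cyl_transform_properties[OF g g1]
  have gm [measurable]: "g \<in> borel_measurable cylinder" using g by auto
  have sm: "snd \<in> borel_measurable (cylinder \<Otimes>\<^sub>M (lborel :: real measure))"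
    using measurable_snd[of cylinder "lborel :: real measure"] by simp
  note [measurable] = sm measurable_compose[OF measurable_fst measurable_cylinder_fst_snd(2)] measurable_compose[OF measurable_fst measurable_cylinder_fst_snd(1)]
    measurable_compose[OF sm measurable_m] measurable_compose[OF sm \<phi>_measurable]
  have m\<phi>: "integrable lborel (\<lambda>\<eta>. of_real (m k \<eta>) * \<phi> k \<eta>)" if "k \<in> freqs" for k
    using weighted_cauchy_schwarz(1)[of 1 "\<lambda>k \<eta>. 1" 1 k] that by simp
  let ?h = "\<lambda>k z \<eta>. of_real (m k \<eta>) * \<phi> k \<eta> * cis (2 * pi * (of_int k * fst z + \<eta> * snd z)) * cnj (g z)"
  have hint: "integrable (cylinder \<Otimes>\<^sub>M lborel) (\<lambda>(z, \<eta>). ?h k z \<eta>)" if "k \<in> freqs" for k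
  proof (rule Bochner_Integration.integrable_bound)
    show "integrable (cylinder \<Otimes>\<^sub>M lborel) (\<lambda>p. cnj (g (fst p)) * (of_real (m k (snd p)) * \<phi> k (snd p)))"
      by (rule integrable_integral_product(1)[OF sigma_finite_cylinder sigma_finite_lborel integrable_cnj[OF g] m\<phi>[OF that]])
    show "(\<lambda>(z, \<eta>). ?h k z \<eta>) \<in> borel_measurable (cylinder \<Otimes>\<^sub>M lborel)" by (simp add: case_prod_beta')
  qed (auto simp: norm_mult)
  have zint: "integrable cylinder (\<lambda>z. LINT \<eta>|lborel. ?h k z \<eta>)" if "k \<in> freqs" for k
    using cl.integrable_fst'[OF hint[OF that]] by simp
  have swap: "(LINT z|cylinder. LINT \<eta>|lborel. ?h k z \<eta>) = (LINT \<eta>|lborel. of_real (m k \<eta>) * \<phi> k \<eta> * cnj (cyl_transform g k \<eta>))" if "k \<in> freqs" for k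
  proof -
    have "(LINT z|cylinder. LINT \<eta>|lborel. ?h k z \<eta>) = (LINT \<eta>|lborel. LINT z|cylinder. ?h k z \<eta>)"
      using cl.Fubini_integral[OF hint[OF that]] by simp
    also have "\<dots> = (LINT \<eta>|lborel. of_real (m k \<eta>) * \<phi> k \<eta> * cnj (cyl_transform g k \<eta>))"
    proof (intro Bochner_Integration.integral_cong refl)
      fix \<eta>
      have "cnj (cyl_transform g k \<eta>) = (LINT z|cylinder. cnj (g z * cis (- 2 * pi * real_of_int k * fst z) * cis (- 2 * pi * \<eta> * snd z)))"
        unfolding cyl_transform_def by (rule Bochner_Integration.integral_cnj[symmetric])
      also have "\<dots> = (LINT z|cylinder. cis (2 * pi * (of_int k * fst z + \<eta> * snd z)) * cnj (g z))"
        by (intro Bochner_Integration.integral_cong refl) (simp add: cis_cnj cis_mult algebra_simps)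
      finally show "(LINT z|cylinder. ?h k z \<eta>) = of_real (m k \<eta>) * \<phi> k \<eta> * cnj (cyl_transform g k \<eta>)"
        by (simp only: mult.assoc integral_mult_right_zero)
    qed
    finally show ?thesis .
  qed
  have "(LINT z|cylinder. F z * cnj (g z)) = (LINT z|cylinder. (\<Sum>k\<in>freqs. (LINT \<eta>|lborel. ?h k z \<eta>)))"
    by (simp only: synthesis_eq sum_distrib_right integral_mult_left_zero)
  also have "\<dots> = (\<Sum>k\<in>freqs. LINT z|cylinder. LINT \<eta>|lborel. ?h k z \<eta>)"
    by (intro Bochner_Integration.integral_sum zint)
  also have "\<dots> = (\<Sum>k\<in>freqs. LINT \<eta>|lborel. of_real (m k \<eta>) * \<phi> k \<eta> * cnj (cyl_transform g k \<eta>))"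
    by (intro sum.cong refl swap)
  finally show ?thesis
    using weighted_cauchy_schwarz(2)[OF s, of "\<lambda>k \<eta>. cnj (cyl_transform g k \<eta>)" "LINT z|cylinder. cmod (g z)"] G(1,4) by simp
qed

text \<open>The hypothesis is applied to g = sgn(F) on the part of the level set with bounded second coordinate.\<close>

lemma emeasure_level_set_le:
  assumes a: "a > 0" and c: "c \<ge> 0"
    and bound: "\<And>g \<nu>. integrable cylinder g \<Longrightarrow> (\<And>z. cmod (g z) \<le> 1) \<Longrightarrow> \<nu> = (LINT z|cylinder. cmod (g z)) \<Longrightarrow> \<nu> > 0 \<Longrightarrow>
       (a * \<nu>)\<^sup>2 \<le> 2 * (\<Sum>k\<in>freqs. LINT \<eta>|lborel. (m k \<eta>)\<^sup>2 * (cmod (cyl_transform g k \<eta>))\<^sup>2) \<Longrightarrow> \<nu> \<le> c"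
  shows "emeasure cylinder {z \<in> space cylinder. a < cmod (F z)} \<le> ennreal c"
proof -
  define E where "E n = {z \<in> space cylinder. a < cmod (F z) \<and> \<bar>snd z\<bar> \<le> real n}" for n :: nat
  have [measurable]: "E n \<in> sets cylinder" for n unfolding E_def by measurable
  have Efin: "emeasure cylinder (E n) < \<infinity>" for n
  proof -
    have sp: "space cylinder = {0..1} \<times> UNIV" by (simp add: cylinder_def space_pair_measure)
    have "emeasure cylinder (E n) \<le> emeasure cylinder ({0..1} \<times> {- real n..real n})"
    proof (rule emeasure_mono)
      show "E n \<subseteq> {0..1} \<times> {- real n..real n}" unfolding E_def sp by auto
      show "{0..1} \<times> {- real n..real n} \<in> sets cylinder" unfolding cylinder_def by (intro pair_measureI) auto
    qed
    also have "\<dots> = emeasure circle {0..1} * emeasure lborel {- real n..real n}"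
      unfolding cylinder_def by (rule lborel.emeasure_pair_measure_Times) auto
    also have "\<dots> < \<infinity>" by (simp add: emeasure_circle)
    finally show ?thesis .
  qed
  have "emeasure cylinder (E n) \<le> ennreal c" for n
  proof -
    define g where "g z = indicator (E n) z *\<^sub>R sgn (F z)" for z
    have gn: "cmod (g z) = indicator (E n) z" for z
      using a by (auto simp: g_def indicator_def norm_sgn E_def)
    have ind: "integrable cylinder (indicator (E n) :: real \<times> real \<Rightarrow> real)"
      using Efin by (intro integrable_real_indicator) auto
    have g: "integrable cylinder g"
    proof (rule Bochner_Integration.integrable_bound[OF ind])
      show "g \<in> borel_measurable cylinder" unfolding g_def sgn_div_norm by measurable
    qed (simp add: gn)
    have g1: "cmod (g z) \<le> 1" for z by (simp add: gn indicator_def)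
    define \<nu> where "\<nu> = (LINT z|cylinder. cmod (g z))"
    have \<nu>m: "\<nu> = measure cylinder (E n)" unfolding \<nu>_def gn by simp
    have "\<nu> \<le> c"
    proof (cases "\<nu> > 0")
      case True
      define Y where "Y = (\<Sum>k\<in>freqs. LINT \<eta>|lborel. (m k \<eta>)\<^sup>2 * (cmod (cyl_transform g k \<eta>))\<^sup>2)"
      have Fg: "F z * cnj (g z) = of_real (indicator (E n) z * cmod (F z))" for z
      proof -
        have "F z * cnj (sgn (F z)) = of_real (cmod (F z))"
          by (cases "F z = 0") (auto simp: sgn_div_norm scaleR_conv_of_real complex_norm_square[symmetric] field_simps power2_eq_square simp del: complex_norm_square)
        thus ?thesis by (auto simp: g_def indicator_def)
      qed
      obtain Bd where Bd: "\<And>z. cmod (F z) \<le> Bd" using synthesis_bounded by blast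
      have Fi: "integrable cylinder (\<lambda>z. indicator (E n) z * cmod (F z))"
        by (rule Bochner_Integration.integrable_bound[OF integrable_mult_right[OF ind, of Bd]])
           (auto simp: indicator_def intro!: order_trans[OF Bd])
      have "a * \<nu> = (LINT z|cylinder. a * indicator (E n) z)" by (simp add: \<nu>m)
      also have "\<dots> \<le> (LINT z|cylinder. indicator (E n) z * cmod (F z))"
        by (intro integral_mono Fi integrable_mult_right ind) (auto simp: indicator_def E_def)
      also have "\<dots> \<le> cmod (LINT z|cylinder. F z * cnj (g z))"
        unfolding Fg integral_complex_of_real by simp
      \<comment> \<open>The choice \<open>s = a * \<nu> / 2\<close> lets half of the left-hand side
        absorb the first term.\<close>
      also have "\<dots> \<le> a * \<nu> / 2 + Y / (2 * (a * \<nu> / 2))"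
        unfolding Y_def using a True by (intro synthesis_duality[OF g g1]) auto
      also have "2 * (a * \<nu> / 2) = a * \<nu>" by simp
      finally have "a * \<nu> / 2 \<le> Y / (a * \<nu>)" by linarith
      hence "(a * \<nu>)\<^sup>2 \<le> 2 * Y" using a True by (simp add: field_simps power2_eq_square)
      thus ?thesis unfolding Y_def by (intro bound[OF g g1 \<nu>_def True])
    qed (use c in auto)
    thus ?thesis unfolding \<nu>m using Efin[of n] by (simp add: emeasure_eq_ennreal_measure ennreal_leI less_top)
  qed
  moreover have "{z \<in> space cylinder. a < cmod (F z)} = (\<Union>n. E n)"
    unfolding E_def using real_arch_simple by blast
  moreover have "(SUP n. emeasure cylinder (E n)) = emeasure cylinder (\<Union>n. E n)"
    by (rule SUP_emeasure_incseq) (auto simp: incseq_def E_def)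
  ultimately show ?thesis using SUP_least[of UNIV "\<lambda>n. emeasure cylinder (E n)" "ennreal c"] by simp
qed

text \<open>Here \<open>m^2 \<le> 1\<close> and Bessel's inequality bound the energy by
  \<open>\<nu>\<close>, so that \<open>(a * \<nu>)^2 \<le> 2 * \<nu>\<close>.\<close>

lemma level_set_chebyshev:
  assumes a: "a > 0"
  shows "emeasure cylinder {z \<in> space cylinder. a < cmod (F z)} \<le> ennreal (2 / a\<^sup>2)"
proof (rule emeasure_level_set_le[OF a])
  fix g \<nu> assume g: "integrable cylinder g" and g1: "\<And>z. cmod (g z) \<le> 1" and \<nu>: "\<nu> = (LINT z|cylinder. cmod (g z))" "\<nu> > 0"
    and le: "(a * \<nu>)\<^sup>2 \<le> 2 * (\<Sum>k\<in>freqs. LINT \<eta>|lborel. (m k \<eta>)\<^sup>2 * (cmod (cyl_transform g k \<eta>))\<^sup>2)"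
  note G = cyl_transform_properties[OF g g1]
  note [measurable] = G(1)
  have "(\<Sum>k\<in>freqs. LINT \<eta>|lborel. (m k \<eta>)\<^sup>2 * (cmod (cyl_transform g k \<eta>))\<^sup>2) \<le> (\<Sum>k\<in>freqs. LINT \<eta>|lborel. (cmod (cyl_transform g k \<eta>))\<^sup>2)"
  proof (intro sum_mono integral_mono G(2))
    show "integrable lborel (\<lambda>\<eta>. (m k \<eta>)\<^sup>2 * (cmod (cyl_transform g k \<eta>))\<^sup>2)" for k
      by (rule weighted_edge(1)[where F = "\<nu>\<^sup>2"]) (auto simp: \<nu>(1) intro!: power_mono G(4))
  qed (simp add: mult_left_le_one_le m2_le_1)
  also have "\<dots> \<le> \<nu>" unfolding \<nu> by (rule G(3)[OF finite_freqs])
  finally have "(a * \<nu>)\<^sup>2 \<le> 2 * \<nu>" using le by linarith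
  hence "\<nu> * (a\<^sup>2 * \<nu>) \<le> \<nu> * 2" by (simp add: power_mult_distrib power2_eq_square algebra_simps)
  hence "a\<^sup>2 * \<nu> \<le> 2" using \<nu>(2) by (simp only: mult_le_cancel_left_pos)
  thus "\<nu> \<le> 2 / a\<^sup>2" using a by (simp add: field_simps)
qed simp

text \<open>The energy bound has two terms quadratic in \<open>\<nu>\<close> and one linear term.
  The assumption on \<open>a\<close> makes the first quadratic term a quarter of
  \<open>(a * \<nu>)^2\<close>, the choice of \<open>\<rho>\<close> the second; the remaining half
  is compared with the linear term.\<close>

lemma level_set_large:
  assumes a: "a > 0" and big: "8 * C1 * (1 + ln lam) * sqrt (lam * \<delta>) \<le> a\<^sup>2"
  shows "emeasure cylinder {z \<in> space cylinder. a < cmod (F z)} \<le> ennreal (256 * (C1 * (1 + ln lam))^3 * (\<delta>^3 * lam) / a^6)"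
proof (rule emeasure_level_set_le[OF a])
  have ln: "ln lam > 0" using lam by simp
  define Q where "Q = C1 * (1 + ln lam)"
  have Q: "Q > 0" unfolding Q_def using C1_pos ln by (intro mult_pos_pos) auto
  show "0 \<le> 256 * (C1 * (1 + ln lam))^3 * (\<delta>^3 * lam) / a^6" using Q lam \<delta> a unfolding Q_def[symmetric] by simp
  fix g \<nu> assume g: "integrable cylinder g" and g1: "\<And>z. cmod (g z) \<le> 1" and \<nu>: "\<nu> = (LINT z|cylinder. cmod (g z))" "\<nu> > 0"
    and le: "(a * \<nu>)\<^sup>2 \<le> 2 * (\<Sum>k\<in>freqs. LINT \<eta>|lborel. (m k \<eta>)\<^sup>2 * (cmod (cyl_transform g k \<eta>))\<^sup>2)"
  \<comment> \<open>rho is chosen so that the van der Corput error becomes a quarter of the left-hand side\<close>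
  define q where "q = a\<^sup>2 / (8 * Q * \<delta>)"
  have q: "q > 0" using a Q \<delta> by (simp add: q_def)
  define \<rho> where "\<rho> = sqrt lam / q\<^sup>2"
  have \<rho>: "\<rho> > 0" using q lam by (simp add: \<rho>_def)
  have \<rho>q: "sqrt (sqrt lam / \<rho>) = q" using q lam by (simp add: \<rho>_def)
  define T where "T = sqrt (lam * \<delta>)"
  have T: "T > 0" using lam \<delta> by (simp add: T_def)
  have "(\<Sum>k\<in>freqs. LINT \<eta>|lborel. (m k \<eta>)\<^sup>2 * (cmod (cyl_transform g k \<eta>))\<^sup>2)
     \<le> 2 * (D + 4) * (\<nu>\<^sup>2 * (4 * sqrt (D * lam * \<delta>))) + 4 * ln lam * (exp (pi * D\<^sup>2) *
        (2 * (60 * (T + \<delta> * q) * \<nu>\<^sup>2 + \<delta> * sqrt lam * \<rho> * \<nu>)))"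
    using multiplier_energy[OF finite_freqs g g1 \<rho>, folded \<nu>(1)] unfolding \<rho>q T_def .
  also have "\<dots> = (8 * (D + 4) * sqrt D) * (T * \<nu>\<^sup>2) + ln lam * (480 * exp (pi * D\<^sup>2)) * ((T + \<delta> * q) * \<nu>\<^sup>2) + ln lam * (8 * exp (pi * D\<^sup>2)) * (\<delta> * sqrt lam * \<rho> * \<nu>)"
    by (simp add: T_def real_sqrt_mult algebra_simps)
  also have "\<dots> \<le> (8 * (D + 4) * sqrt D) * ((1 + ln lam) * ((T + \<delta> * q) * \<nu>\<^sup>2)) + (480 * exp (pi * D\<^sup>2)) * ((1 + ln lam) * ((T + \<delta> * q) * \<nu>\<^sup>2)) + Q * (\<delta> * sqrt lam * \<rho> * \<nu>)"
  proof (intro add_mono)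
    have "T * \<nu>\<^sup>2 \<le> 1 * ((T + \<delta> * q) * \<nu>\<^sup>2)" using q \<delta> by (simp add: mult_right_mono)
    also have "\<dots> \<le> (1 + ln lam) * ((T + \<delta> * q) * \<nu>\<^sup>2)" using ln q \<delta> T by (intro mult_right_mono) auto
    finally show "(8 * (D + 4) * sqrt D) * (T * \<nu>\<^sup>2) \<le> (8 * (D + 4) * sqrt D) * ((1 + ln lam) * ((T + \<delta> * q) * \<nu>\<^sup>2))"
      using D by (intro mult_left_mono) auto
    have "ln lam * (480 * exp (pi * D\<^sup>2)) * ((T + \<delta> * q) * \<nu>\<^sup>2) = (480 * exp (pi * D\<^sup>2)) * (ln lam * ((T + \<delta> * q) * \<nu>\<^sup>2))" by simp
    also have "\<dots> \<le> (480 * exp (pi * D\<^sup>2)) * ((1 + ln lam) * ((T + \<delta> * q) * \<nu>\<^sup>2))"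
      using ln q \<delta> T by (intro mult_left_mono mult_right_mono) auto
    finally show "ln lam * (480 * exp (pi * D\<^sup>2)) * ((T + \<delta> * q) * \<nu>\<^sup>2) \<le> (480 * exp (pi * D\<^sup>2)) * ((1 + ln lam) * ((T + \<delta> * q) * \<nu>\<^sup>2))" .
    have "8 * exp (pi * D\<^sup>2) \<le> C1" unfolding C1_def using D by (intro add_increasing2 add_increasing mult_nonneg_nonneg) auto
    hence "(1 + ln lam) * (8 * exp (pi * D\<^sup>2)) \<le> (1 + ln lam) * C1" using ln by (intro mult_left_mono) auto
    moreover have "ln lam * (8 * exp (pi * D\<^sup>2)) \<le> (1 + ln lam) * (8 * exp (pi * D\<^sup>2))" by (intro mult_right_mono) auto
    ultimately have "ln lam * (8 * exp (pi * D\<^sup>2)) \<le> Q" unfolding Q_def mult.commute[of C1] by linarith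
    thus "ln lam * (8 * exp (pi * D\<^sup>2)) * (\<delta> * sqrt lam * \<rho> * \<nu>) \<le> Q * (\<delta> * sqrt lam * \<rho> * \<nu>)"
      using \<delta> lam \<rho> \<nu> by (intro mult_right_mono) auto
  qed
  also have "\<dots> \<le> Q * ((T + \<delta> * q) * \<nu>\<^sup>2) + Q * (\<delta> * sqrt lam * \<rho> * \<nu>)"
  proof (rule add_right_mono)
    have "8 * (D + 4) * sqrt D + 480 * exp (pi * D\<^sup>2) \<le> C1" unfolding C1_def using D by simp
    hence "(8 * (D + 4) * sqrt D + 480 * exp (pi * D\<^sup>2)) * ((1 + ln lam) * ((T + \<delta> * q) * \<nu>\<^sup>2)) \<le> C1 * ((1 + ln lam) * ((T + \<delta> * q) * \<nu>\<^sup>2))"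
      using ln T q \<delta> by (intro mult_right_mono) auto
    thus "(8 * (D + 4) * sqrt D) * ((1 + ln lam) * ((T + \<delta> * q) * \<nu>\<^sup>2)) + (480 * exp (pi * D\<^sup>2)) * ((1 + ln lam) * ((T + \<delta> * q) * \<nu>\<^sup>2)) \<le> Q * ((T + \<delta> * q) * \<nu>\<^sup>2)"
      by (simp only: Q_def distrib_right mult.assoc)
  qed
  finally have energy: "(\<Sum>k\<in>freqs. LINT \<eta>|lborel. (m k \<eta>)\<^sup>2 * (cmod (cyl_transform g k \<eta>))\<^sup>2)
     \<le> Q * ((T + \<delta> * q) * \<nu>\<^sup>2) + Q * (\<delta> * sqrt lam * \<rho> * \<nu>)" .
  have "(a * \<nu>)\<^sup>2 \<le> 2 * (Q * ((T + \<delta> * q) * \<nu>\<^sup>2) + Q * (\<delta> * sqrt lam * \<rho> * \<nu>))"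
    by (rule order_trans[OF le mult_left_mono[OF energy]]) simp
  hence "a\<^sup>2 * \<nu>\<^sup>2 \<le> (2 * Q * T) * \<nu>\<^sup>2 + (2 * Q * \<delta> * q) * \<nu>\<^sup>2 + 2 * Q * (\<delta> * sqrt lam * \<rho> * \<nu>)"
    by (simp add: power_mult_distrib algebra_simps)
  also have "2 * Q * \<delta> * q = a\<^sup>2 / 4" using Q \<delta> by (simp add: q_def)
  also have "(2 * Q * T) * \<nu>\<^sup>2 \<le> (a\<^sup>2 / 4) * \<nu>\<^sup>2" using big by (intro mult_right_mono) (auto simp: Q_def T_def)
  finally have "\<nu> * (a\<^sup>2 * \<nu>) \<le> \<nu> * (4 * Q * (\<delta> * sqrt lam * \<rho>))" by (simp add: algebra_simps power2_eq_square)
  hence *: "a\<^sup>2 * \<nu> \<le> 4 * Q * (\<delta> * sqrt lam * \<rho>)" using \<nu>(2) by (simp only: mult_le_cancel_left_pos)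
  have "sqrt lam * \<rho> = lam / q\<^sup>2" using lam by (simp add: \<rho>_def)
  hence "4 * Q * (\<delta> * sqrt lam * \<rho>) = 4 * Q * \<delta> * (lam / q\<^sup>2)" by (simp add: mult.assoc)
  \<comment> \<open>Here \<open>q^2 = a^4 / (64 * Q^2 * \<delta>^2)\<close>, and
    \<open>256 = 4 * 64\<close>.\<close>
  also have "\<dots> = 256 * Q^3 * (\<delta>^3 * lam) / a^4"
    using a Q \<delta> by (simp add: q_def power_divide power_mult_distrib field_simps eval_nat_numeral)
  finally have "a\<^sup>2 * \<nu> \<le> 256 * Q^3 * (\<delta>^3 * lam) / a^4" using * by (simp only:)
  hence "\<nu> \<le> 256 * Q^3 * (\<delta>^3 * lam) / a^4 / a\<^sup>2"
    using a by (subst pos_le_divide_eq) (auto simp only: mult.commute zero_less_power)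
  also have "\<dots> = 256 * Q^3 * (\<delta>^3 * lam) / a^6" by (simp flip: power_add)
  finally show "\<nu> \<le> 256 * (C1 * (1 + ln lam))^3 * (\<delta>^3 * lam) / a^6" by (simp add: Q_def)
qed

end

section \<open>Integration over dyadic level sets\<close>

text \<open>The factor \<open>2 powr P\<close> compares neighbouring dyadic levels, and the
  geometric series sums the gains \<open>(a / A) powr \<theta>\<close>.\<close>

definition dyadic_const :: "real \<Rightarrow> real \<Rightarrow> real" where
  "dyadic_const P \<theta> = 2 powr P * (\<Sum>j. (2 powr - \<theta>) ^ Suc j)"

text \<open>Every nonzero value lies in a shell \<open>a (Suc j) < cmod (F z) \<le> a j\<close>,
  where the integrand is at most \<open>a j powr P\<close>. The factor
  \<open>(a / A) powr \<theta>\<close> makes the infinitely many levels below \<open>A\<close>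
  summable.\<close>

lemma nn_integral_powr_level_sets:
  fixes F :: "'a \<Rightarrow> complex"
  assumes [measurable]: "F \<in> borel_measurable M" and A: "A > 0" and FA: "\<And>z. cmod (F z) \<le> A"
    and P: "P > 0" and \<theta>: "\<theta> > 0" and B: "B \<ge> 0"
    and level: "\<And>a. 0 < a \<Longrightarrow> a \<le> A \<Longrightarrow> emeasure M {z \<in> space M. a < cmod (F z)} \<le> ennreal (B * a powr - P * (a / A) powr \<theta>)"
  shows "(\<integral>\<^sup>+z. ennreal (cmod (F z) powr P) \<partial>M) \<le> ennreal (dyadic_const P \<theta> * B)"
proof -
  define a where "a j = A * (1/2) ^ j" for j :: nat
  have a: "a j > 0" "a j \<le> A" for j using A by (auto simp: a_def mult_left_le power_le_one)
  define E where "E j = {z \<in> space M. a (Suc j) < cmod (F z)}" for j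
  have [measurable]: "E j \<in> sets M" for j unfolding E_def by measurable
  have pt: "ennreal (cmod (F z) powr P) \<le> (\<Sum>j. ennreal (a j powr P) * indicator (E j) z)" if z: "z \<in> space M" for z
  proof (cases "F z = 0")
    case False
    define v where "v = cmod (F z)"
    have v: "v > 0" "v \<le> A" using False FA by (auto simp: v_def)
    have "\<exists>n. (1/2::real) ^ n < v / A" using v A by (intro real_arch_pow_inv) auto
    hence ex: "\<exists>n. a n < v" using A by (auto simp: a_def field_simps)
    define n where "n = (LEAST n. a n < v)"
    have n: "a n < v" unfolding n_def using ex by (rule LeastI_ex)
    have "n \<noteq> 0" using n v by (auto simp: a_def intro: ccontr)
    then obtain j where j: "n = Suc j" by (cases n) auto
    have "\<not> a j < v" using not_less_Least[of j "\<lambda>n. a n < v"] j by (simp add: n_def)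
    hence "v powr P \<le> a j powr P" using v P by (intro powr_mono2) auto
    moreover have "indicator (E j) z = (1::ennreal)" using n j z by (simp add: E_def v_def)
    ultimately have "ennreal (v powr P) \<le> ennreal (a j powr P) * indicator (E j) z" by (simp add: ennreal_leI)
    also have "\<dots> = (\<Sum>i\<in>{j}. ennreal (a i powr P) * indicator (E i) z)"
      by (simp only: sum.insert[OF finite.emptyI] empty_iff not_False_eq_True sum.empty add_0_right)
    also have "\<dots> \<le> (\<Sum>j. ennreal (a j powr P) * indicator (E j) z)" by (intro sum_le_suminf) auto
    finally show ?thesis by (simp add: v_def)
  qed simp
  have "(\<integral>\<^sup>+z. ennreal (cmod (F z) powr P) \<partial>M) \<le> (\<integral>\<^sup>+z. (\<Sum>j. ennreal (a j powr P) * indicator (E j) z) \<partial>M)"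
    by (intro nn_integral_mono pt)
  also have "\<dots> = (\<Sum>j. ennreal (a j powr P) * emeasure M (E j))"
    by (subst nn_integral_suminf) (auto simp: nn_integral_cmult_indicator)
  also have "\<dots> \<le> (\<Sum>j. ennreal (B * 2 powr P * (2 powr - \<theta>) ^ Suc j))"
  proof (intro suminf_le allI)
    fix j
    have "ennreal (a j powr P) * emeasure M (E j) \<le> ennreal (a j powr P) * ennreal (B * a (Suc j) powr - P * (a (Suc j) / A) powr \<theta>)"
      unfolding E_def by (intro mult_left_mono level a) auto
    also have "\<dots> = ennreal (a j powr P * (B * a (Suc j) powr - P * (a (Suc j) / A) powr \<theta>))"
      using B by (simp add: ennreal_mult)
    also have "a j powr P * (B * a (Suc j) powr - P * (a (Suc j) / A) powr \<theta>) = B * 2 powr P * (2 powr - \<theta>) ^ Suc j"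
    proof -
      have "a j = 2 * a (Suc j)" by (simp add: a_def)
      hence "a j powr P = 2 powr P * a (Suc j) powr P" using a[of "Suc j"] by (simp add: powr_mult)
      moreover have "a (Suc j) powr P * a (Suc j) powr - P = 1" using a[of "Suc j"] by (simp flip: powr_add)
      moreover have "(a (Suc j) / A) powr \<theta> = (2 powr - \<theta>) ^ Suc j"
      proof -
        have "a (Suc j) / A = (1/2) ^ Suc j" using A by (simp add: a_def del: power_Suc)
        also have "\<dots> = 2 powr - real (Suc j)"
          by (simp only: powr_minus powr_realpow[OF zero_less_numeral] power_one_over inverse_eq_divide)
        also have "\<dots> powr \<theta> = (2 powr - \<theta>) powr real (Suc j)" by (simp only: powr_powr mult.commute minus_mult_commute)
        also have "\<dots> = (2 powr - \<theta>) ^ Suc j" by (rule powr_realpow) simp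
        finally show ?thesis .
      qed
      moreover have "c * x * (B * y * w) = B * c * w" if "x * y = 1" for c x y w :: real
      proof -
        have "c * x * (B * y * w) = x * y * (B * c * w)" by (simp only: mult_ac)
        thus ?thesis by (simp only: that mult_1_left)
      qed
      ultimately show ?thesis by (simp only:)
    qed
    finally show "ennreal (a j powr P) * emeasure M (E j) \<le> ennreal (B * 2 powr P * (2 powr - \<theta>) ^ Suc j)" .
  qed auto
  also have "\<dots> = ennreal (\<Sum>j. B * 2 powr P * (2 powr - \<theta>) ^ Suc j)"
  proof (rule suminf_ennreal2)
    have "2 powr - \<theta> < (1::real)" using \<theta> by (simp add: powr_minus field_simps)
    hence s: "summable (\<lambda>j. (2 powr - \<theta>) ^ Suc j)" unfolding summable_Suc_iff by (intro summable_geometric) simp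
    thus "summable (\<lambda>j. B * 2 powr P * (2 powr - \<theta>) ^ Suc j)" by (rule summable_mult)
  qed (use B in auto)
  also have "(\<Sum>j. B * 2 powr P * (2 powr - \<theta>) ^ Suc j) = dyadic_const P \<theta> * B"
  proof -
    have "2 powr - \<theta> < (1::real)" using \<theta> by (simp add: powr_minus field_simps)
    hence s: "summable (\<lambda>j. (2 powr - \<theta>) ^ Suc j)" unfolding summable_Suc_iff by (intro summable_geometric) simp
    show ?thesis unfolding suminf_mult[OF s, of "B * 2 powr P"] dyadic_const_def by (simp only: mult_ac)
  qed
  finally show ?thesis .
qed

lemma dyadic_const_pos: "\<theta> > 0 \<Longrightarrow> dyadic_const P \<theta> > 0"
proof -
  assume \<theta>: "\<theta> > 0"
  have "2 powr - \<theta> < (1::real)" using \<theta> by (simp add: powr_minus field_simps)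
  hence s: "summable (\<lambda>j. (2 powr - \<theta>) ^ Suc j)" unfolding summable_Suc_iff by (intro summable_geometric) simp
  thus ?thesis unfolding dyadic_const_def by (intro mult_pos_pos suminf_pos) auto
qed

text \<open>Spares a case distinction on the sign of the exponent; the exponent \<open>P - 6\<close>
  changes sign within the range \<open>P > 2\<close>.\<close>

lemma powr_between:
  fixes a x y s :: real
  assumes "0 < x" "x \<le> a" "a \<le> y"
  shows "a powr s \<le> x powr s + y powr s"
proof (cases "s \<ge> 0")
  case True
  hence "a powr s \<le> y powr s" using assms by (intro powr_mono2) auto
  thus ?thesis by (simp add: add_increasing)
next
  case False
  hence "a powr s \<le> x powr s" using assms by (intro powr_mono2') auto
  thus ?thesis by (simp add: add_increasing2)
qed

lemma sqrt_powr: "x \<ge> 0 \<Longrightarrow> sqrt x powr s = x powr (s / 2)"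
  unfolding powr_half_sqrt[symmetric] by (simp only: powr_powr) simp

context annulus_synthesis
begin

text \<open>Level sets below a0 are handled by Chebyshev, those above by the large-level estimate. The small exponent theta makes
  the sum over dyadic levels geometric, at the cost of (A / a0) powr theta.\<close>

lemma synthesis_Lp_bound:
  assumes P: "P > 2" and \<theta>: "\<theta> > 0" "\<theta> \<le> P - 2"
  defines "Q \<equiv> C1 * (1 + ln lam)"
  defines "X \<equiv> (lam * \<delta>) powr (1 / 4 - 1 / (2 * P))" and "Z \<equiv> lam powr (1 / 2 - 2 / P) * \<delta> powr (1 / 2)"
  shows "(\<integral>\<^sup>+z. ennreal (cmod (F z) powr P) \<partial>cylinder)
     \<le> ennreal (dyadic_const P \<theta> * (1300 * Q ^ 3 * (8 * Q) powr (P / 2) * (X + Z) powr P * lam powr (\<theta> / 2)))"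
proof -
  have ln: "ln lam > 0" using lam by simp
  have "480 * exp (pi * D\<^sup>2) \<ge> 1" using one_le_exp_iff[of "pi * D\<^sup>2"] by (simp del: one_le_exp_iff)
  hence "C1 \<ge> 1" unfolding C1_def using D by (intro add_increasing2 add_increasing mult_nonneg_nonneg) auto
  hence Q1: "Q \<ge> 1" unfolding Q_def using ln mult_mono[of 1 C1 1 "1 + ln lam"] by simp
  define V where "V = sqrt (lam * \<delta>)"
  have V: "V > 0" "V * V = lam * \<delta>" using lam \<delta> by (auto simp: V_def)
  \<comment> \<open>The level \<open>a0\<close> is the threshold of \<open>level_set_large\<close>,
    and \<open>A\<close> is the supremum bound of \<open>synthesis_bounded\<close>.\<close>
  define a0 where "a0 = sqrt (8 * Q * V)"
  define A where "A = 2 * sqrt (Q * (V + lam * \<delta>))"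
  have a0: "a0 > 0" "a0\<^sup>2 = 8 * Q * V" using Q1 V by (auto simp: a0_def)
  have A: "A > 0" "A\<^sup>2 = 4 * Q * (V + V * V)" using Q1 V lam \<delta> unfolding A_def V(2) by (auto intro!: mult_pos_pos add_pos_pos simp: power_mult_distrib)
  have FA: "cmod (F z) \<le> A" for z using synthesis_bounded[of z] by (simp add: A_def Q_def V_def)
  \<comment> \<open>From \<open>V \<le> lam\<close> follows \<open>A^2 \<le> lam * a0^2\<close>, so
    the loss is a small power of \<open>lam\<close>, uniformly in \<open>\<delta>\<close>.\<close>
  have Aa0: "(A / a0) powr \<theta> \<le> lam powr (\<theta> / 2)"
  proof -
    have "lam * \<delta> \<le> lam * lam" using lam \<delta> by (intro mult_left_mono) auto
    hence "V \<le> lam" unfolding V_def using lam by (intro real_le_lsqrt) (auto simp: power2_eq_square)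
    hence "V * 1 + V * V \<le> V * lam + V * lam" using V(1) lam by (intro add_mono mult_left_mono) auto
    hence "4 * Q * (V + V * V) \<le> 4 * Q * (V * (2 * lam))" using Q1 by (intro mult_left_mono) auto
    hence AA: "A\<^sup>2 \<le> (sqrt lam * a0)\<^sup>2" unfolding A a0 power_mult_distrib using lam by (simp add: mult_ac)
    have "A \<le> sqrt lam * a0" using a0(1) lam by (intro power2_le_imp_le[OF AA]) simp
    hence "A / a0 \<le> sqrt lam" using a0(1) by (simp add: field_simps)
    hence "(A / a0) powr \<theta> \<le> sqrt lam powr \<theta>" using A(1) a0(1) \<theta> by (intro powr_mono2) auto
    moreover have "sqrt lam powr \<theta> = lam powr (\<theta> / 2)"
      using sqrt_powr[of lam \<theta>] lam by simp
    ultimately show ?thesis by simp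
  qed
  \<comment> \<open>Chebyshev's bound is worst at \<open>a0\<close>; the bound for large levels is
    worst at \<open>a0\<close> or at \<open>A\<close>, according to the sign of
    \<open>P - 6\<close>.\<close>
  define B0 where "B0 = 2 * a0 powr (P - 2) + 256 * Q ^ 3 * (\<delta> ^ 3 * lam) * (a0 powr (P - 6) + A powr (P - 6))"
  have B0: "B0 \<ge> 0" unfolding B0_def using Q1 \<delta> lam by (intro add_nonneg_nonneg mult_nonneg_nonneg) auto
  have "(\<integral>\<^sup>+z. ennreal (cmod (F z) powr P) \<partial>cylinder) \<le> ennreal (dyadic_const P \<theta> * (B0 * (A / a0) powr \<theta>))"
  proof (rule nn_integral_powr_level_sets[OF synthesis_measurable A(1) FA])
    fix a :: real assume a: "0 < a" "a \<le> A"
    have rhs: "B0 * (A / a0) powr \<theta> * a powr - P * (a / A) powr \<theta> = B0 * (a / a0) powr \<theta> * a powr - P"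
    proof -
      have "(A / a0) powr \<theta> * (a / A) powr \<theta> = (a / a0) powr \<theta>" using a A(1) a0(1) by (simp add: powr_divide)
      moreover have "B0 * u * v * w = B0 * (u * w) * v" for u v w :: real by (simp only: mult_ac)
      ultimately show ?thesis by (simp only:)
    qed
    have pw: "c / a ^ n = c * a powr (P - real n) * a powr - P" for c :: real and n
    proof -
      have "a powr (P - real n) * a powr - P = a powr - real n" by (simp flip: powr_add)
      also have "\<dots> = inverse (a ^ n)" using a by (simp add: powr_minus powr_realpow)
      finally show ?thesis by (simp add: divide_inverse mult.assoc)
    qed
    show "emeasure cylinder {z \<in> space cylinder. a < cmod (F z)} \<le> ennreal (B0 * (A / a0) powr \<theta> * a powr - P * (a / A) powr \<theta>)"
    proof (cases "a \<le> a0")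
      case True
      have "2 / a\<^sup>2 = 2 * a powr (P - 2) * a powr - P"
        using pw[of 2 2] by simp
      also have "a powr (P - 2) = a0 powr (P - 2) * (a / a0) powr (P - 2)" using a a0(1) by (simp add: powr_divide)
      also have "2 * (a0 powr (P - 2) * (a / a0) powr (P - 2)) * a powr - P \<le> B0 * (a / a0) powr \<theta> * a powr - P"
      proof (rule mult_right_mono)
        have "(a / a0) powr (P - 2) \<le> (a / a0) powr \<theta>" using a a0(1) True \<theta> by (intro powr_mono') auto
        moreover have "2 * a0 powr (P - 2) \<le> B0" unfolding B0_def using Q1 \<delta> lam by simp
        ultimately have "2 * a0 powr (P - 2) * (a / a0) powr (P - 2) \<le> B0 * (a / a0) powr \<theta>" using B0 by (intro mult_mono) auto
        thus "2 * (a0 powr (P - 2) * (a / a0) powr (P - 2)) \<le> B0 * (a / a0) powr \<theta>" by (simp add: mult.assoc)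
      qed simp
      finally have "2 / a\<^sup>2 \<le> B0 * (a / a0) powr \<theta> * a powr - P" by (simp only: mult.assoc)
      thus ?thesis unfolding rhs by (rule order_trans[OF level_set_chebyshev[OF a(1)] ennreal_leI])
    next
      case False
      have "a0\<^sup>2 \<le> a\<^sup>2" using False a0(1) by (intro power_mono) auto
      hence "8 * C1 * (1 + ln lam) * sqrt (lam * \<delta>) \<le> a\<^sup>2" unfolding a0 by (simp add: Q_def V_def mult.assoc)
      note L = level_set_large[OF a(1) this, folded Q_def]
      have "256 * Q ^ 3 * (\<delta> ^ 3 * lam) / a ^ 6 = 256 * Q ^ 3 * (\<delta> ^ 3 * lam) * a powr (P - 6) * a powr - P"
        using pw[of _ 6] by simp
      also have "\<dots> \<le> B0 * (a / a0) powr \<theta> * a powr - P"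
      proof (rule mult_right_mono)
        have "256 * Q ^ 3 * (\<delta> ^ 3 * lam) * a powr (P - 6) \<le> 256 * Q ^ 3 * (\<delta> ^ 3 * lam) * (a0 powr (P - 6) + A powr (P - 6))"
          using Q1 \<delta> lam a a0(1) False by (intro mult_left_mono powr_between) auto
        also have "\<dots> \<le> B0 * 1" unfolding B0_def by simp
        also have "\<dots> \<le> B0 * (a / a0) powr \<theta>" using False a0(1) \<theta> B0 by (intro mult_left_mono ge_one_powr_ge_zero) auto
        finally show "256 * Q ^ 3 * (\<delta> ^ 3 * lam) * a powr (P - 6) \<le> B0 * (a / a0) powr \<theta>" .
      qed simp
      finally show ?thesis unfolding rhs by (rule order_trans[OF L ennreal_leI])
    qed
  qed (use P \<theta> B0 in auto)
  also have "\<dots> \<le> ennreal (dyadic_const P \<theta> * (1300 * Q ^ 3 * (8 * Q) powr (P / 2) * (X + Z) powr P * lam powr (\<theta> / 2)))"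
  proof (intro ennreal_leI mult_left_mono)
    have XZ0: "X > 0" "Z > 0" using lam \<delta> by (auto simp: X_def Z_def)
    \<comment> \<open>In terms of \<open>V\<close>, the two parts of the claimed bound become
      \<open>V powr (P / 2 - 1)\<close> and \<open>\<delta>^3 * lam * V powr (P - 6)\<close>. The
      first has the order of the contribution of \<open>a0\<close>, the second that of
      \<open>A\<close> when \<open>V > 1\<close>, up to powers of \<open>Q\<close>.\<close>
    have XP: "X powr P = V powr (P / 2 - 1)"
    proof -
      have "X powr P = (lam * \<delta>) powr ((1 / 4 - 1 / (2 * P)) * P)" by (simp add: X_def powr_powr)
      also have "(1 / 4 - 1 / (2 * P)) * P = (1/2) * (P / 2 - 1)" using P by (simp add: field_simps)
      also have "(lam * \<delta>) powr ((1/2) * (P / 2 - 1)) = V powr (P / 2 - 1)"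
        using sqrt_powr[of "lam * \<delta>" "P / 2 - 1"] lam \<delta> by (simp add: V_def)
      finally show ?thesis .
    qed
    have ZP: "Z powr P = \<delta> ^ 3 * lam * V powr (P - 6)"
    proof -
      have gen: "lam powr (1 + e) * \<delta> powr (3 + e) = \<delta> ^ 3 * lam * (lam * \<delta>) powr e" for e
        using lam \<delta> by (simp add: powr_add powr_mult)
      have "Z powr P = lam powr ((1 / 2 - 2 / P) * P) * \<delta> powr (1 / 2 * P)" using lam \<delta> by (simp add: Z_def powr_mult powr_powr)
      also have "(1 / 2 - 2 / P) * P = 1 + (P / 2 - 3)" using P by (simp add: field_simps)
      also have "1 / 2 * P = 3 + (P / 2 - 3)" by simp
      also have "lam powr (1 + (P / 2 - 3)) * \<delta> powr (3 + (P / 2 - 3)) = \<delta> ^ 3 * lam * (lam * \<delta>) powr (P / 2 - 3)"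
        by (rule gen)
      also have "(lam * \<delta>) powr (P / 2 - 3) = V powr (P - 6)"
        using sqrt_powr[of "lam * \<delta>" "P - 6"] lam \<delta> by (simp add: V_def diff_divide_distrib)
      finally show ?thesis .
    qed
    have sq: "x powr s = (x\<^sup>2) powr (s / 2)" if "x > 0" for x s :: real
    proof -
      have "x\<^sup>2 = x powr 2" using that by simp
      thus ?thesis by (simp only: powr_powr) simp
    qed
    have Qp: "(c * Q) powr (s / 2) \<le> (8 * Q) powr (P / 2)" if "1 \<le> c" "c \<le> 8" "s \<le> P" for c s
    proof -
      have "1 \<le> c * Q" using that Q1 mult_mono[of 1 c 1 Q] by simp
      hence "(c * Q) powr (s / 2) \<le> (c * Q) powr (P / 2)" using that by (intro powr_mono) auto
      also have "\<dots> \<le> (8 * Q) powr (P / 2)" using that Q1 P by (intro powr_mono2) auto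
      finally show ?thesis .
    qed
    \<comment> \<open>Since \<open>\<delta>^3 * lam \<le> \<delta> * lam = V^2\<close>, the bound
      for large levels at \<open>a0\<close> has the size of Chebyshev's bound there.\<close>
    have d3: "\<delta> ^ 3 * lam * V powr ((P - 6) / 2) \<le> X powr P"
    proof -
      have "V powr (P / 2 - 1) = V powr ((P - 6) / 2) * V powr 2" unfolding powr_add[symmetric] by (simp add: field_simps)
      also have "V powr 2 = lam * \<delta>" using V by (simp add: power2_eq_square)
      finally have eq: "X powr P = V powr ((P - 6) / 2) * (lam * \<delta>)" by (simp add: XP)
      have "\<delta> ^ 3 = \<delta> * \<delta>\<^sup>2" by (simp add: power3_eq_cube power2_eq_square)
      also have "\<dots> \<le> \<delta> * 1" using \<delta> by (intro mult_left_mono power_le_one) auto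
      finally have "\<delta> ^ 3 * lam * V powr ((P - 6) / 2) \<le> \<delta> * lam * V powr ((P - 6) / 2)" using lam by (intro mult_right_mono) auto
      thus ?thesis unfolding eq by (simp add: mult_ac)
    qed
    have t1: "a0 powr (P - 2) \<le> (8 * Q) powr (P / 2) * X powr P"
    proof -
      have "a0 powr (P - 2) = (8 * Q) powr ((P - 2) / 2) * V powr ((P - 2) / 2)"
        unfolding sq[OF a0(1)] a0(2) using Q1 V(1) by (simp add: powr_mult)
      also have "\<dots> \<le> (8 * Q) powr (P / 2) * V powr ((P - 2) / 2)" using Qp[of 8 "P - 2"] by (intro mult_right_mono) auto
      also have "(P - 2) / 2 = P / 2 - 1" by (simp add: field_simps)
      finally show ?thesis by (simp add: XP)
    qed
    have low: "\<delta> ^ 3 * lam * (c * Q * V) powr ((P - 6) / 2) \<le> (8 * Q) powr (P / 2) * X powr P" if "1 \<le> c" "c \<le> 8" for c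
    proof -
      have "\<delta> ^ 3 * lam * (c * Q * V) powr ((P - 6) / 2) = (c * Q) powr ((P - 6) / 2) * (\<delta> ^ 3 * lam * V powr ((P - 6) / 2))"
        using that Q1 V(1) by (simp add: powr_mult)
      also have "\<dots> \<le> (8 * Q) powr (P / 2) * X powr P"
        using Qp[of c "P - 6"] that lam \<delta> by (intro mult_mono d3) auto
      finally show ?thesis .
    qed
    have t2: "\<delta> ^ 3 * lam * a0 powr (P - 6) \<le> (8 * Q) powr (P / 2) * X powr P"
      unfolding sq[OF a0(1)] a0(2) using low[of 8] by simp
    \<comment> \<open>\<open>A^2\<close> is comparable to \<open>Q * V\<close> for
      \<open>V \<le> 1\<close> and to \<open>Q * V^2\<close> for \<open>V > 1\<close>. The first
      case resembles that of \<open>a0\<close>; the second produces \<open>Z powr P\<close>.\<close>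
    have t3: "\<delta> ^ 3 * lam * A powr (P - 6) \<le> 2 * ((8 * Q) powr (P / 2) * (X powr P + Z powr P))"
    proof (cases "V \<le> 1")
      case True
      have "(A\<^sup>2) powr ((P - 6) / 2) \<le> (4 * Q * V) powr ((P - 6) / 2) + (8 * Q * V) powr ((P - 6) / 2)"
      proof (rule powr_between)
        have "V * V \<le> V" using True V(1) by (simp add: mult_left_le)
        hence "4 * Q * (V + V * V) \<le> 4 * Q * (V + V)" using Q1 by (intro mult_left_mono add_left_mono) auto
        thus "A\<^sup>2 \<le> 8 * Q * V" unfolding A by simp
        have "4 * Q * V \<le> 4 * Q * (V + V * V)" using Q1 V(1) by (intro mult_left_mono) auto
        thus "4 * Q * V \<le> A\<^sup>2" unfolding A .
      qed (use Q1 V in auto)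
      hence "\<delta> ^ 3 * lam * A powr (P - 6) \<le> \<delta> ^ 3 * lam * ((4 * Q * V) powr ((P - 6) / 2) + (8 * Q * V) powr ((P - 6) / 2))"
        unfolding sq[OF A(1)] using lam \<delta> by (intro mult_left_mono) auto
      also have "\<dots> \<le> (8 * Q) powr (P / 2) * X powr P + (8 * Q) powr (P / 2) * X powr P"
        unfolding distrib_left by (intro add_mono low) auto
      also have "\<dots> \<le> 2 * ((8 * Q) powr (P / 2) * (X powr P + Z powr P))" by (simp add: algebra_simps)
      finally show ?thesis .
    next
      case False
      have "(A\<^sup>2) powr ((P - 6) / 2) \<le> (4 * Q * V\<^sup>2) powr ((P - 6) / 2) + (8 * Q * V\<^sup>2) powr ((P - 6) / 2)"
      proof (rule powr_between)
        have "V \<le> V * V" using False V(1) by (simp add: mult_left_le)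
        hence "4 * Q * (V + V * V) \<le> 4 * Q * (V * V + V * V)" using Q1 by (intro mult_left_mono add_right_mono) auto
        thus "A\<^sup>2 \<le> 8 * Q * V\<^sup>2" unfolding A by (simp add: power2_eq_square)
        have "4 * Q * (V * V) \<le> 4 * Q * (V + V * V)" using Q1 V(1) by (intro mult_left_mono) auto
        thus "4 * Q * V\<^sup>2 \<le> A\<^sup>2" unfolding A by (simp add: power2_eq_square)
      qed (use Q1 V in auto)
      hence "\<delta> ^ 3 * lam * A powr (P - 6) \<le> \<delta> ^ 3 * lam * ((4 * Q * V\<^sup>2) powr ((P - 6) / 2) + (8 * Q * V\<^sup>2) powr ((P - 6) / 2))"
        unfolding sq[OF A(1)] using lam \<delta> by (intro mult_left_mono) auto
      also have "\<dots> = ((4 * Q) powr ((P - 6) / 2) + (8 * Q) powr ((P - 6) / 2)) * Z powr P"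
        unfolding ZP sq[OF V(1)] using Q1 by (simp add: powr_mult algebra_simps)
      also have "\<dots> \<le> ((8 * Q) powr (P / 2) + (8 * Q) powr (P / 2)) * Z powr P"
        by (intro mult_right_mono add_mono Qp) auto
      also have "\<dots> \<le> 2 * ((8 * Q) powr (P / 2) * (X powr P + Z powr P))" by (simp add: algebra_simps)
      finally show ?thesis .
    qed
    define N where "N = (8 * Q) powr (P / 2)"
    define S where "S = (X + Z) powr P"
    have NS: "N \<ge> 0" "S \<ge> 0" by (auto simp: N_def S_def)
    have XS: "X powr P \<le> S" "Z powr P \<le> S" unfolding S_def using XZ0 P by (auto intro!: powr_mono2)
    have b1: "a0 powr (P - 2) \<le> N * S" using t1 mult_left_mono[OF XS(1) NS(1)] unfolding N_def by linarith
    have b2: "\<delta> ^ 3 * lam * a0 powr (P - 6) \<le> N * S" using t2 mult_left_mono[OF XS(1) NS(1)] unfolding N_def by linarith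
    have b3: "\<delta> ^ 3 * lam * A powr (P - 6) \<le> 4 * (N * S)"
    proof -
      have "N * (X powr P + Z powr P) \<le> N * (S + S)" using XS NS by (intro mult_left_mono add_mono) auto
      thus ?thesis using t3 unfolding N_def by (simp add: algebra_simps)
    qed
    have "B0 \<le> 2 * (N * S) + 256 * Q ^ 3 * (5 * (N * S))"
    proof -
      have "B0 = 2 * a0 powr (P - 2) + 256 * Q ^ 3 * (\<delta> ^ 3 * lam * a0 powr (P - 6) + \<delta> ^ 3 * lam * A powr (P - 6))"
        by (simp add: B0_def algebra_simps)
      also have "\<dots> \<le> 2 * (N * S) + 256 * Q ^ 3 * (N * S + 4 * (N * S))"
        using Q1 by (intro add_mono mult_left_mono b1 b2 b3) auto
      finally show ?thesis by simp
    qed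
    also have "\<dots> \<le> 1300 * Q ^ 3 * N * S"
    proof -
      have "1 \<le> Q ^ 3" using Q1 by (rule one_le_power)
      hence "1 * (N * S) \<le> Q ^ 3 * (N * S)" using NS by (intro mult_right_mono) auto
      moreover have "256 * Q ^ 3 * (5 * (N * S)) = 1280 * (Q ^ 3 * (N * S))" "1300 * Q ^ 3 * N * S = 1300 * (Q ^ 3 * (N * S))"
        by simp_all
      moreover have "0 \<le> N * S" using NS by simp
      ultimately show ?thesis by linarith
    qed
    finally show "B0 * (A / a0) powr \<theta> \<le> 1300 * Q ^ 3 * (8 * Q) powr (P / 2) * (X + Z) powr P * lam powr (\<theta> / 2)"
      unfolding N_def S_def using Aa0 Q1 by (intro mult_mono) auto
  qed (use dyadic_const_pos[OF \<theta>(1), of P] in auto)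
  finally show ?thesis .
qed

end

section \<open>From cutoffs to annular symbols, and the upper bound\<close>

lemma cutoff_measurable: "cutoff chi \<Longrightarrow> chi \<in> borel_measurable borel"
proof -
  assume "cutoff chi"
  hence "\<forall>n. (deriv ^^ n) chi differentiable_on UNIV" unfolding cutoff_def by (rule conjunct1)
  hence "(deriv ^^ 0) chi differentiable_on UNIV" by (rule spec)
  hence "continuous_on UNIV chi" by (auto dest: differentiable_imp_continuous_on)
  thus ?thesis by (rule borel_measurable_continuous_onI)
qed

lemma cutoff_support:
  assumes "cutoff chi"
  shows "\<exists>R\<ge>1. \<forall>t. chi t \<noteq> 0 \<longrightarrow> \<bar>t\<bar> \<le> R"
proof -
  have "bounded (closure {t. chi t \<noteq> 0})" using assms unfolding cutoff_def by (intro compact_imp_bounded) auto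
  then obtain B where B: "\<forall>t\<in>closure {t. chi t \<noteq> 0}. norm t \<le> B" by (auto simp: bounded_iff)
  show ?thesis
  proof (intro exI[of _ "max 1 B"] conjI allI impI)
    show "max 1 B \<ge> 1" by simp
    fix t assume "chi t \<noteq> 0"
    hence "t \<in> closure {t. chi t \<noteq> 0}" by (intro subsetD[OF closure_subset]) simp
    from bspec[OF B this] show "\<bar>t\<bar> \<le> max 1 B" by simp
  qed
qed

lemma cutoff_plateau:
  assumes "cutoff chi"
  shows "\<exists>r>0. \<forall>t. \<bar>t\<bar> < r \<longrightarrow> chi t = 1"
proof -
  have "\<forall>\<^sub>F t in nhds 0. chi t = 1" using assms unfolding cutoff_def by simp
  then obtain r where "r > 0" "\<forall>t. dist t 0 < r \<longrightarrow> chi t = 1" by (auto simp: eventually_nhds_metric)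
  thus ?thesis by (intro exI[of _ r]) (simp add: dist_real_def)
qed

definition annulus_symbol :: "(real \<Rightarrow> real) \<Rightarrow> real \<Rightarrow> real \<Rightarrow> int \<Rightarrow> real \<Rightarrow> real" where
  "annulus_symbol chi lam \<delta> k \<eta> = chi ((sqrt ((of_int k)\<^sup>2 + \<eta>\<^sup>2) - lam) / \<delta>)"

text \<open>For \<open>s = sqrt (k^2 + \<eta>^2)\<close> in the support,
  \<open>\<bar>s - lam\<bar> \<le> R * \<delta>\<close> and
  \<open>s + lam \<le> (2 + R) * lam\<close>; the product gives
  \<open>D = R * (2 + R)\<close>.\<close>

lemma annulus_multiplier_symbol:
  assumes chi: "cutoff chi" and R: "R \<ge> 1" "\<And>t. chi t \<noteq> 0 \<Longrightarrow> \<bar>t\<bar> \<le> R"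
    and lam: "lam > 1" and \<delta>: "0 < \<delta>" "\<delta> < 1"
  shows "annulus_multiplier (annulus_symbol chi lam \<delta>) lam \<delta> (R * (2 + R))"
proof
  show "1 \<le> R * (2 + R)" using R(1) mult_mono[of 1 R 1 "2 + R"] by simp
  fix k :: int and \<eta> :: real
  have [measurable]: "chi \<in> borel_measurable borel" by (rule cutoff_measurable[OF chi])
  show "annulus_symbol chi lam \<delta> k \<in> borel_measurable borel" unfolding annulus_symbol_def[abs_def] by measurable
  show "\<bar>annulus_symbol chi lam \<delta> k \<eta>\<bar> \<le> 1" using chi unfolding annulus_symbol_def cutoff_def by (simp add: abs_le_iff order_trans[of "-1" 0])
  assume "annulus_symbol chi lam \<delta> k \<eta> \<noteq> 0"
  define s where "s = sqrt ((real_of_int k)\<^sup>2 + \<eta>\<^sup>2)"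
  have s: "s \<ge> 0" "s\<^sup>2 = (real_of_int k)\<^sup>2 + \<eta>\<^sup>2" by (auto simp: s_def)
  have "\<bar>(s - lam) / \<delta>\<bar> \<le> R"
    using \<open>annulus_symbol chi lam \<delta> k \<eta> \<noteq> 0\<close> unfolding annulus_symbol_def s_def by (rule R(2))
  hence sl: "\<bar>s - lam\<bar> \<le> R * \<delta>" using \<delta> by (simp add: field_simps)
  have "R * \<delta> \<le> R * lam" using R lam \<delta> by (intro mult_left_mono) auto
  hence "s + lam \<le> (2 + R) * lam" using sl by (simp add: algebra_simps abs_le_iff)
  hence "\<bar>s - lam\<bar> * (s + lam) \<le> (R * \<delta>) * ((2 + R) * lam)" using sl s R lam \<delta> by (intro mult_mono) auto
  moreover have "(real_of_int k)\<^sup>2 + \<eta>\<^sup>2 - lam\<^sup>2 = (s - lam) * (s + lam)" unfolding s(2)[symmetric] by (simp add: algebra_simps power2_eq_square)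
  ultimately show "\<bar>(real_of_int k)\<^sup>2 + \<eta>\<^sup>2 - lam\<^sup>2\<bar> \<le> R * (2 + R) * lam * \<delta>"
    using s lam by (simp add: abs_mult mult_ac)
qed (use lam \<delta> in auto)

lemma spectral_projector_eq_synthesis:
  assumes "annulus_multiplier (annulus_symbol chi lam \<delta>) lam \<delta> D"
  shows "spectral_projector chi lam \<delta> f = annulus_multiplier.synthesis (annulus_symbol chi lam \<delta>) (fourier_cyl f)"
  unfolding spectral_projector_def annulus_multiplier.synthesis_def[OF assms] annulus_symbol_def ..

lemma Lp_norm_2_le_1_iff: "Lp_norm M 2 f \<le> 1 \<longleftrightarrow> (\<integral>\<^sup>+z. ennreal ((cmod (f z))\<^sup>2) \<partial>M) \<le> 1"
proof
  assume "Lp_norm M 2 f \<le> 1"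
  hence "Lp_norm M 2 f * Lp_norm M 2 f \<le> 1 * 1" by (intro mult_mono) auto
  thus "(\<integral>\<^sup>+z. ennreal ((cmod (f z))\<^sup>2) \<partial>M) \<le> 1" by (simp add: Lp_norm_2_square)
next
  assume le: "(\<integral>\<^sup>+z. ennreal ((cmod (f z))\<^sup>2) \<partial>M) \<le> 1"
  show "Lp_norm M 2 f \<le> 1"
  proof (rule ccontr)
    assume gt: "\<not> ?thesis"
    have "1 < Lp_norm M 2 f" using gt by simp
    also have "Lp_norm M 2 f = 1 * Lp_norm M 2 f" by simp
    also have "\<dots> \<le> Lp_norm M 2 f * Lp_norm M 2 f" using gt by (intro mult_right_mono) auto
    finally show False using le unfolding Lp_norm_2_square by simp
  qed
qed

lemma Lp_norm_leI:
  assumes P: "P > 0" and b: "b \<ge> 0" and le: "(\<integral>\<^sup>+z. ennreal (cmod (f z) powr P) \<partial>M) \<le> ennreal (b powr P)"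
  shows "Lp_norm M (ennreal P) f \<le> ennreal b"
proof -
  define I where "I = (\<integral>\<^sup>+z. ennreal (cmod (f z) powr P) \<partial>M)"
  have I: "I \<le> ennreal (b powr P)" using le by (simp add: I_def)
  hence fin: "I \<noteq> \<infinity>" by (auto simp: top_unique)
  have "enn2real I \<le> b powr P" using I by (intro enn2real_leI) auto
  hence "enn2real I powr (1 / P) \<le> (b powr P) powr (1 / P)" using P by (intro powr_mono2) auto
  also have "\<dots> = b" using P b by (simp add: powr_powr)
  finally have "ennreal (enn2real I powr (1 / P)) \<le> ennreal b" by (rule ennreal_leI)
  thus ?thesis using P fin by (simp add: Lp_norm_def Let_def I_def)
qed

text \<open>As \<open>enn2real (1 / p)\<close> vanishes at infinity, one formula covers the
  essential supremum too, where \<open>\<Omega>\<close> only has to have positive measure.\<close>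

lemma Lp_norm_ge_on_set:
  assumes f: "f \<in> borel_measurable M" and \<Omega>: "\<Omega> \<in> sets M" "emeasure M \<Omega> = ennreal \<mu>" "\<mu> > 0"
    and p: "p > 0" and v: "v \<ge> 0" and lower: "\<And>z. z \<in> \<Omega> \<Longrightarrow> v \<le> cmod (f z)"
  shows "ennreal (v * \<mu> powr enn2real (1 / p)) \<le> Lp_norm M p f"
proof (cases "p = \<infinity>")
  case True
  have "ennreal v \<le> esssup M (\<lambda>z. ennreal (cmod (f z)))"
  proof (rule ccontr)
    assume less: "\<not> ?thesis"
    have [measurable]: "f \<in> borel_measurable M" "\<Omega> \<in> sets M" by fact+
    have "AE z in M. ennreal (cmod (f z)) \<le> esssup M (\<lambda>z. ennreal (cmod (f z)))" by (rule esssup_AE)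
    hence "AE z in M. z \<notin> \<Omega>"
    proof eventually_elim
      case (elim z)
      show ?case
      proof
        assume "z \<in> \<Omega>"
        hence "ennreal v \<le> ennreal (cmod (f z))" by (intro ennreal_leI lower)
        from order_trans[OF this elim] show False using less by contradiction
      qed
    qed
    moreover have "{z \<in> space M. \<not> z \<notin> \<Omega>} = \<Omega>" using sets.sets_into_space[OF \<Omega>(1)] by auto
    ultimately have "emeasure M \<Omega> = 0" using AE_iff_measurable[OF \<Omega>(1), of "\<lambda>z. z \<notin> \<Omega>"] by simp
    thus False using \<Omega> by simp
  qed
  thus ?thesis using True \<Omega> by (simp add: Lp_norm_def)
next
  case False
  then obtain P where P: "p = ennreal P" "P > 0" using p by (cases p) auto
  have [measurable]: "f \<in> borel_measurable M" "\<Omega> \<in> sets M" by fact+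
  define I where "I = (\<integral>\<^sup>+z. ennreal (cmod (f z) powr P) \<partial>M)"
  have "ennreal (v powr P * \<mu>) = (\<integral>\<^sup>+z. ennreal (v powr P) * indicator \<Omega> z \<partial>M)"
    using \<Omega> by (simp add: nn_integral_cmult_indicator ennreal_mult)
  also have "\<dots> \<le> I"
    unfolding I_def using lower v P by (intro nn_integral_mono) (auto simp: indicator_def intro!: ennreal_leI powr_mono2)
  finally have I: "ennreal (v powr P * \<mu>) \<le> I" .
  have q: "enn2real (1 / p) = 1 / P" using P by (simp add: divide_ennreal flip: ennreal_1)
  show ?thesis
  proof (cases "I = \<infinity>")
    case True
    thus ?thesis using P by (simp add: Lp_norm_def Let_def I_def)
  next
    case False
    hence "v powr P * \<mu> \<le> enn2real I" using I \<Omega> enn2real_mono[OF I] by (simp add: less_top)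
    hence "(v powr P * \<mu>) powr (1 / P) \<le> enn2real I powr (1 / P)" using P \<Omega> by (intro powr_mono2) auto
    also have "(v powr P * \<mu>) powr (1 / P) = v * \<mu> powr (1 / P)" using P v \<Omega> by (simp add: powr_mult powr_powr)
    finally show ?thesis using False P unfolding q by (simp add: Lp_norm_def Let_def I_def ennreal_leI)
  qed
qed

text \<open>Turns each logarithmic loss into an arbitrarily small power, by
  \<open>ln x \<le> x\<close> at \<open>x = lam powr \<kappa>\<close>.\<close>

lemma one_plus_ln_le_powr:
  fixes lam \<kappa> :: real
  assumes "lam > 1" "\<kappa> > 0"
  shows "1 + ln lam \<le> (1 + 1 / \<kappa>) * lam powr \<kappa>"
proof -
  have "1 \<le> lam powr \<kappa>" using assms by (intro ge_one_powr_ge_zero) auto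
  moreover have "ln (lam powr \<kappa>) \<le> lam powr \<kappa>" using assms ln_le_minus_one[of "lam powr \<kappa>"] by simp
  hence "ln lam \<le> 1 / \<kappa> * lam powr \<kappa>" using assms by (simp add: ln_powr field_simps)
  ultimately show ?thesis by (simp add: algebra_simps)
qed

lemma projector_bound_ennreal:
  assumes "P > 0"
  shows "projector_bound (ennreal P) lam \<delta> = lam powr (1 / 2 - 2 / P) * \<delta> powr (1 / 2) + (lam * \<delta>) powr (1 / 4 - 1 / (2 * P))"
proof -
  have "2 / ennreal P = ennreal (2 / P)" using assms by (simp add: divide_ennreal flip: ennreal_numeral)
  moreover have "1 / (2 * ennreal P) = ennreal (1 / (2 * P))"
  proof -
    have "2 * ennreal P = ennreal (2 * P)" using assms by (simp add: ennreal_mult)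
    thus ?thesis using assms by (simp add: divide_ennreal flip: ennreal_1)
  qed
  ultimately show ?thesis using assms by (simp add: projector_bound_def)
qed

lemma annulus_synthesis_fourier_cyl:
  assumes m: "annulus_multiplier m lam \<delta> D" and f: "f \<in> Lp_space cylinder 2" "Lp_norm cylinder 2 f \<le> 1"
  shows "annulus_synthesis m lam \<delta> D (fourier_cyl f)"
proof -
  interpret annulus_multiplier m lam \<delta> D by fact
  have fm: "f \<in> borel_measurable cylinder" using f by (simp add: Lp_space_def)
  have f1: "(\<integral>\<^sup>+z. ennreal ((cmod (f z))\<^sup>2) \<partial>cylinder) \<le> 1" using f(2) by (simp add: Lp_norm_2_le_1_iff)
  hence f2: "(\<integral>\<^sup>+z. ennreal ((cmod (f z))\<^sup>2) \<partial>cylinder) < \<infinity>" by (auto simp: le_less_trans[OF _ ennreal_one_less_top])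
  show ?thesis
  proof
    show "fourier_cyl f k \<in> borel_measurable borel" for k by (rule bessel_fourier_cyl(1)[OF fm f2 finite_freqs])
    have "(\<Sum>k\<in>freqs. \<integral>\<^sup>+\<eta>. ennreal ((cmod (fourier_cyl f k \<eta>))\<^sup>2) \<partial>lborel) \<le> 2 * (\<integral>\<^sup>+z. ennreal ((cmod (f z))\<^sup>2) \<partial>cylinder)"
      by (rule bessel_fourier_cyl(2)[OF fm f2 finite_freqs])
    also have "\<dots> \<le> 2 * 1" by (intro mult_left_mono f1) simp
    finally show "(\<Sum>k\<in>freqs. \<integral>\<^sup>+\<eta>. ennreal ((cmod (fourier_cyl f k \<eta>))\<^sup>2) \<partial>lborel) \<le> 2" by simp
  qed
qed

lemma spectral_projector_upper_bound:
  assumes chi: "cutoff chi" and p: "2 < p" and \<epsilon>: "\<epsilon> > 0"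
  shows "\<exists>C>0. \<forall>lam \<delta>. 1 < lam \<and> 0 < \<delta> \<and> \<delta> < 1 \<longrightarrow>
     op_norm_L2_Lp p (spectral_projector chi lam \<delta>) \<le> ennreal (C * lam powr \<epsilon> * \<delta> powr (- \<epsilon>) * projector_bound p lam \<delta>)"
proof -
  obtain R where R1: "R \<ge> 1" and "\<forall>t. chi t \<noteq> 0 \<longrightarrow> \<bar>t\<bar> \<le> R" using cutoff_support[OF chi] by auto
  hence R: "R \<ge> 1" "\<And>t. chi t \<noteq> 0 \<Longrightarrow> \<bar>t\<bar> \<le> R" by simp_all
  define D where "D = R * (2 + R)"
  have D: "D \<ge> 1" using R(1) mult_mono[of 1 R 1 "2 + R"] by (simp add: D_def)
  \<comment> \<open>The value of \<open>C1\<close>, restated outside the locale because the constant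
    has to be fixed before \<open>lam\<close> and \<open>\<delta>\<close>.\<close>
  define c1 where "c1 = 8 * (D + 4) * sqrt D + 480 * exp (pi * D\<^sup>2) + 32 * D"
  have c1: "c1 > 0" unfolding c1_def using D by (intro add_pos_pos add_nonneg_pos) auto
  \<comment> \<open>Reduction to arbitrary admissible Fourier data; the factor
    \<open>\<delta> powr (- \<epsilon>) \<ge> 1\<close> is inserted at the end.\<close>
  have main: ?thesis if C: "C > 0"
    and bound: "\<And>lam \<delta> \<phi>. 1 < lam \<Longrightarrow> 0 < \<delta> \<Longrightarrow> \<delta> < 1 \<Longrightarrow> annulus_synthesis (annulus_symbol chi lam \<delta>) lam \<delta> D \<phi> \<Longrightarrow>
       Lp_norm cylinder p (annulus_multiplier.synthesis (annulus_symbol chi lam \<delta>) \<phi>) \<le> ennreal (C * lam powr \<epsilon> * projector_bound p lam \<delta>)" for C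
  proof (intro exI[of _ C] conjI allI impI C)
    fix lam \<delta> :: real assume "1 < lam \<and> 0 < \<delta> \<and> \<delta> < 1"
    hence ld: "1 < lam" "0 < \<delta>" "\<delta> < 1" by auto
    have m: "annulus_multiplier (annulus_symbol chi lam \<delta>) lam \<delta> D"
      unfolding D_def by (rule annulus_multiplier_symbol[OF chi R ld])
    have pb: "projector_bound p lam \<delta> \<ge> 0" unfolding projector_bound_def by (intro add_nonneg_nonneg mult_nonneg_nonneg) auto
    have "1 \<le> \<delta> powr (- \<epsilon>)" using ld \<epsilon> powr_mono'[of "- \<epsilon>" 0 \<delta>] by simp
    hence "C * lam powr \<epsilon> * projector_bound p lam \<delta> * 1 \<le> C * lam powr \<epsilon> * projector_bound p lam \<delta> * \<delta> powr (- \<epsilon>)"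
      using C pb by (intro mult_left_mono) auto
    hence le: "C * lam powr \<epsilon> * projector_bound p lam \<delta> \<le> C * lam powr \<epsilon> * \<delta> powr (- \<epsilon>) * projector_bound p lam \<delta>"
      by (simp add: mult_ac)
    show "op_norm_L2_Lp p (spectral_projector chi lam \<delta>) \<le> ennreal (C * lam powr \<epsilon> * \<delta> powr (- \<epsilon>) * projector_bound p lam \<delta>)"
      unfolding op_norm_L2_Lp_def spectral_projector_eq_synthesis[OF m]
    proof (rule SUP_least)
      fix f assume "f \<in> {f \<in> Lp_space cylinder 2. Lp_norm cylinder 2 f \<le> 1}"
      hence "annulus_synthesis (annulus_symbol chi lam \<delta>) lam \<delta> D (fourier_cyl f)"
        by (intro annulus_synthesis_fourier_cyl[OF m]) auto
      from bound[OF ld this] ennreal_leI[OF le]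
      show "Lp_norm cylinder p (annulus_multiplier.synthesis (annulus_symbol chi lam \<delta>) (fourier_cyl f)) \<le> ennreal (C * lam powr \<epsilon> * \<delta> powr (- \<epsilon>) * projector_bound p lam \<delta>)"
        by (rule order_trans)
    qed
  qed
  show ?thesis
  proof (cases "p = \<infinity>")
    case True
    \<comment> \<open>The logarithm is bounded by the power \<open>2 * \<epsilon>\<close>, which the
      square root in \<open>synthesis_bounded\<close> halves.\<close>
    define c3 where "c3 = c1 * (1 + 1 / (2 * \<epsilon>))"
    have c3: "c3 > 0" using c1 \<epsilon> by (simp add: c3_def add_pos_pos)
    show ?thesis
    proof (rule main)
      show "2 * sqrt c3 > 0" using c3 by simp
      fix lam \<delta> :: real and \<phi> assume ld: "1 < lam" "0 < \<delta>" "\<delta> < 1" and "annulus_synthesis (annulus_symbol chi lam \<delta>) lam \<delta> D \<phi>"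
      then interpret annulus_synthesis "annulus_symbol chi lam \<delta>" lam \<delta> D \<phi> by simp
      have cc: "C1 = c1" by (simp add: C1_def c1_def)
      have "2 * \<epsilon> > 0" using \<epsilon> by simp
      have "C1 * (1 + ln lam) \<le> c1 * ((1 + 1 / (2 * \<epsilon>)) * lam powr (2 * \<epsilon>))"
        unfolding cc using c1 by (intro mult_left_mono one_plus_ln_le_powr ld \<open>2 * \<epsilon> > 0\<close>) auto
      hence Q: "C1 * (1 + ln lam) \<le> c3 * lam powr (2 * \<epsilon>)" by (simp add: c3_def mult.assoc)
      define W where "W = sqrt (lam * \<delta>) + lam * \<delta>"
      have W: "W \<ge> 0" using ld by (simp add: W_def)
      have b: "cmod (F z) \<le> 2 * sqrt c3 * lam powr \<epsilon> * projector_bound p lam \<delta>" for z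
      proof -
        have "cmod (F z) \<le> 2 * sqrt (C1 * (1 + ln lam) * W)" unfolding W_def by (rule synthesis_bounded)
        also have "\<dots> \<le> 2 * sqrt (c3 * lam powr (2 * \<epsilon>) * W)" using Q W by (intro mult_left_mono real_sqrt_le_mono mult_right_mono) auto
        also have "\<dots> = 2 * sqrt c3 * lam powr \<epsilon> * sqrt W"
        proof -
          have "lam powr (2 * \<epsilon>) = (lam powr \<epsilon>)\<^sup>2" by (simp add: power2_eq_square flip: powr_add)
          thus ?thesis by (simp add: real_sqrt_mult)
        qed
        also have "\<dots> \<le> 2 * sqrt c3 * lam powr \<epsilon> * projector_bound p lam \<delta>"
        proof (rule mult_left_mono)
          have "sqrt W \<le> sqrt (sqrt (lam * \<delta>)) + sqrt (lam * \<delta>)" unfolding W_def using ld by (intro sqrt_add_le_add_sqrt) auto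
          also have "\<dots> = projector_bound p lam \<delta>"
          proof -
            have "sqrt (sqrt (lam * \<delta>)) = (lam * \<delta>) powr (1/4)"
              using ld sqrt_powr[of "lam * \<delta>" "1/2"] by (simp add: powr_half_sqrt)
            moreover have "sqrt (lam * \<delta>) = lam powr (1/2) * \<delta> powr (1/2)" using ld by (simp add: powr_half_sqrt real_sqrt_mult)
            ultimately show ?thesis using True by (simp add: projector_bound_def ennreal_mult_top)
          qed
          finally show "sqrt W \<le> projector_bound p lam \<delta>" .
        qed (use c3 in auto)
        finally show ?thesis .
      qed
      have [measurable]: "F \<in> borel_measurable cylinder" by (rule synthesis_measurable)
      have "esssup cylinder (\<lambda>z. ennreal (cmod (F z))) \<le> ennreal (2 * sqrt c3 * lam powr \<epsilon> * projector_bound p lam \<delta>)"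
        by (intro esssup_I AE_I2 ennreal_leI b) measurable
      thus "Lp_norm cylinder p (synthesis \<phi>) \<le> ennreal (2 * sqrt c3 * lam powr \<epsilon> * projector_bound p lam \<delta>)"
        using True by (simp add: Lp_norm_def)
    qed
  next
    case False
    then obtain P where P: "p = ennreal P" "P \<ge> 0" by (cases p) auto
    have P2: "P > 2" using p P by (simp flip: ennreal_numeral add: ennreal_less_iff)
    \<comment> \<open>Budget for the \<open>P\<close>-th power of the norm:
      \<open>lam powr (\<theta> / 2)\<close> costs at most \<open>\<epsilon> * P / 2\<close>, and
      \<open>Q\<close>, which enters with the exponent \<open>3 + P / 2\<close>, costs the other
      half through \<open>\<kappa>\<close>.\<close>
    define \<theta> where "\<theta> = min (P - 2) (\<epsilon> * P)"
    have \<theta>: "\<theta> > 0" "\<theta> \<le> P - 2" "\<theta> \<le> \<epsilon> * P" using P2 \<epsilon> by (auto simp: \<theta>_def)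
    define \<kappa> where "\<kappa> = \<epsilon> * P / (2 * (3 + P / 2))"
    have \<kappa>: "\<kappa> > 0" "\<kappa> * (3 + P / 2) = \<epsilon> * P / 2"
      using P2 \<epsilon> unfolding \<kappa>_def by (simp, simp add: field_simps)
    define c3 where "c3 = c1 * (1 + 1 / \<kappa>)"
    have c3: "c3 > 0" using c1 \<kappa> by (simp add: c3_def add_pos_pos)
    define K where "K = dyadic_const P \<theta> * (1300 * c3 ^ 3 * (8 * c3) powr (P / 2))"
    have K: "K > 0" unfolding K_def using c3 dyadic_const_pos[OF \<theta>(1)] by simp
    show ?thesis
    proof (rule main)
      show "K powr (1 / P) > 0" using K by simp
      fix lam \<delta> :: real and \<phi> assume ld: "1 < lam" "0 < \<delta>" "\<delta> < 1" and "annulus_synthesis (annulus_symbol chi lam \<delta>) lam \<delta> D \<phi>"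
      then interpret annulus_synthesis "annulus_symbol chi lam \<delta>" lam \<delta> D \<phi> by simp
      have cc: "C1 = c1" by (simp add: C1_def c1_def)
      define Q where "Q = C1 * (1 + ln lam)"
      have Q0: "Q \<ge> 0" unfolding Q_def cc using c1 ld by simp
      have "C1 * (1 + ln lam) \<le> c1 * ((1 + 1 / \<kappa>) * lam powr \<kappa>)"
        unfolding cc using c1 by (intro mult_left_mono one_plus_ln_le_powr ld \<kappa>) auto
      hence Q: "Q \<le> c3 * lam powr \<kappa>" by (simp add: c3_def Q_def mult.assoc)
      define b where "b = projector_bound p lam \<delta>"
      have b0: "b \<ge> 0" unfolding b_def projector_bound_def by (intro add_nonneg_nonneg mult_nonneg_nonneg) auto
      have b: "b = (lam * \<delta>) powr (1 / 4 - 1 / (2 * P)) + lam powr (1 / 2 - 2 / P) * \<delta> powr (1 / 2)"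
        unfolding b_def P(1) using P2 by (simp add: projector_bound_ennreal)
      have "(\<integral>\<^sup>+z. ennreal (cmod (F z) powr P) \<partial>cylinder)
         \<le> ennreal (dyadic_const P \<theta> * (1300 * Q ^ 3 * (8 * Q) powr (P / 2) * b powr P * lam powr (\<theta> / 2)))"
        unfolding Q_def b by (rule synthesis_Lp_bound[OF P2 \<theta>(1,2)])
      also have "\<dots> \<le> ennreal ((K powr (1 / P) * lam powr \<epsilon> * b) powr P)"
      proof (rule ennreal_leI)
        have "Q ^ 3 \<le> (c3 * lam powr \<kappa>) ^ 3" using Q Q0 by (intro power_mono) auto
        also have "\<dots> = c3 ^ 3 * lam powr (3 * \<kappa>)" using ld by (simp add: power_mult_distrib powr_power)
        finally have q3: "Q ^ 3 \<le> c3 ^ 3 * lam powr (3 * \<kappa>)" .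
        have "(8 * Q) powr (P / 2) \<le> (8 * (c3 * lam powr \<kappa>)) powr (P / 2)" using Q Q0 P2 by (intro powr_mono2) auto
        also have "\<dots> = (8 * c3) powr (P / 2) * lam powr (\<kappa> * (P / 2))" using c3 ld by (simp add: powr_mult powr_powr)
        finally have q8: "(8 * Q) powr (P / 2) \<le> (8 * c3) powr (P / 2) * lam powr (\<kappa> * (P / 2))" .
        have "lam powr (\<theta> / 2) \<le> lam powr (\<epsilon> * P / 2)" using ld \<theta> by (intro powr_mono) auto
        hence "1300 * Q ^ 3 * (8 * Q) powr (P / 2) * b powr P * lam powr (\<theta> / 2)
          \<le> 1300 * (c3 ^ 3 * lam powr (3 * \<kappa>)) * ((8 * c3) powr (P / 2) * lam powr (\<kappa> * (P / 2))) * b powr P * lam powr (\<epsilon> * P / 2)"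
          using q3 q8 Q0 c3 by (intro mult_mono mult_nonneg_nonneg) auto
        also have "\<dots> = (1300 * c3 ^ 3 * (8 * c3) powr (P / 2)) * (lam powr (3 * \<kappa>) * lam powr (\<kappa> * (P / 2)) * lam powr (\<epsilon> * P / 2)) * b powr P"
          by (simp only: mult_ac)
        also have "lam powr (3 * \<kappa>) * lam powr (\<kappa> * (P / 2)) * lam powr (\<epsilon> * P / 2) = lam powr (\<epsilon> * P)"
        proof -
          have "3 * \<kappa> + \<kappa> * (P / 2) + \<epsilon> * P / 2 = \<epsilon> * P" using \<kappa>(2) by (simp add: algebra_simps)
          thus ?thesis by (simp only: powr_add[symmetric])
        qed
        finally have "dyadic_const P \<theta> * (1300 * Q ^ 3 * (8 * Q) powr (P / 2) * b powr P * lam powr (\<theta> / 2))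
          \<le> dyadic_const P \<theta> * ((1300 * c3 ^ 3 * (8 * c3) powr (P / 2)) * lam powr (\<epsilon> * P) * b powr P)"
          using dyadic_const_pos[OF \<theta>(1), of P] by (intro mult_left_mono) auto
        also have "\<dots> = K * lam powr (\<epsilon> * P) * b powr P" by (simp add: K_def mult_ac)
        also have "\<dots> = (K powr (1 / P) * lam powr \<epsilon> * b) powr P"
          using K ld b0 P2 by (simp add: powr_mult powr_powr)
        finally show "dyadic_const P \<theta> * (1300 * Q ^ 3 * (8 * Q) powr (P / 2) * b powr P * lam powr (\<theta> / 2)) \<le> (K powr (1 / P) * lam powr \<epsilon> * b) powr P" .
      qed
      finally have "Lp_norm cylinder (ennreal P) (synthesis \<phi>) \<le> ennreal (K powr (1 / P) * lam powr \<epsilon> * b)"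
        using P2 b0 by (intro Lp_norm_leI) auto
      thus "Lp_norm cylinder p (synthesis \<phi>) \<le> ennreal (K powr (1 / P) * lam powr \<epsilon> * projector_bound p lam \<delta>)"
        by (simp add: P(1) b_def)
    qed
  qed
qed

section \<open>Test functions and the lower bound\<close>

lemma parseval_circle:
  assumes S: "finite S"
  shows "(\<integral>\<^sup>+x. ennreal ((cmod (\<Sum>k\<in>S. a k * cis (2 * pi * real_of_int k * x)))\<^sup>2) \<partial>circle) = ennreal (\<Sum>k\<in>S. (cmod (a k))\<^sup>2)"
proof -
  define e where "e k x = cis (2 * pi * real_of_int k * x)" for k :: int and x :: real
  have ee: "has_bochner_integral circle (\<lambda>x. e k x * cnj (e l x)) (if k = l then 1 else 0)" for k l
    using circle_has_integral_cis[of "k - l"] by (simp add: e_def cis_cnj cis_mult algebra_simps)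
  have expand: "complex_of_real ((cmod (\<Sum>k\<in>S. a k * e k x))\<^sup>2) = (\<Sum>k\<in>S. \<Sum>l\<in>S. a k * cnj (a l) * (e k x * cnj (e l x)))" for x
    unfolding complex_norm_square by (simp add: sum_product mult_ac)
  have "has_bochner_integral circle (\<lambda>x. complex_of_real ((cmod (\<Sum>k\<in>S. a k * e k x))\<^sup>2)) (\<Sum>k\<in>S. \<Sum>l\<in>S. a k * cnj (a l) * (if k = l then 1 else 0))"
    unfolding expand by (intro has_bochner_integral_sum has_bochner_integral_mult_right ee)
  also have "(\<Sum>k\<in>S. \<Sum>l\<in>S. a k * cnj (a l) * (if k = l then 1 else 0)) = complex_of_real (\<Sum>k\<in>S. (cmod (a k))\<^sup>2)"
    using S by (simp add: if_distrib sum.delta complex_norm_square[symmetric] del: of_real_power cong: if_cong)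
  finally have H: "has_bochner_integral circle (\<lambda>x. complex_of_real ((cmod (\<Sum>k\<in>S. a k * e k x))\<^sup>2)) (complex_of_real (\<Sum>k\<in>S. (cmod (a k))\<^sup>2))" .
  have int: "integrable circle (\<lambda>x. (cmod (\<Sum>k\<in>S. a k * e k x))\<^sup>2)"
    using H integrable_Re[of circle "\<lambda>x. complex_of_real ((cmod (\<Sum>k\<in>S. a k * e k x))\<^sup>2)"]
    unfolding has_bochner_integral_iff Re_complex_of_real by simp
  have "(LINT x|circle. (cmod (\<Sum>k\<in>S. a k * e k x))\<^sup>2) = (\<Sum>k\<in>S. (cmod (a k))\<^sup>2)"
    using H unfolding has_bochner_integral_iff integral_complex_of_real of_real_eq_iff by simp
  with nn_integral_eq_integral[OF int] show ?thesis by (simp add: e_def)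
qed

lemma fourier_coeff_x_trigonometric:
  assumes S: "finite S"
  shows "fourier_coeff_x (\<lambda>(x, y). \<Sum>k\<in>S. h k y * cis (2 * pi * real_of_int k * x)) j y = (if j \<in> S then h j y else 0)"
proof -
  have ee: "has_bochner_integral circle (\<lambda>x. cis (2 * pi * real_of_int k * x) * cis (- 2 * pi * real_of_int j * x)) (if k = j then 1 else 0)" for k
    using circle_has_integral_cis[of "k - j"] by (simp add: cis_mult algebra_simps)
  have "has_bochner_integral circle (\<lambda>x. \<Sum>k\<in>S. h k y * (cis (2 * pi * real_of_int k * x) * cis (- 2 * pi * real_of_int j * x))) (\<Sum>k\<in>S. h k y * (if k = j then 1 else 0))"
    by (intro has_bochner_integral_sum has_bochner_integral_mult_right ee)
  hence "fourier_coeff_x (\<lambda>(x, y). \<Sum>k\<in>S. h k y * cis (2 * pi * real_of_int k * x)) j y = (\<Sum>k\<in>S. h k y * (if k = j then 1 else 0))"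
    by (simp add: has_bochner_integral_iff fourier_coeff_x_def sum_distrib_right mult.assoc)
  also have "\<dots> = (if j \<in> S then h j y else 0)" using S by (simp add: if_distrib sum.delta cong: if_cong)
  finally show ?thesis .
qed

text \<open>The transform is the Gaussian of height 1 and width \<open>l\<close> centred at
  \<open>c\<close>. The exact squared norm is \<open>l / sqrt 2\<close>; dropping one of the two
  Gaussian factors in the square gives the bound \<open>l\<close>.\<close>

lemma gaussian_wave_packet:
  fixes l c :: real
  assumes l: "l > 0"
  defines "h \<equiv> \<lambda>y. of_real (l * exp (- pi * (l * y)\<^sup>2)) * cis (2 * pi * c * y)"
  shows "integrable lborel h" "(\<integral>\<^sup>+y. ennreal ((cmod (h y))\<^sup>2) \<partial>lborel) \<le> ennreal l"
    and "(LINT y|lborel. h y * cis (- 2 * pi * \<eta> * y)) = of_real (exp (- pi * ((\<eta> - c) / l)\<^sup>2))"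
proof -
  have l': "1 / l > 0" using l by simp
  have g: "integrable lborel (\<lambda>y. exp (- pi * (l * y)\<^sup>2))" "(LINT y|lborel. exp (- pi * (l * y)\<^sup>2)) = 1 / l"
    using gaussian_integrable[OF l', of 0] by (simp_all add: mult.commute)
  have hn: "cmod (h y) = l * exp (- pi * (l * y)\<^sup>2)" for y using l by (simp add: h_def norm_mult)
  show "integrable lborel h"
    by (rule Bochner_Integration.integrable_bound[OF integrable_mult_right[OF g(1), of l]]) (auto simp: hn abs_mult, simp add: h_def)
  have "(\<integral>\<^sup>+y. ennreal ((cmod (h y))\<^sup>2) \<partial>lborel) \<le> (\<integral>\<^sup>+y. ennreal (l\<^sup>2 * exp (- pi * (l * y)\<^sup>2)) \<partial>lborel)"
  proof (intro nn_integral_mono ennreal_leI)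
    fix y
    have "exp (- pi * (l * y)\<^sup>2) \<le> 1" unfolding exp_le_one_iff by simp
    hence "exp (- pi * (l * y)\<^sup>2) * exp (- pi * (l * y)\<^sup>2) \<le> exp (- pi * (l * y)\<^sup>2) * 1" by (intro mult_left_mono) auto
    thus "(cmod (h y))\<^sup>2 \<le> l\<^sup>2 * exp (- pi * (l * y)\<^sup>2)" unfolding hn power_mult_distrib by (intro mult_left_mono) (simp_all add: power2_eq_square)
  qed
  also have "\<dots> = ennreal (LINT y|lborel. l\<^sup>2 * exp (- pi * (l * y)\<^sup>2))"
    by (rule nn_integral_eq_integral) (use g in auto)
  also have "(LINT y|lborel. l\<^sup>2 * exp (- pi * (l * y)\<^sup>2)) = l" using g l by (simp add: power2_eq_square)
  finally show "(\<integral>\<^sup>+y. ennreal ((cmod (h y))\<^sup>2) \<partial>lborel) \<le> ennreal l" .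
  have "(LINT y|lborel. h y * cis (- 2 * pi * \<eta> * y)) = (LINT y|lborel. of_real l * (of_real (exp (- pi * (y / (1 / l))\<^sup>2)) * cis (2 * pi * y * (c - \<eta>))))"
  proof (intro Bochner_Integration.integral_cong refl)
    fix y
    have "cis (2 * pi * c * y) * cis (- 2 * pi * \<eta> * y) = cis (2 * pi * y * (c - \<eta>))" by (simp add: cis_mult algebra_simps)
    thus "h y * cis (- 2 * pi * \<eta> * y) = of_real l * (of_real (exp (- pi * (y / (1 / l))\<^sup>2)) * cis (2 * pi * y * (c - \<eta>)))"
      by (simp add: h_def mult.assoc mult.commute[of y l])
  qed
  also have "\<dots> = of_real l * of_real (1 / l * exp (- pi * (1 / l * (c - \<eta>))\<^sup>2))"
    unfolding integral_mult_right_zero gaussian_fourier[OF l'] ..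
  also have "\<dots> = of_real (exp (- pi * ((\<eta> - c) / l)\<^sup>2))" using l by (simp add: power2_commute power_divide)
  finally show "(LINT y|lborel. h y * cis (- 2 * pi * \<eta> * y)) = of_real (exp (- pi * ((\<eta> - c) / l)\<^sup>2))" .
qed

text \<open>An eighth of a turn is \<open>pi / 4\<close>, which is less than
  \<open>pi / 3\<close>.\<close>

lemma cos_ge_half:
  fixes t :: real
  assumes "\<bar>t\<bar> \<le> 1 / 8"
  shows "1 / 2 \<le> cos (2 * pi * t)"
proof -
  have "cos (pi / 3) \<le> cos \<bar>2 * pi * t\<bar>"
    using assms by (intro cos_monotone_0_pi_le) (auto simp: abs_mult)
  thus ?thesis by (simp add: cos_60)
qed

section \<open>Lower bound from a family of packets in phase\<close>

context annulus_multiplier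
begin

text \<open>On Omega all plane waves occurring in the test function have the same phase tau up to 1/8, so that they do not cancel.\<close>

lemma op_norm_lower_bound:
  fixes S :: "int set" and c :: "int \<Rightarrow> real" and \<tau> :: "real \<times> real \<Rightarrow> real"
  assumes S: "finite S" "S \<noteq> {}" and l: "l > 0" and w: "0 < w" "w \<le> 1"
    and nonneg: "\<And>k \<eta>. 0 \<le> m k \<eta>"
    and plateau: "\<And>k \<eta>. k \<in> S \<Longrightarrow> \<bar>\<eta> - c k\<bar> \<le> w * l \<Longrightarrow> m k \<eta> = 1"
    and \<Omega>: "\<Omega> \<in> sets cylinder" "emeasure cylinder \<Omega> = ennreal \<mu>" "\<mu> > 0"
    and phase: "\<And>z k \<eta>. z \<in> \<Omega> \<Longrightarrow> k \<in> S \<Longrightarrow> m k \<eta> \<noteq> 0 \<Longrightarrow> \<bar>real_of_int k * fst z + \<eta> * snd z - \<tau> z\<bar> \<le> 1 / 8"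
    and p: "p > 0"
  shows "ennreal (w * exp (- pi) * sqrt (real (card S) * l) * \<mu> powr enn2real (1 / p)) \<le> op_norm_L2_Lp p (\<lambda>f. synthesis (fourier_cyl f))"
proof -
  define N where "N = real (card S)"
  have N: "N > 0" using S by (simp add: N_def card_gt_0_iff)
  \<comment> \<open>Normalisation: the packets have distinct \<open>k\<close>, hence are orthogonal,
    and each has squared norm at most \<open>l\<close>.\<close>
  define s where "s = 1 / sqrt (N * l)"
  have s: "s > 0" "s\<^sup>2 * (N * l) = 1" using N l by (auto simp: s_def power_divide)
  define h where "h k y = of_real (l * exp (- pi * (l * y)\<^sup>2)) * cis (2 * pi * c k * y)" for k y
  define G where "G k \<eta> = exp (- pi * ((\<eta> - c k) / l)\<^sup>2)" for k \<eta>
  define f where "f = (\<lambda>(x, y). \<Sum>k\<in>S. (of_real s * h k y) * cis (2 * pi * real_of_int k * x))"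
  note H = gaussian_wave_packet[OF l, of "c _", folded h_def G_def]
  have hm [measurable]: "h k \<in> borel_measurable borel" for k unfolding h_def by measurable
  have Gm [measurable]: "G k \<in> borel_measurable borel" for k unfolding G_def by measurable
  have fm [measurable]: "f \<in> borel_measurable cylinder"
    unfolding f_def case_prod_beta' using measurable_compose[OF measurable_cylinder_fst_snd(2) hm] by measurable
  have f1: "(\<integral>\<^sup>+z. ennreal ((cmod (f z))\<^sup>2) \<partial>cylinder) \<le> 1"
  proof -
    have "(\<integral>\<^sup>+z. ennreal ((cmod (f z))\<^sup>2) \<partial>cylinder) = (\<integral>\<^sup>+y. (\<Sum>k\<in>S. ennreal (s\<^sup>2) * ennreal ((cmod (h k y))\<^sup>2)) \<partial>lborel)"
      by (subst nn_integral_cylinder) (auto simp: f_def parseval_circle[OF S(1)] norm_mult power_mult_distrib sum_ennreal ennreal_mult simp flip: sum_ennreal)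
    also have "\<dots> = (\<Sum>k\<in>S. ennreal (s\<^sup>2) * (\<integral>\<^sup>+y. ennreal ((cmod (h k y))\<^sup>2) \<partial>lborel))"
      by (simp add: nn_integral_sum nn_integral_cmult)
    also have "\<dots> \<le> (\<Sum>k\<in>S. ennreal (s\<^sup>2) * ennreal l)" by (intro sum_mono mult_left_mono H(2)) auto
    also have "\<dots> = ennreal (\<Sum>k\<in>S. s\<^sup>2 * l)" using l by (subst sum_ennreal[symmetric]) (auto simp only: ennreal_mult zero_le_power2 mult_nonneg_nonneg less_imp_le)
    also have "(\<Sum>k\<in>S. s\<^sup>2 * l) = 1" using s(2) by (simp add: N_def mult_ac)
    finally show ?thesis by simp
  qed
  have f2: "f \<in> {f \<in> Lp_space cylinder 2. Lp_norm cylinder 2 f \<le> 1}"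
    using fm f1 by (auto simp: Lp_space_def Lp_norm_2_le_1_iff[THEN iffD2] intro: le_less_trans[OF _ ennreal_one_less_top])
  then interpret syn: annulus_synthesis m lam \<delta> D "fourier_cyl f"
    by (intro annulus_synthesis_fourier_cyl annulus_multiplier_axioms) auto
  \<comment> \<open>Equality holds almost everywhere only, because
    \<open>fourier_transform_L2\<close> picks a representative; the synthesis integrates it
    away.\<close>
  have ft: "AE \<eta> in lborel. fourier_cyl f k \<eta> = (if k \<in> S then of_real (s * G k \<eta>) else 0)" for k
  proof -
    have coeff: "fourier_coeff_x f k = (\<lambda>y. if k \<in> S then of_real s * h k y else 0)"
      unfolding f_def using fourier_coeff_x_trigonometric[OF S(1), of "\<lambda>k y. of_real s * h k y" k] by auto
    show ?thesis
    proof (cases "k \<in> S")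
      case True
      have int: "integrable lborel (\<lambda>y. of_real s * h k y)" by (intro integrable_mult_right H(1))
      have "(\<integral>\<^sup>+y. ennreal ((cmod (of_real s * h k y))\<^sup>2) \<partial>lborel) = ennreal (s\<^sup>2) * (\<integral>\<^sup>+y. ennreal ((cmod (h k y))\<^sup>2) \<partial>lborel)"
        by (subst nn_integral_cmult[symmetric]) (auto simp: norm_mult power_mult_distrib ennreal_mult)
      also have "\<dots> \<le> ennreal (s\<^sup>2) * ennreal l" by (intro mult_left_mono H(2)) auto
      also have "\<dots> < \<infinity>" by (simp add: ennreal_mult_less_top)
      finally have fin: "(\<integral>\<^sup>+y. ennreal ((cmod (of_real s * h k y))\<^sup>2) \<partial>lborel) < \<infinity>" .
      have "AE \<eta> in lborel. fourier_transform_L2 (\<lambda>y. of_real s * h k y) \<eta> = (LINT y|lborel. of_real s * h k y * cis (- 2 * pi * \<eta> * y))"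
        by (rule fourier_transform_L2_integrable[OF int fin])
      moreover have "(LINT y|lborel. of_real s * h k y * cis (- 2 * pi * \<eta> * y)) = of_real (s * G k \<eta>)" for \<eta>
        unfolding mult.assoc[of "of_real s"] integral_mult_right_zero H(3) of_real_mult ..
      ultimately show ?thesis using True unfolding fourier_cyl_def coeff by simp
    next
      case False
      have "AE \<eta> in lborel. fourier_transform_L2 (\<lambda>y. 0) \<eta> = (LINT y|lborel. (0::complex) * cis (- 2 * pi * \<eta> * y))"
        by (rule fourier_transform_L2_integrable) auto
      thus ?thesis using False unfolding fourier_cyl_def coeff by simp
    qed
  qed
  have Gb: "0 \<le> G k \<eta>" "G k \<eta> \<le> 1" for k \<eta> by (simp_all add: G_def)
  have mGi: "integrable lborel (\<lambda>\<eta>. m k \<eta> * (s * G k \<eta>))" for k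
  proof -
    have "integrable lborel (\<lambda>\<eta>. s * G k \<eta>)" unfolding G_def by (intro integrable_mult_right gaussian_integrable(1) l)
    thus ?thesis by (rule Bochner_Integration.integrable_bound) (use m_le_1 Gb s in \<open>auto simp: abs_mult mult_left_le_one_le\<close>)
  qed
  have SF: "S \<subseteq> freqs"
  proof
    fix k assume "k \<in> S"
    hence "m k (c k) = 1" using w l by (intro plateau) auto
    hence "\<not> lam + D < \<bar>real_of_int k\<bar>" using far[of k "c k"] by auto
    thus "k \<in> freqs" unfolding freqs_def by (auto simp: abs_le_iff) linarith+
  qed
  have val: "synthesis (fourier_cyl f) z = (\<Sum>k\<in>S. LINT \<eta>|lborel. of_real (m k \<eta> * (s * G k \<eta>)) * cis (2 * pi * (real_of_int k * fst z + \<eta> * snd z)))" for z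
  proof -
    have "(LINT \<eta>|lborel. of_real (m k \<eta>) * fourier_cyl f k \<eta> * cis (2 * pi * (of_int k * fst z + \<eta> * snd z)))
      = (LINT \<eta>|lborel. of_real (m k \<eta>) * (if k \<in> S then of_real (s * G k \<eta>) else 0) * cis (2 * pi * (of_int k * fst z + \<eta> * snd z)))" for k
    proof (rule integral_cong_AE)
      show "AE \<eta> in lborel. of_real (m k \<eta>) * fourier_cyl f k \<eta> * cis (2 * pi * (of_int k * fst z + \<eta> * snd z))
        = of_real (m k \<eta>) * (if k \<in> S then of_real (s * G k \<eta>) else 0) * cis (2 * pi * (of_int k * fst z + \<eta> * snd z))"
        using ft[of k] by eventually_elim simp
      show "(\<lambda>\<eta>. of_real (m k \<eta>) * fourier_cyl f k \<eta> * cis (2 * pi * (of_int k * fst z + \<eta> * snd z))) \<in> borel_measurable lborel"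
        using syn.\<phi>_measurable by simp
    qed (cases "k \<in> S"; simp)
    hence "synthesis (fourier_cyl f) z = (\<Sum>k\<in>freqs. LINT \<eta>|lborel. of_real (m k \<eta>) * (if k \<in> S then of_real (s * G k \<eta>) else 0) * cis (2 * pi * (of_int k * fst z + \<eta> * snd z)))"
      by (simp add: synthesis_eq)
    also have "\<dots> = (\<Sum>k\<in>S. LINT \<eta>|lborel. of_real (m k \<eta>) * (if k \<in> S then of_real (s * G k \<eta>) else 0) * cis (2 * pi * (of_int k * fst z + \<eta> * snd z)))"
      using SF finite_freqs by (intro sum.mono_neutral_right) auto
    also have "\<dots> = (\<Sum>k\<in>S. LINT \<eta>|lborel. of_real (m k \<eta> * (s * G k \<eta>)) * cis (2 * pi * (real_of_int k * fst z + \<eta> * snd z)))"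
      by (intro sum.cong refl) (simp add: mult_ac)
    finally show ?thesis .
  qed
  \<comment> \<open>On the plateau, of length \<open>2 * w * l\<close>, the symbol is 1 and the
    Gaussian is at least \<open>exp (- pi)\<close> because \<open>w \<le> 1\<close>.\<close>
  have mass: "s * (2 * w * l * exp (- pi)) \<le> (LINT \<eta>|lborel. m k \<eta> * (s * G k \<eta>))" if k: "k \<in> S" for k
  proof -
    have "(LINT \<eta>|lborel. s * exp (- pi) * indicator {c k - w * l..c k + w * l} \<eta>) \<le> (LINT \<eta>|lborel. m k \<eta> * (s * G k \<eta>))"
    proof (rule integral_mono[OF _ mGi])
      show "integrable lborel (\<lambda>\<eta>. s * exp (- pi) * indicator {c k - w * l..c k + w * l} \<eta> :: real)"
        using w l by (intro integrable_mult_right) auto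
      fix \<eta>
      show "s * exp (- pi) * indicator {c k - w * l..c k + w * l} \<eta> \<le> m k \<eta> * (s * G k \<eta>)"
      proof (cases "\<eta> \<in> {c k - w * l..c k + w * l}")
        case True
        hence d: "\<bar>\<eta> - c k\<bar> \<le> w * l" by (auto simp: abs_le_iff)
        also have "\<dots> \<le> 1 * l" using w l by (intro mult_right_mono) auto
        finally have "\<bar>(\<eta> - c k) / l\<bar> \<le> 1" using l by (simp add: field_simps)
        hence "((\<eta> - c k) / l)\<^sup>2 \<le> 1" by (simp only: abs_square_le_1)
        hence "pi * ((\<eta> - c k) / l)\<^sup>2 \<le> pi * 1" by (intro mult_left_mono) auto
        hence "exp (- pi) \<le> G k \<eta>" unfolding G_def by simp
        thus ?thesis using True plateau[OF k d] s by simp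
      qed (use nonneg s Gb in auto)
    qed
    moreover have "(LINT \<eta>|lborel. s * exp (- pi) * indicator {c k - w * l..c k + w * l} \<eta>) = s * (2 * w * l * exp (- pi))"
      using mult_nonneg_nonneg[of w l] w l by simp
    ultimately show ?thesis by (simp only:)
  qed
  \<comment> \<open>After rotation by the common phase, each integrand has real part at least half
    its modulus. The masses add up, and \<open>s * (N * l) = sqrt (N * l)\<close>.\<close>
  have lower: "w * exp (- pi) * sqrt (N * l) \<le> cmod (synthesis (fourier_cyl f) z)" if z: "z \<in> \<Omega>" for z
  proof -
    define t where "t k \<eta> = real_of_int k * fst z + \<eta> * snd z" for k \<eta>
    have ci: "integrable lborel (\<lambda>\<eta>. complex_of_real (m k \<eta> * (s * G k \<eta>)) * cis (2 * pi * (t k \<eta> - \<tau> z)))" for k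
      by (rule Bochner_Integration.integrable_bound[OF mGi[of k]]) (auto simp: t_def norm_mult)
    have "cis (- 2 * pi * \<tau> z) * synthesis (fourier_cyl f) z = (\<Sum>k\<in>S. LINT \<eta>|lborel. of_real (m k \<eta> * (s * G k \<eta>)) * cis (2 * pi * (t k \<eta> - \<tau> z)))"
      unfolding val sum_distrib_left integral_mult_right_zero[symmetric]
    proof (intro sum.cong refl Bochner_Integration.integral_cong)
      fix k \<eta>
      have "cis (- 2 * pi * \<tau> z) * cis (2 * pi * (real_of_int k * fst z + \<eta> * snd z)) = cis (2 * pi * (t k \<eta> - \<tau> z))"
        by (simp add: t_def cis_mult algebra_simps)
      thus "cis (- 2 * pi * \<tau> z) * (of_real (m k \<eta> * (s * G k \<eta>)) * cis (2 * pi * (real_of_int k * fst z + \<eta> * snd z)))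
         = of_real (m k \<eta> * (s * G k \<eta>)) * cis (2 * pi * (t k \<eta> - \<tau> z))"
        unfolding mult.left_commute[of "cis (- 2 * pi * \<tau> z)" "of_real _"] by (simp only:)
    qed
    hence "Re (cis (- 2 * pi * \<tau> z) * synthesis (fourier_cyl f) z) = (\<Sum>k\<in>S. LINT \<eta>|lborel. m k \<eta> * (s * G k \<eta>) * cos (2 * pi * (t k \<eta> - \<tau> z)))"
      using integral_Re[OF ci] by simp
    moreover have "Re (cis (- 2 * pi * \<tau> z) * synthesis (fourier_cyl f) z) \<le> cmod (synthesis (fourier_cyl f) z)"
      using complex_Re_le_cmod[of "cis (- 2 * pi * \<tau> z) * synthesis (fourier_cyl f) z"] by (simp add: norm_mult)
    moreover have "(\<Sum>k\<in>S. s * (w * l * exp (- pi))) \<le> (\<Sum>k\<in>S. LINT \<eta>|lborel. m k \<eta> * (s * G k \<eta>) * cos (2 * pi * (t k \<eta> - \<tau> z)))"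
    proof (rule sum_mono)
      fix k assume k: "k \<in> S"
      have "s * (w * l * exp (- pi)) = 1 / 2 * (s * (2 * w * l * exp (- pi)))" by simp
      also have "\<dots> \<le> 1 / 2 * (LINT \<eta>|lborel. m k \<eta> * (s * G k \<eta>))" by (intro mult_left_mono mass k) simp
      also have "\<dots> = (LINT \<eta>|lborel. 1 / 2 * (m k \<eta> * (s * G k \<eta>)))" by simp
      also have "\<dots> \<le> (LINT \<eta>|lborel. m k \<eta> * (s * G k \<eta>) * cos (2 * pi * (t k \<eta> - \<tau> z)))"
      proof (rule integral_mono)
        show "integrable lborel (\<lambda>\<eta>. 1 / 2 * (m k \<eta> * (s * G k \<eta>)))" by (intro integrable_mult_right mGi)
        show "integrable lborel (\<lambda>\<eta>. m k \<eta> * (s * G k \<eta>) * cos (2 * pi * (t k \<eta> - \<tau> z)))"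
          using integrable_Re[OF ci[of k]] by simp
        fix \<eta>
        show "1 / 2 * (m k \<eta> * (s * G k \<eta>)) \<le> m k \<eta> * (s * G k \<eta>) * cos (2 * pi * (t k \<eta> - \<tau> z))"
        proof (cases "m k \<eta> = 0")
          case False
          have "1 / 2 \<le> cos (2 * pi * (t k \<eta> - \<tau> z))" using phase[OF z k False] unfolding t_def by (rule cos_ge_half)
          moreover have "0 \<le> m k \<eta> * (s * G k \<eta>)" using nonneg s Gb by simp
          ultimately have "(m k \<eta> * (s * G k \<eta>)) * (1 / 2) \<le> (m k \<eta> * (s * G k \<eta>)) * cos (2 * pi * (t k \<eta> - \<tau> z))" by (rule mult_left_mono)
          thus ?thesis by simp
        qed simp
      qed
      finally show "s * (w * l * exp (- pi)) \<le> (LINT \<eta>|lborel. m k \<eta> * (s * G k \<eta>) * cos (2 * pi * (t k \<eta> - \<tau> z)))" .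
    qed
    moreover have "(\<Sum>k\<in>S. s * (w * l * exp (- pi))) = w * exp (- pi) * sqrt (N * l)"
    proof -
      have "s * (N * l) = sqrt (N * l)" using N l by (simp add: s_def real_div_sqrt)
      hence "w * exp (- pi) * (s * (N * l)) = w * exp (- pi) * sqrt (N * l)" by simp
      thus ?thesis by (simp add: N_def mult_ac)
    qed
    ultimately show ?thesis by linarith
  qed
  have "ennreal (w * exp (- pi) * sqrt (N * l) * \<mu> powr enn2real (1 / p)) \<le> Lp_norm cylinder p (synthesis (fourier_cyl f))"
    using w N l by (intro Lp_norm_ge_on_set[OF syn.synthesis_measurable \<Omega> p _ lower]) auto
  also have "\<dots> \<le> op_norm_L2_Lp p (\<lambda>f. synthesis (fourier_cyl f))"
    unfolding op_norm_L2_Lp_def using f2 by (intro SUP_upper)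
  finally show ?thesis by (simp add: N_def)
qed

end

section \<open>The two extremal configurations\<close>

text \<open>Expresses all exponents through one real parameter \<open>q\<close>, equal to 0 at
  infinity, so that finite and infinite \<open>p\<close> share the computation.\<close>

lemma enn2real_exponents:
  fixes p :: ennreal
  assumes "2 < p"
  defines "q \<equiv> enn2real (1 / p)"
  shows "0 \<le> q" "q \<le> 1" "enn2real (2 / p) = 2 * q" "enn2real (1 / (2 * p)) = q / 2"
proof -
  have "0 \<le> q \<and> q \<le> 1 \<and> enn2real (2 / p) = 2 * q \<and> enn2real (1 / (2 * p)) = q / 2"
  proof (cases p)
    case top
    thus ?thesis by (simp add: q_def ennreal_mult_top)
  next
    case (real P)
    have P: "P > 2" using assms(1) real by (simp flip: ennreal_numeral add: ennreal_less_iff)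
    have "1 / ennreal P = ennreal (1 / P)" "2 / ennreal P = ennreal (2 / P)"
      using P by (simp_all add: divide_ennreal flip: ennreal_1 ennreal_numeral)
    moreover have "1 / (2 * ennreal P) = ennreal (1 / (2 * P))"
    proof -
      have "2 * ennreal P = ennreal (2 * P)" using P by (simp add: ennreal_mult)
      thus ?thesis using P by (simp add: divide_ennreal flip: ennreal_1)
    qed
    ultimately show ?thesis using P real by (simp add: q_def)
  qed
  thus "0 \<le> q" "q \<le> 1" "enn2real (2 / p) = 2 * q" "enn2real (1 / (2 * p)) = q / 2" by auto
qed

lemma emeasure_cylinder_rectangle:
  assumes "0 \<le> a" "a \<le> 1" "0 \<le> b"
  shows "{0..a} \<times> {- b..b} \<in> sets cylinder" "emeasure cylinder ({0..a} \<times> {- b..b}) = ennreal (a * (2 * b))"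
proof -
  have s: "{0..a} \<in> sets circle" using assms by (auto simp: sets_restrict_space_iff)
  show "{0..a} \<times> {- b..b} \<in> sets cylinder" unfolding cylinder_def using s by (intro pair_measureI) auto
  have "emeasure cylinder ({0..a} \<times> {- b..b}) = emeasure circle {0..a} * emeasure lborel {- b..b}"
    unfolding cylinder_def using s by (intro lborel.emeasure_pair_measure_Times) auto
  also have "emeasure circle {0..a} = ennreal a" using assms by (subst emeasure_restrict_space) auto
  also have "emeasure lborel {- b..b} = ennreal (2 * b)" using assms by simp
  finally show "emeasure cylinder ({0..a} \<times> {- b..b}) = ennreal (a * (2 * b))" using assms by (simp add: ennreal_mult)
qed

lemma sqrt_sum_squares_lipschitz:
  fixes a b d :: real
  shows "\<bar>sqrt (a\<^sup>2 + b\<^sup>2) - sqrt (a\<^sup>2 + d\<^sup>2)\<bar> \<le> \<bar>b - d\<bar>"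
proof -
  have "\<bar>cmod (Complex a b) - cmod (Complex a d)\<bar> \<le> cmod (Complex a b - Complex a d)" by (rule norm_triangle_ineq3)
  also have "Complex a b - Complex a d = Complex 0 (b - d)" by (simp add: complex_eq_iff)
  finally show ?thesis by (simp add: cmod_def)
qed

text \<open>Both configurations live at the same integer radius and work for all
  \<open>\<delta>\<close>, so one \<open>lam'\<close> serves for the whole bound. The better of the
  two loses at most a factor 2 against the sum.\<close>

lemma spectral_projector_lower_bound:
  assumes chi: "cutoff chi" and p: "2 < p"
  shows "projector_bound_optimal chi p"
proof -
  obtain R where R1: "R \<ge> 1" and "\<forall>t. chi t \<noteq> 0 \<longrightarrow> \<bar>t\<bar> \<le> R" using cutoff_support[OF chi] by auto
  hence R: "R \<ge> 1" "\<And>t. chi t \<noteq> 0 \<Longrightarrow> \<bar>t\<bar> \<le> R" by simp_all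
  obtain r where r0: "r > 0" and "\<forall>t. \<bar>t\<bar> < r \<longrightarrow> chi t = 1" using cutoff_plateau[OF chi] by auto
  hence r: "\<And>t. \<bar>t\<bar> < r \<Longrightarrow> chi t = 1" by simp
  define D where "D = R * (2 + R)"
  have D: "D \<ge> 1" using R(1) mult_mono[of 1 R 1 "2 + R"] by (simp add: D_def)
  \<comment> \<open>Half the plateau radius, to stay strictly inside it, and at most 1 as
    \<open>op_norm_lower_bound\<close> requires.\<close>
  define w where "w = min 1 (r / 2)"
  have w: "0 < w" "w \<le> 1" "w < r" using r0 by (auto simp: w_def)
  \<comment> \<open>On the square of side about \<open>c / lam\<close> the phases in
    \<open>x\<close> are at most \<open>c\<close> and those in \<open>y\<close> at most
    \<open>(1 + D) * c\<close>, together at most 1/8.\<close>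
  define c where "c = 1 / (16 * (1 + D))"
  have c: "c > 0" "c \<le> 1 / 16" "(1 + D) * c = 1 / 16" using D by (auto simp: c_def field_simps)
  define q where "q = enn2real (1 / p)"
  note q = enn2real_exponents[OF p, folded q_def]
  define e1 where "e1 = w * exp (- pi) * (2 * c\<^sup>2)"
  define e2 where "e2 = w * exp (- pi) * (1 / (4 * sqrt D))"
  have e: "e1 > 0" "e2 > 0" using w c D by (auto simp: e1_def e2_def)
  have p0: "p > 0" using p by (auto intro: less_trans[rotated])
  \<comment> \<open>Replaces the constant \<open>x powr q\<close> by \<open>x\<close>, so that
    \<open>e1\<close> and \<open>e2\<close> do not depend on \<open>p\<close>.\<close>
  have pow: "x \<le> x powr q" if "0 < x" "x \<le> 1" for x :: real
    using that q powr_mono'[of q 1 x] by simp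
  have main: "ennreal (min e1 e2 / 2 * projector_bound p lam \<delta>) \<le> op_norm_L2_Lp p (spectral_projector chi lam \<delta>)"
    if lamn: "lam = real_of_int n" and lam1: "lam > 1" and \<delta>: "0 < \<delta>" "\<delta> < 1" for lam \<delta> n
  proof -
    interpret annulus_multiplier "annulus_symbol chi lam \<delta>" lam \<delta> D
      unfolding D_def by (rule annulus_multiplier_symbol[OF chi R lam1 \<delta>])
    have sp: "spectral_projector chi lam \<delta> = (\<lambda>f. synthesis (fourier_cyl f))"
      by (rule ext) (rule spectral_projector_eq_synthesis[OF annulus_multiplier_axioms])
    have nonneg: "0 \<le> annulus_symbol chi lam \<delta> k \<eta>" for k \<eta>
      using chi unfolding cutoff_def annulus_symbol_def by simp
    have plat: "annulus_symbol chi lam \<delta> k \<eta> = 1" if "\<bar>sqrt ((real_of_int k)\<^sup>2 + \<eta>\<^sup>2) - lam\<bar> \<le> w * \<delta>" for k \<eta>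
      unfolding annulus_symbol_def
    proof (rule r)
      have "\<bar>sqrt ((real_of_int k)\<^sup>2 + \<eta>\<^sup>2) - lam\<bar> < r * \<delta>" using that mult_strict_right_mono[OF w(3) \<delta>(1)] by linarith
      thus "\<bar>(sqrt ((real_of_int k)\<^sup>2 + \<eta>\<^sup>2) - lam) / \<delta>\<bar> < r" using \<delta> by (simp add: abs_divide field_simps)
    qed
    have n: "n > 0" using lamn lam1 by linarith
    have bound1: "ennreal (e1 * (lam powr (1 / 2 - 2 * q) * \<delta> powr (1 / 2))) \<le> op_norm_L2_Lp p (spectral_projector chi lam \<delta>)"
    proof -
      define a where "a = c / lam"
      have a: "0 < a" "a \<le> 1" "lam * a = c" using c lam by (auto simp: a_def field_simps)
      define S where "S = {0..n}"
      \<comment> \<open>The packets sit exactly on the circle of radius \<open>lam\<close>. The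
        radius is Lipschitz in \<open>\<eta>\<close>, so
        \<open>\<bar>\<eta> - ck k\<bar> \<le> w * \<delta>\<close> stays on the plateau.\<close>
      define ck where "ck k = sqrt (lam\<^sup>2 - (real_of_int k)\<^sup>2)" for k :: int
      have S: "finite S" "S \<noteq> {}" "real (card S) = lam + 1" using n by (auto simp: S_def lamn)
      have "ennreal (w * exp (- pi) * sqrt (real (card S) * \<delta>) * (a * (2 * a)) powr enn2real (1 / p)) \<le> op_norm_L2_Lp p (\<lambda>f. synthesis (fourier_cyl f))"
      proof (rule op_norm_lower_bound[OF S(1,2) \<delta>(1) w(1,2) nonneg, where c = ck and \<Omega> = "{0..a} \<times> {- a..a}" and \<tau> = "\<lambda>_. 0"])
        fix k \<eta> assume k: "k \<in> S" and near: "\<bar>\<eta> - ck k\<bar> \<le> w * \<delta>"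
        have "(real_of_int k)\<^sup>2 \<le> lam\<^sup>2" using k unfolding S_def lamn by (intro power_mono) auto
        hence "sqrt ((real_of_int k)\<^sup>2 + (ck k)\<^sup>2) = lam" using lam by (simp add: ck_def)
        hence "\<bar>sqrt ((real_of_int k)\<^sup>2 + \<eta>\<^sup>2) - lam\<bar> \<le> \<bar>\<eta> - ck k\<bar>" using sqrt_sum_squares_lipschitz[of "real_of_int k" \<eta> "ck k"] by simp
        thus "annulus_symbol chi lam \<delta> k \<eta> = 1" using near by (intro plat) linarith
      next
        fix z :: "real \<times> real" and k \<eta> assume z: "z \<in> {0..a} \<times> {- a..a}" and k: "k \<in> S" and nz: "annulus_symbol chi lam \<delta> k \<eta> \<noteq> 0"
        have "\<bar>\<eta>\<bar> \<le> lam + D" using annulus_support(2)[OF D lam1 \<delta>, of \<eta> "real_of_int k"] m_support[OF nz] by (simp add: add.commute)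
        also have "\<dots> \<le> lam + D * lam" using D lam by simp
        also have "\<dots> = (1 + D) * lam" by (simp add: algebra_simps)
        finally have \<eta>: "\<bar>\<eta>\<bar> \<le> (1 + D) * lam" .
        have zz: "\<bar>fst z\<bar> \<le> a" "\<bar>snd z\<bar> \<le> a" using z by auto
        have "\<bar>real_of_int k * fst z\<bar> \<le> lam * a" unfolding abs_mult using k zz a lamn by (intro mult_mono) (auto simp: S_def)
        moreover have "\<bar>\<eta> * snd z\<bar> \<le> ((1 + D) * lam) * a" unfolding abs_mult using \<eta> zz a lam D by (intro mult_mono) auto
        moreover have "((1 + D) * lam) * a = 1 / 16" using a(3) c(3) by (simp add: mult.assoc)
        ultimately show "\<bar>real_of_int k * fst z + \<eta> * snd z - 0\<bar> \<le> 1 / 8" using a(3) c(2) by linarith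
      qed (use emeasure_cylinder_rectangle[of a a] a p0 in auto)
      hence le: "ennreal (w * exp (- pi) * sqrt ((lam + 1) * \<delta>) * (a * (2 * a)) powr q) \<le> op_norm_L2_Lp p (spectral_projector chi lam \<delta>)"
        unfolding sp S(3) q_def .
      have "e1 * (lam powr (1 / 2 - 2 * q) * \<delta> powr (1 / 2)) \<le> w * exp (- pi) * sqrt ((lam + 1) * \<delta>) * (a * (2 * a)) powr q"
      proof -
        have "a * (2 * a) = (2 * c\<^sup>2) * (1 / lam\<^sup>2)" by (simp add: a_def power2_eq_square)
        hence "(a * (2 * a)) powr q = (2 * c\<^sup>2) powr q * (1 / lam\<^sup>2) powr q" using c lam by (simp only: powr_mult)
        also have "(1 / lam\<^sup>2) powr q = lam powr (- 2 * q)"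
        proof -
          have "1 / lam\<^sup>2 = lam powr (- 2)" using lam by (simp add: powr_minus divide_inverse)
          thus ?thesis by (simp only: powr_powr)
        qed
        finally have aq: "(a * (2 * a)) powr q = (2 * c\<^sup>2) powr q * lam powr (- 2 * q)" .
        have "c\<^sup>2 \<le> (1 / 16)\<^sup>2" using c by (intro power_mono) auto
        hence "2 * c\<^sup>2 \<le> 1" by (simp add: power2_eq_square)
        hence c2: "2 * c\<^sup>2 \<le> (2 * c\<^sup>2) powr q" using c by (intro pow) auto
        have "lam powr (1 / 2 - 2 * q) = lam powr (1 / 2) * lam powr (- 2 * q)" by (simp flip: powr_add)
        hence "e1 * (lam powr (1 / 2 - 2 * q) * \<delta> powr (1 / 2)) = w * exp (- pi) * sqrt (lam * \<delta>) * ((2 * c\<^sup>2) * lam powr (- 2 * q))"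
          using lam \<delta> by (simp add: e1_def real_sqrt_mult powr_half_sqrt mult_ac)
        also have "\<dots> \<le> w * exp (- pi) * sqrt ((lam + 1) * \<delta>) * ((2 * c\<^sup>2) powr q * lam powr (- 2 * q))"
          using c2 w lam \<delta> by (intro mult_mono mult_nonneg_nonneg) auto
        finally show ?thesis unfolding aq .
      qed
      from order_trans[OF ennreal_leI[OF this] le] show ?thesis .
    qed
    have bound2: "ennreal (e2 * (lam * \<delta>) powr (1 / 4 - q / 2)) \<le> op_norm_L2_Lp p (spectral_projector chi lam \<delta>)"
    proof -
      \<comment> \<open>On the tangent line \<open>k = lam\<close> the radius exceeds
        \<open>lam\<close> only quadratically in \<open>\<eta>\<close>, so a packet of this larger
        width still fits the plateau.\<close>
      define l where "l = sqrt (lam * \<delta>)"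
      have l: "l > 0" "l\<^sup>2 = lam * \<delta>" using lam \<delta> by (auto simp: l_def)
      \<comment> \<open>The symbol confines \<open>\<eta>\<close> to \<open>sqrt D * l\<close>, so
        the phase in \<open>y\<close> stays below 1/8 for \<open>\<bar>y\<bar> \<le> b\<close>. The
        coordinate \<open>x\<close> runs over the whole circle because \<open>lam * x\<close> is the
        common phase.\<close>
      define b where "b = 1 / (8 * (sqrt D * l))"
      have b: "b > 0" "sqrt D * l * b = 1 / 8" using D l by (auto simp: b_def)
      have "ennreal (w * exp (- pi) * sqrt (real (card {n}) * l) * (1 * (2 * b)) powr enn2real (1 / p)) \<le> op_norm_L2_Lp p (\<lambda>f. synthesis (fourier_cyl f))"
      proof (rule op_norm_lower_bound[OF _ _ l(1) w(1,2) nonneg, where c = "\<lambda>_. 0" and \<Omega> = "{0..1} \<times> {- b..b}" and \<tau> = "\<lambda>z. lam * fst z"])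
        fix k \<eta> assume k: "k \<in> {n}" and near: "\<bar>\<eta> - 0\<bar> \<le> w * l"
        define s where "s = sqrt (lam\<^sup>2 + \<eta>\<^sup>2)"
        have s: "s\<^sup>2 = lam\<^sup>2 + \<eta>\<^sup>2" by (simp add: s_def)
        have "lam = sqrt (lam\<^sup>2)" using lam by simp
        also have "\<dots> \<le> s" unfolding s_def by simp
        finally have ls: "lam \<le> s" .
        have "(s - lam) * lam \<le> (s - lam) * (s + lam)" using ls lam by (intro mult_left_mono) auto
        also have "\<dots> = \<eta>\<^sup>2" using s by (simp add: algebra_simps power2_eq_square)
        also have "\<dots> = \<bar>\<eta>\<bar>\<^sup>2" by simp
        also have "\<dots> \<le> (w * l)\<^sup>2" using near by (intro power_mono) auto
        also have "\<dots> = (w * w * \<delta>) * lam" using l by (simp add: power_mult_distrib power2_eq_square)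
        finally have "s - lam \<le> w * w * \<delta>" using lam by simp
        also have "\<dots> \<le> w * 1 * \<delta>" using w \<delta> by (intro mult_right_mono mult_left_mono) auto
        finally have "\<bar>s - lam\<bar> \<le> w * \<delta>" using ls by simp
        thus "annulus_symbol chi lam \<delta> k \<eta> = 1" using k lamn by (intro plat) (simp add: s_def)
      next
        fix z :: "real \<times> real" and k \<eta> assume z: "z \<in> {0..1} \<times> {- b..b}" and k: "k \<in> {n}" and nz: "annulus_symbol chi lam \<delta> k \<eta> \<noteq> 0"
        have "\<bar>\<eta>\<bar> \<le> sqrt D * l"
          using annulus_support(1)[OF D lam1 \<delta> m_support[OF nz]] k lamn unfolding l_def by (simp add: real_sqrt_mult mult.assoc)
        hence "\<bar>\<eta> * snd z\<bar> \<le> (sqrt D * l) * b" unfolding abs_mult using z D l by (intro mult_mono) auto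
        thus "\<bar>real_of_int k * fst z + \<eta> * snd z - lam * fst z\<bar> \<le> 1 / 8" using k lamn b(2) by simp
      qed (use emeasure_cylinder_rectangle[of 1 b] b p0 in auto)
      hence le: "ennreal (w * exp (- pi) * sqrt l * (2 * b) powr q) \<le> op_norm_L2_Lp p (spectral_projector chi lam \<delta>)"
        unfolding sp q_def by simp
      have "e2 * (lam * \<delta>) powr (1 / 4 - q / 2) \<le> w * exp (- pi) * sqrt l * (2 * b) powr q"
      proof -
        have "2 * b = (1 / (4 * sqrt D)) * (1 / l)" by (simp add: b_def)
        hence "(2 * b) powr q = (1 / (4 * sqrt D)) powr q * (1 / l) powr q" using D l by (simp only: powr_mult)
        also have "(1 / l) powr q = l powr (- q)" using l by (simp add: powr_divide powr_minus_divide)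
        finally have bq: "(2 * b) powr q = (1 / (4 * sqrt D)) powr q * l powr (- q)" .
        have "1 \<le> sqrt D" using D by simp
        hence D4: "1 \<le> 4 * sqrt D" by linarith
        have d: "1 / (4 * sqrt D) \<le> (1 / (4 * sqrt D)) powr q"
        proof (rule pow)
          show "0 < 1 / (4 * sqrt D)" using D by simp
          show "1 / (4 * sqrt D) \<le> 1" unfolding divide_le_eq_1 using D4 D by simp
        qed
        have "(lam * \<delta>) powr (1 / 4 - q / 2) = l powr (1 / 2 - q)"
          using lam \<delta> sqrt_powr[of "lam * \<delta>" "1 / 2 - q"] by (simp add: l_def diff_divide_distrib)
        also have "\<dots> = l powr (1 / 2) * l powr (- q)" by (simp flip: powr_add)
        also have "l powr (1 / 2) = sqrt l" using l by (simp add: powr_half_sqrt)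
        finally have "e2 * (lam * \<delta>) powr (1 / 4 - q / 2) = w * exp (- pi) * sqrt l * (1 / (4 * sqrt D) * l powr (- q))"
          by (simp add: e2_def)
        also have "\<dots> \<le> w * exp (- pi) * sqrt l * ((1 / (4 * sqrt D)) powr q * l powr (- q))"
          using d w l by (intro mult_left_mono mult_right_mono) auto
        finally show ?thesis unfolding bq .
      qed
      from order_trans[OF ennreal_leI[OF this] le] show ?thesis .
    qed
    define X Y where "X = lam powr (1 / 2 - 2 * q) * \<delta> powr (1 / 2)" and "Y = (lam * \<delta>) powr (1 / 4 - q / 2)"
    have XY: "X \<ge> 0" "Y \<ge> 0" by (auto simp: X_def Y_def)
    have "projector_bound p lam \<delta> = X + Y" unfolding projector_bound_def q X_def Y_def ..
    hence "min e1 e2 / 2 * projector_bound p lam \<delta> \<le> max (e1 * X) (e2 * Y)"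
    proof -
      have "min e1 e2 * X \<le> e1 * X" "min e1 e2 * Y \<le> e2 * Y" using XY by (auto intro!: mult_right_mono)
      hence "min e1 e2 * X + min e1 e2 * Y \<le> 2 * max (e1 * X) (e2 * Y)" by linarith
      thus ?thesis using \<open>projector_bound p lam \<delta> = X + Y\<close> by (simp add: algebra_simps)
    qed
    hence "ennreal (min e1 e2 / 2 * projector_bound p lam \<delta>) \<le> ennreal (max (e1 * X) (e2 * Y))" by (rule ennreal_leI)
    also have "\<dots> \<le> op_norm_L2_Lp p (spectral_projector chi lam \<delta>)"
      using bound1 bound2 unfolding X_def[symmetric] Y_def[symmetric] by (simp add: max_def)
    finally show ?thesis .
  qed
  show ?thesis unfolding projector_bound_optimal_def
  proof (intro exI[of _ "min e1 e2 / 2"] conjI allI impI)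
    show "0 < min e1 e2 / 2" using e by simp
    fix lam :: real assume lam: "1 < lam"
    show "\<exists>lam'\<in>{lam..lam + 1}. \<forall>\<delta>. 0 < \<delta> \<and> \<delta> < 1 \<longrightarrow>
        ennreal (min e1 e2 / 2 * projector_bound p lam' \<delta>) \<le> op_norm_L2_Lp p (spectral_projector chi lam' \<delta>)"
    \<comment> \<open>The ceiling is an integer in the window and is chosen before
      \<open>\<delta>\<close>, as the order of quantifiers demands.\<close>
    proof (intro bexI[of _ "real_of_int \<lceil>lam\<rceil>"] allI impI)
      show "real_of_int \<lceil>lam\<rceil> \<in> {lam..lam + 1}" by simp
      fix \<delta> :: real assume "0 < \<delta> \<and> \<delta> < 1"
      moreover have "real_of_int \<lceil>lam\<rceil> > 1" using lam le_of_int_ceiling[of lam] by linarith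
      ultimately show "ennreal (min e1 e2 / 2 * projector_bound p (real_of_int \<lceil>lam\<rceil>) \<delta>) \<le> op_norm_L2_Lp p (spectral_projector chi (real_of_int \<lceil>lam\<rceil>) \<delta>)"
        by (intro main[OF refl]) auto
    qed
  qed
qed

theorem theorem1p1:
  fixes p :: ennreal and chi :: "real \<Rightarrow> real"
  assumes "cutoff chi" and "2 < p"
  shows "(\<forall>\<epsilon>::real. \<epsilon> > 0 \<longrightarrow> (\<exists>C::real. C > 0 \<and> (\<forall>lam \<delta>. 1 < lam \<and> 0 < \<delta> \<and> \<delta> < 1 \<longrightarrow>
            op_norm_L2_Lp p (spectral_projector chi lam \<delta>)
              \<le> ennreal (C * lam powr \<epsilon> * \<delta> powr (- \<epsilon>) * projector_bound p lam \<delta>))))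
       \<and> projector_bound_optimal chi p"
  using spectral_projector_upper_bound[OF assms] spectral_projector_lower_bound[OF assms] by simp

end
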